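(* Let $T\ge 0$ be a random time with density $p_T$, independent of a standard Brownian motion $B$, let $X_1,\dots,X_n$ be i.i.d. copies of $X=B_T$, let $p_{T,n}$ be the estimator defined in the context with parameter $\max(a_T,3/4)<\gamma<b_T$ and bandwidth $h_n$, and let $x>0$. Suppose that $$\left.\frac{d}{du}\Bigl(\Gamma(2\gamma-3/2+\mathrm{i}u)\,\mathcal{M}[p_T](2\gamma-1+\mathrm{i}u)\Bigr)\right|_{u=0}\ne0$$ and $$\int_{-\infty}^\infty\bigl|\mathcal{M}[p_T](2\gamma-1+\mathrm{i}u)\bigr|\,du<\infty .$$ Then $$\rho_n^{-1}\bigl(p_{T,n}(x)-\mathbb{E}[p_{T,n}(x)]\bigr)\overset{\mathcal{D}}{\longrightarrow}\mathcal{N}(0,\sigma^2)$$ for some $\sigma^2>0$, where $$\rho_n=n^{-1/2}\,h_n^{\gamma-1}\,\log^{-1}(1/h_n)\,\exp\bigl[\pi/(2h_n)\bigr]\,(1+o(1))$$ and $h_n\asymp c\log^{-1}(n)$ for some $c>0$, as $n\to\infty$.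
   Context: For a non-negative random variable $\xi$ with density $p_\xi$, the Mellin transform is $\mathcal{M}[p_\xi](z)=\mathbb{E}[\xi^{z-1}]=\int_0^\infty p_\xi(x)x^{z-1}\,dx$ for $z\in\mathcal{S}_\xi=\{z\in\mathbb{C}:\mathbb{E}[\xi^{\mathrm{Re}\,z-1}]<\infty\}$. It is assumed that $0\le a_T<1\le b_T$ are such that $\{z: a_T<\mathrm{Re}(z)<b_T\}\subset\mathcal{S}_T$. The estimator of $p_T$ (kernel $1_{[-1,1]}$, bandwidth $h_n>0$, $h_n\to0$) is $$p_{T,n}(x)=\frac{1}{\sqrt\pi}\int_{-1/h_n}^{1/h_n}\Bigl[\frac1n\sum_{k=1}^n|X_k|^{2(\gamma+\mathrm{i}v-1)}\Bigr]\frac{x^{-\gamma-\mathrm{i}v}}{2^{\gamma+\mathrm{i}v}\,\Gamma(\gamma-1/2+\mathrm{i}v)}\,dv .$$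
   Formalization: The formal theorem also assumes that 2γ−1 lies in S_T (so the Mellin transform on that line is defined) and 2γ−1 < b_T; this excludes only γ > 1 with 2γ−1 the right boundary point of S_T, where the stated normalisation can fail. *)

theory Defs
  imports "HOL-Probability.Probability" "HOL-Library.Landau_Symbols"
begin

text \<open>Only the values \<open>B t\<close> with \<open>t \<ge> 0\<close> are relevant.\<close>

definition standard_brownian_motion :: "'a measure \<Rightarrow> (real \<Rightarrow> 'a \<Rightarrow> real) \<Rightarrow> bool" where
  "standard_brownian_motion M B \<longleftrightarrow>
     prob_space M \<and>
     (\<forall>t\<ge>0. B t \<in> borel_measurable M) \<and>
     (AE \<omega> in M. B 0 \<omega> = 0) \<and>
     (\<forall>\<omega>\<in>space M. continuous_on {0..} (\<lambda>t. B t \<omega>)) \<and>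
     (\<forall>s t. 0 \<le> s \<longrightarrow> s < t \<longrightarrow>
        distributed M lborel (\<lambda>\<omega>. B t \<omega> - B s \<omega>) (normal_density 0 (sqrt (t - s)))) \<and>
     (\<forall>(m::nat) (t::nat \<Rightarrow> real). 0 \<le> t 0 \<longrightarrow> mono t \<longrightarrow>
        prob_space.indep_vars M (\<lambda>_. borel) (\<lambda>i \<omega>. B (t (Suc i)) \<omega> - B (t i) \<omega>) {..<m})"

text \<open>The set \<open>S_\<xi>\<close> for a non-negative \<open>\<xi>\<close>. Since \<open>0 powr a = 0\<close>, this agrees with the
  usual convention only when \<open>\<xi> > 0\<close> almost surely, e.g. when \<open>\<xi>\<close> has a density.\<close>

definition mellin_domain :: "'a measure \<Rightarrow> ('a \<Rightarrow> real) \<Rightarrow> complex set" where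
  "mellin_domain M \<xi> = {z. integrable M (\<lambda>\<omega>. \<xi> \<omega> powr (Re z - 1))}"

definition mellin :: "(real \<Rightarrow> real) \<Rightarrow> complex \<Rightarrow> complex" where
  "mellin p z = (CLBINT x:{0<..}. complex_of_real (p x) * complex_of_real x powr (z - 1))"

text \<open>\<open>Y k\<close>, \<open>1 \<le> k \<le> n\<close>, are the observed values and \<open>h\<close> is the bandwidth. The integral is
  real, because the integrand at \<open>-v\<close> is the complex conjugate of the integrand at \<open>v\<close>; \<open>Re\<close>
  only changes the type (see \<open>of_real_pT_estimator\<close>).\<close>

definition pT_estimator_integrand ::
  "real \<Rightarrow> nat \<Rightarrow> (nat \<Rightarrow> real) \<Rightarrow> real \<Rightarrow> real \<Rightarrow> complex" where
  "pT_estimator_integrand \<gamma> n Y x v =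
     (1 / of_nat n * (\<Sum>k=1..n. complex_of_real \<bar>Y k\<bar> powr (2 * (of_real \<gamma> + \<i> * of_real v - 1)))) *
     (complex_of_real x powr (- of_real \<gamma> - \<i> * of_real v) /
       (2 powr (of_real \<gamma> + \<i> * of_real v) * Gamma (of_real \<gamma> - 1/2 + \<i> * of_real v)))"

definition pT_estimator :: "real \<Rightarrow> real \<Rightarrow> nat \<Rightarrow> (nat \<Rightarrow> real) \<Rightarrow> real \<Rightarrow> real" where
  "pT_estimator \<gamma> h n Y x =
     Re (1 / complex_of_real (sqrt pi) * (CLBINT v:{-1/h..1/h}. pT_estimator_integrand \<gamma> n Y x v))"

lemma cnj_pT_estimator_integrand:
  assumes "x > 0"
  shows "cnj (pT_estimator_integrand \<gamma> n Y x v) = pT_estimator_integrand \<gamma> n Y x (- v)"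
  using assms by (simp add: pT_estimator_integrand_def cnj_powr cnj_Gamma)

lemma of_real_pT_estimator:
  assumes "x > 0"
  shows "complex_of_real (pT_estimator \<gamma> h n Y x) =
    1 / complex_of_real (sqrt pi) * (CLBINT v:{-1/h..1/h}. pT_estimator_integrand \<gamma> n Y x v)"
proof -
  let ?f = "pT_estimator_integrand \<gamma> n Y x"
  let ?I = "CLBINT v:{-1/h..1/h}. ?f v"
  have "cnj ?I = (CLBINT v:{-1/h..1/h}. cnj (?f v))"
    unfolding set_lebesgue_integral_def by (simp flip: Bochner_Integration.integral_cnj)
  also have "\<dots> = (CLBINT v:{-1/h..1/h}. ?f (- v))"
    using assms by (simp add: cnj_pT_estimator_integrand)
  also have "\<dots> = ?I"
    unfolding set_lebesgue_integral_def
    by (subst lborel_integral_real_affine[where c = "-1" and t = 0])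
       (auto intro!: Bochner_Integration.integral_cong simp: indicator_def)
  finally have "cnj (1 / complex_of_real (sqrt pi) * ?I) = 1 / complex_of_real (sqrt pi) * ?I"
    by simp
  then show ?thesis
    unfolding pT_estimator_def by (metis Reals_cnj_iff of_real_Re)
qed

end

theory Submission
  imports Defs
begin

text \<open>
  Write \<open>V = 1 / h\<close>, \<open>L = ln V\<close> and \<open>\<alpha> = \<gamma> - 1/2\<close>. The estimator is the mean over the observations \<open>r\<close> of the
  scores \<open>K \<bar>r\<bar> powr (2 \<gamma> - 2) J V y\<close>, where \<open>K\<close> depends only on \<open>\<gamma>\<close> and \<open>x\<close>, \<open>y = 2 ln \<bar>r\<bar> - ln (2 x)\<close>, and \<open>J V y\<close> is
  the integral of \<open>exp (\<i> v y) / \<Gamma>(\<alpha> + \<i> v)\<close> over \<open>[-V, V]\<close> (\<open>pT_estimator_eq_mean_score\<close>). So everything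
  depends on the behaviour of \<open>J V y\<close> for large \<open>V\<close>.

  The modulus of \<open>1 / \<Gamma>(\<alpha> + \<i> v)\<close> grows like \<open>A v = v powr (1/2 - \<alpha>) exp (\<pi> v / 2)\<close>, while its phase rotates with
  speed \<open>- ln v\<close>. Both facts come from an expansion of the Digamma function. Hence the integral is concentrated
  near the two ends of \<open>[-V, V]\<close>, and an integration by parts shows that \<open>J V y\<close> is close to twice the real part of
  \<open>exp (\<i> V y) / \<Gamma>(\<alpha> + \<i> V)\<close> divided by \<open>\<pi> / 2 + \<i> (y - L)\<close> (\<open>rGamma_wave_integral_asymptotics\<close>). The denominator
  has order \<open>L\<close>, which is the origin of the logarithm in the rate. After multiplication by \<open>L / A V\<close> the integral
  is bounded by a multiple of \<open>1 + max 0 y\<close>, uniformly in \<open>V\<close>, and for fixed \<open>y\<close> it approaches a pure oscillation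
  \<open>2 Re (\<i> exp (\<i> V y) w)\<close> with \<open>\<bar>w\<bar>\<close> convergent to a positive limit.

  The uniform bound supplies one square integrable envelope for all normalised scores, because the observations
  have a moment of order slightly above \<open>4 \<gamma> - 4\<close>. For rows of independent variables with a common envelope, a
  central limit theorem needs nothing but convergence of the variances (\<open>weak_conv_iid_rows_dominated\<close>). The
  variances are computed from the pure oscillation: its square is half its squared modulus plus a term that
  oscillates twice as fast, and the latter vanishes in the limit by a Riemann-Lebesgue argument
  (\<open>score_asymptotic_moments\<close>). The limit variance is a positive multiple of \<open>E \<bar>X\<bar> powr (4 \<gamma> - 4)\<close>.

  The moments of \<open>X\<close> and the Riemann-Lebesgue property follow from the fact that \<open>X\<close> has the law of \<open>sqrt T\<close> times
  an independent standard normal variable (\<open>stopped_brownian_motion\<close>, \<open>normal_mixture_powr\<close>): the functions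
  \<open>\<bar>x\<bar> powr (s + \<i> u)\<close> are multiplicative, and the normal factor decays as \<open>u\<close> grows.
\<close>

section \<open>The reciprocal Gamma function on vertical lines\<close>

text \<open>The trapezoidal rule for \<open>1 / (w + t)\<close> on \<open>[0, 1]\<close>: the error function vanishes at \<open>0\<close> and its
  derivative is \<open>- s\<^sup>2 / (2 w (w + s)\<^sup>2)\<close>. Cubic decay in \<open>w\<close> makes the errors summable with a tail of
  order \<open>1 / \<bar>w\<bar>\<^sup>2\<close>, which is the precision needed for the Digamma function.\<close>

lemma norm_Ln_add_1_trapezoid:
  fixes w :: complex
  assumes "Re w > 0"
  shows "cmod (Ln (w + 1) - Ln w - (1 / w + 1 / (w + 1)) / 2) \<le> 1 / (2 * cmod w ^ 3)"
proof -
  define f where "f s = Ln (w + s) - Ln w - s * (1 / w + inverse (w + s)) * (1 / 2)" for s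
  define f' where "f' s = - (s\<^sup>2 / (2 * w * (w + s)\<^sup>2))" for s
  have re: "Re s \<ge> 0" "cmod s \<le> 1" if s: "s \<in> closed_segment 0 (1::complex)" for s
  proof -
    obtain u where u: "0 \<le> u" "u \<le> 1" "s = of_real u"
      using s unfolding closed_segment_def by (auto simp: scaleR_conv_of_real)
    then show "Re s \<ge> 0" "cmod s \<le> 1" by auto
  qed
  have w0: "w \<noteq> 0" using assms by auto
  have "cmod (f 1 - f 0) \<le> 1 / (2 * cmod w ^ 3) * cmod (1 - 0)"
  proof (rule field_differentiable_bound[where S = "closed_segment 0 1" and f' = f'])
    fix s :: complex assume s: "s \<in> closed_segment 0 1"
    have ws: "Re (w + s) > 0" using re[OF s] assms by simp
    then have ws0: "w + s \<noteq> 0" "w + s \<notin> \<real>\<^sub>\<le>\<^sub>0"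
      by (force simp: complex_nonpos_Reals_iff)+
    have "(f has_field_derivative (inverse (w + s) -
            (1 / w + inverse (w + s) - s * (inverse (w + s) * inverse (w + s))) * (1 / 2))) (at s)"
      unfolding f_def using ws0
      by (auto intro!: derivative_eq_intros)
    also have "inverse (w + s) - (1 / w + inverse (w + s) - s * (inverse (w + s) * inverse (w + s))) * (1 / 2) = f' s"
      unfolding f'_def using ws0(1) w0
      by (simp add: divide_simps power2_eq_square) (simp add: algebra_simps)
    finally show "(f has_field_derivative f' s) (at s within closed_segment 0 1)"
      by (rule has_field_derivative_at_within)
    have le: "cmod w \<le> cmod (w + s)"
    proof -
      obtain u where u: "0 \<le> u" "u \<le> 1" "s = of_real u"
        using s unfolding closed_segment_def by (auto simp: scaleR_conv_of_real)
      then show ?thesis using assms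
        by (auto simp: cmod_def intro!: real_sqrt_le_mono power_mono)
    qed
    have "cmod (f' s) = cmod s ^ 2 / (2 * cmod w * cmod (w + s) ^ 2)"
      unfolding f'_def by (simp add: norm_divide norm_mult norm_power)
    also have "\<dots> \<le> 1 ^ 2 / (2 * cmod w * cmod w ^ 2)"
      using le re[OF s] w0 by (intro frac_le mult_left_mono power_mono) auto
    finally show "cmod (f' s) \<le> 1 / (2 * cmod w ^ 3)"
      by (simp add: power3_eq_cube power2_eq_square mult.assoc)
  qed (auto simp: convex_closed_segment)
  then show ?thesis by (simp add: f_def inverse_eq_divide)
qed

lemma Ln_add_of_nat_minus_ln_tendsto_0:
  fixes z :: complex
  assumes "Re z > 0"
  shows "(\<lambda>m. Ln (z + of_nat m) - of_real (ln (real m))) \<longlonglongrightarrow> 0"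
proof -
  have "(\<lambda>m. z / of_nat m + 1) \<longlonglongrightarrow> 0 + 1"
    by (intro tendsto_intros lim_const_over_n)
  then have "(\<lambda>m. Ln (z / of_nat m + 1)) \<longlonglongrightarrow> Ln (0 + 1)"
    by (intro tendsto_intros) auto
  moreover have "eventually (\<lambda>m. Ln (z / of_nat m + 1) = Ln (z + of_nat m) - of_real (ln (real m))) sequentially"
    using eventually_gt_at_top[of 0]
  proof eventually_elim
    case (elim m)
    have "z / of_nat m + 1 \<noteq> 0"
      using assms elim by (auto simp: complex_eq_iff add_eq_0_iff field_simps)
    then have "Ln (of_real (real m) * (z / of_nat m + 1)) = of_real (ln (real m)) + Ln (z / of_nat m + 1)"
      using elim Ln_times_of_real[of "real m" "z / of_nat m + 1"] by simp
    also have "of_real (real m) * (z / of_nat m + 1) = z + of_nat m"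
      using elim by (simp add: field_simps)
    finally show ?case by simp
  qed
  ultimately show ?thesis by (auto intro: Lim_transform_eventually)
qed

text \<open>Digamma is the limit of \<open>ln m - (\<Sum>n<m. 1 / (z + n))\<close>. Comparing each summand with an increment of
  \<open>Ln\<close> by the trapezoidal rule leaves the boundary term \<open>- 1 / (2 z)\<close> and an error that is bounded by
  \<open>(\<Sum>n. 1 / \<bar>z + n\<bar>\<^sup>3) / 2\<close>.\<close>

lemma norm_Digamma_minus_Ln:
  fixes z :: complex
  assumes "Re z > 0" "Im z \<ge> 2"
  shows "cmod (Digamma z - Ln z + 1 / (2 * z)) \<le> 2 / (Im z)\<^sup>2"
proof -
  define v where "v = Im z"
  have v: "v \<ge> 2" using assms by (simp add: v_def)
  define t where "t n = Ln (z + of_nat n + 1) - Ln (z + of_nat n)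
      - (1 / (z + of_nat n) + 1 / (z + of_nat n + 1)) / 2" for n
  define S where "S m = of_real (ln (real m)) - (\<Sum>n<m. inverse (z + of_nat n)) - Ln z + 1 / (2 * z)" for m
  have sum_t: "(\<Sum>n<m. t n) = S m + (Ln (z + of_nat m) - of_real (ln (real m))) - 1 / (2 * (z + of_nat m))" for m
  proof (induction m)
    case 0
    show ?case by (simp add: S_def)
  next
    case (Suc m)
    define q where "q k = 1 / (z + of_nat k)" for k
    have q: "inverse (z + of_nat m) = q m" "1 / (z + of_nat m) = q m" "1 / (z + of_nat m + 1) = q (Suc m)"
      "1 / (2 * (z + of_nat k)) = q k / 2" for k
      by (simp_all add: q_def inverse_eq_divide add_ac)
    have "S (Suc m) = S m + of_real (ln (real (Suc m))) - of_real (ln (real m)) - q m"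
      by (simp add: S_def q)
    moreover have "t m = Ln (z + of_nat (Suc m)) - Ln (z + of_nat m) - (q m + q (Suc m)) / 2"
      by (simp add: t_def q_def add_ac)
    moreover have "(\<Sum>n<m. t n) = S m + (Ln (z + of_nat m) - of_real (ln (real m))) - q m / 2"
      using Suc.IH by (simp only: q)
    ultimately show ?case
      unfolding q by (simp add: add_divide_distrib)
  qed
  \<comment> \<open>Here \<open>\<bar>z + n\<bar> \<ge> v\<close> and \<open>\<bar>z + n\<bar>\<^sup>2 \<ge> n\<^sup>2 + v\<^sup>2 \<ge> (n + v)\<^sup>2 / 2\<close>; replacing one factor \<open>n + v\<close> by
       \<open>n + v - 1\<close> makes the bound telescope.\<close>
  have t_le: "cmod (t n) \<le> 1 / v * (1 / (real n + v - 1) - 1 / (real (Suc n) + v - 1))" for n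
  proof -
    have n0: "1 \<le> real n + v - 1" using v by linarith
    have "cmod (t n) \<le> 1 / (2 * cmod (z + of_nat n) ^ 3)"
      unfolding t_def using assms by (intro norm_Ln_add_1_trapezoid) simp
    also have "\<dots> \<le> 1 / (2 * (v * (((real n + v) * (real n + v - 1)) / 2)))"
    proof -
      have "v \<le> cmod (z + of_nat n)"
        using abs_Im_le_cmod[of "z + of_nat n"] by (simp add: v_def)
      moreover have "(real n + v) * (real n + v - 1) / 2 \<le> cmod (z + of_nat n) ^ 2"
      proof -
        have "0 \<le> (real n - v)\<^sup>2" by simp
        then have "(real n + v) * (real n + v - 1) / 2 \<le> (real n)\<^sup>2 + v\<^sup>2"
          using v by (simp add: power2_eq_square algebra_simps)
        also have "\<dots> \<le> (Re z + real n)\<^sup>2 + v\<^sup>2"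
          using assms by (intro add_right_mono power_mono) auto
        also have "\<dots> = cmod (z + of_nat n) ^ 2"
          by (simp add: cmod_power2 v_def)
        finally show ?thesis .
      qed
      ultimately have "v * ((real n + v) * (real n + v - 1) / 2) \<le> cmod (z + of_nat n) * cmod (z + of_nat n) ^ 2"
        using v n0 by (intro mult_mono) auto
      then have "v * ((real n + v) * (real n + v - 1) / 2) \<le> cmod (z + of_nat n) ^ 3"
        by (simp add: power3_eq_cube power2_eq_square)
      moreover have "0 < v * ((real n + v) * (real n + v - 1) / 2)"
        using v n0 by (intro mult_pos_pos divide_pos_pos) auto
      ultimately show ?thesis by (intro frac_le) auto
    qed
    also have "\<dots> = 1 / v * (1 / (real n + v - 1) - 1 / (real (Suc n) + v - 1))"
      using v n0 by (simp add: divide_simps)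
    finally show ?thesis .
  qed
  have "cmod (\<Sum>n<m. t n) \<le> 2 / v\<^sup>2" for m
  proof -
    have "cmod (\<Sum>n<m. t n) \<le> (\<Sum>n<m. 1 / v * (1 / (real n + v - 1) - 1 / (real (Suc n) + v - 1)))"
      by (intro order.trans[OF norm_sum] sum_mono t_le)
    also have "\<dots> = 1 / v * (1 / (v - 1) - 1 / (real m + v - 1))"
      unfolding sum_distrib_left[symmetric] by (subst sum_lessThan_telescope') simp
    also have "\<dots> \<le> 1 / v * (2 / v)"
    proof -
      have "1 / (v - 1) \<le> 2 / v" "1 / (real m + v - 1) \<ge> 0" using v by (auto simp: field_simps)
      then have "1 / (v - 1) - 1 / (real m + v - 1) \<le> 2 / v" by linarith
      then show ?thesis using v by (intro mult_left_mono) auto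
    qed
    finally show ?thesis by (simp add: power2_eq_square)
  qed
  moreover have "(\<lambda>m. \<Sum>n<m. t n) \<longlonglongrightarrow> Digamma z - Ln z + 1 / (2 * z)"
  proof -
    have "z \<noteq> 0" using assms by auto
    then have "S \<longlonglongrightarrow> Digamma z - Ln z + 1 / (2 * z)"
      unfolding S_def by (intro tendsto_intros Digamma_LIMSEQ)
    moreover have "(\<lambda>m. 1 / (2 * (z + of_nat m))) \<longlonglongrightarrow> 0"
      by (intro tendsto_divide_0[OF tendsto_const] tendsto_mult_filterlim_at_infinity[OF tendsto_const]
          tendsto_add_filterlim_at_infinity[OF tendsto_const tendsto_of_nat]) auto
    ultimately have "(\<lambda>m. S m + (Ln (z + of_nat m) - of_real (ln (real m))) - 1 / (2 * (z + of_nat m)))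
       \<longlonglongrightarrow> (Digamma z - Ln z + 1 / (2 * z)) + 0 - 0"
      using assms by (intro tendsto_intros Ln_add_of_nat_minus_ln_tendsto_0)
    then show ?thesis by (simp add: sum_t)
  qed
  ultimately show ?thesis
    unfolding v_def by (intro Lim_bounded[OF tendsto_norm]) auto
qed

text \<open>Both \<open>Ln z\<close> and \<open>1 / (2 z)\<close> are expanded around the point \<open>\<i> v\<close>, where the logarithm is explicit. The
  term \<open>(\<alpha> - 1/2) / v\<close> is the difference of the two first-order contributions.\<close>

lemma norm_Digamma_vertical_line:
  fixes \<alpha> v :: real
  assumes "\<alpha> > 0" "v \<ge> 2"
  shows "cmod (Digamma (of_real \<alpha> + \<i> * of_real v)
           - (of_real (ln v) + \<i> * of_real (pi / 2) - \<i> * of_real ((\<alpha> - 1/2) / v)))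
         \<le> (2 + \<alpha>\<^sup>2 + \<alpha>) / v\<^sup>2"
proof -
  define z where "z = of_real \<alpha> + \<i> * complex_of_real v"
  have z: "Re z = \<alpha>" "Im z = v" by (simp_all add: z_def)
  have iv0: "\<i> * complex_of_real v \<noteq> 0" using assms by simp
  define f where "f s = Ln (s + \<i> * of_real v) - s / (\<i> * of_real v)" for s
  have "cmod (f (of_real \<alpha>) - f 0) \<le> \<alpha> / v\<^sup>2 * cmod (of_real \<alpha> - 0)"
  proof (rule field_differentiable_bound[where S = "closed_segment 0 (of_real \<alpha>)"
        and f' = "\<lambda>s. - s / ((s + \<i> * of_real v) * (\<i> * of_real v))"])
    fix s :: complex assume "s \<in> closed_segment 0 (of_real \<alpha>)"
    then obtain u where u: "0 \<le> u" "u \<le> 1" "s = of_real (u * \<alpha>)"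
      unfolding closed_segment_def by (auto simp: scaleR_conv_of_real)
    have s: "Im s = 0" "cmod s \<le> \<alpha>"
      using u assms by (auto simp: abs_mult mult_le_cancel_right1 simp del: of_real_mult)
    have nz: "s + \<i> * of_real v \<noteq> 0" "s + \<i> * of_real v \<notin> \<real>\<^sub>\<le>\<^sub>0"
      using s assms by (auto simp: complex_eq_iff complex_nonpos_Reals_iff)
    have "(f has_field_derivative (1 / (s + \<i> * of_real v) - 1 / (\<i> * of_real v))) (at s)"
      unfolding f_def using nz iv0
      by (auto intro!: derivative_eq_intros simp: inverse_eq_divide)
    also have "1 / (s + \<i> * of_real v) - 1 / (\<i> * of_real v) = - s / ((s + \<i> * of_real v) * (\<i> * of_real v))"
      using nz(1) iv0 by (simp add: divide_simps)
    finally show "(f has_field_derivative - s / ((s + \<i> * of_real v) * (\<i> * of_real v)))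
        (at s within closed_segment 0 (of_real \<alpha>))"
      by (rule has_field_derivative_at_within)
    have "v \<le> cmod (s + \<i> * of_real v)"
      using abs_Im_le_cmod[of "s + \<i> * of_real v"] s assms by simp
    then have "cmod s / (cmod (s + \<i> * of_real v) * v) \<le> \<alpha> / (v * v)"
      using s assms by (intro frac_le mult_right_mono mult_pos_pos) auto
    then show "cmod (- s / ((s + \<i> * of_real v) * (\<i> * of_real v))) \<le> \<alpha> / v\<^sup>2"
      using assms by (simp add: norm_divide norm_mult power2_eq_square)
  qed (auto simp: convex_closed_segment)
  moreover have "f 0 = of_real (ln v) + \<i> * of_real (pi / 2)"
    using Ln_times_of_real[of v \<i>] assms by (simp add: f_def mult.commute Ln_of_real)
  ultimately have A: "cmod (Ln z - (of_real (ln v) + \<i> * of_real (pi / 2)) - of_real \<alpha> / (\<i> * of_real v))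
     \<le> \<alpha>\<^sup>2 / v\<^sup>2"
    using assms by (simp add: f_def z_def power2_eq_square algebra_simps)
  have z0: "z \<noteq> 0" "v \<le> cmod z" using z assms abs_Im_le_cmod[of z] by auto
  have "1 / (2 * z) - 1 / (2 * (\<i> * of_real v)) = - of_real \<alpha> / (2 * z * (\<i> * of_real v))"
    using z0(1) iv0 by (simp add: divide_simps) (simp add: z_def)
  also have "cmod \<dots> = \<alpha> / (2 * cmod z * v)"
    using assms by (simp add: norm_divide norm_mult)
  also have "\<dots> \<le> \<alpha> / (v * v)"
    using z0 assms by (intro divide_left_mono mult_right_mono mult_pos_pos) auto
  finally have B: "cmod (1 / (2 * z) - 1 / (2 * (\<i> * of_real v))) \<le> \<alpha> / v\<^sup>2"
    by (simp add: power2_eq_square)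
  have C: "cmod (Digamma z - Ln z + 1 / (2 * z)) \<le> 2 / v\<^sup>2"
    using norm_Digamma_minus_Ln[of z] z assms by simp
  have e: "of_real \<alpha> / (\<i> * of_real v) = 1 / (2 * (\<i> * of_real v)) - \<i> * of_real ((\<alpha> - 1/2) / v)"
    using assms by (simp add: field_simps)
  have "Digamma z - (of_real (ln v) + \<i> * of_real (pi / 2) - \<i> * of_real ((\<alpha> - 1/2) / v)) =
     (Digamma z - Ln z + 1 / (2 * z)) +
     (Ln z - (of_real (ln v) + \<i> * of_real (pi / 2)) - of_real \<alpha> / (\<i> * of_real v)) -
     (1 / (2 * z) - 1 / (2 * (\<i> * of_real v)))"
    unfolding e by simp
  then have "cmod (Digamma z - (of_real (ln v) + \<i> * of_real (pi / 2) - \<i> * of_real ((\<alpha> - 1/2) / v)))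
     \<le> 2 / v\<^sup>2 + \<alpha>\<^sup>2 / v\<^sup>2 + \<alpha> / v\<^sup>2"
    using order.trans[OF norm_triangle_ineq4 add_mono[OF order.trans[OF norm_triangle_ineq add_mono[OF C A]] B]]
    by presburger
  then show ?thesis by (simp add: z_def add_divide_distrib)
qed

lemma tendsto_at_top_if_tail_bound:
  fixes f :: "real \<Rightarrow> real"
  assumes "\<And>a b. c \<le> a \<Longrightarrow> a \<le> b \<Longrightarrow> \<bar>f b - f a\<bar> \<le> K / a"
  obtains l where "(f \<longlongrightarrow> l) at_top"
proof -
  have lim0: "((\<lambda>a. K / a) \<longlongrightarrow> 0) at_top"
    by (intro tendsto_divide_0[OF tendsto_const] filterlim_at_top_imp_at_infinity filterlim_ident)
  have "Cauchy (\<lambda>n. f (real n))"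
  proof (rule metric_CauchyI)
    fix e :: real assume "e > 0"
    then have "eventually (\<lambda>a. K / a < e / 2 \<and> c \<le> a) at_top"
      by (intro eventually_conj order_tendstoD(2)[OF lim0] eventually_ge_at_top) auto
    then have "eventually (\<lambda>n. K / real n < e / 2 \<and> c \<le> real n) sequentially"
      by (rule eventually_compose_filterlim[OF _ filterlim_real_sequentially])
    then obtain n0 where n0: "K / real n0 < e / 2" "c \<le> real n0"
      by (auto simp: eventually_sequentially)
    show "\<exists>M. \<forall>m\<ge>M. \<forall>n\<ge>M. dist (f (real m)) (f (real n)) < e"
    proof (intro exI allI impI)
      fix m n assume "n0 \<le> m" "n0 \<le> n"
      then have "\<bar>f (real m) - f (real n0)\<bar> \<le> K / real n0" "\<bar>f (real n) - f (real n0)\<bar> \<le> K / real n0"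
        using n0(2) by (intro assms; simp)+
      then show "dist (f (real m)) (f (real n)) < e"
        using n0(1) unfolding dist_real_def by linarith
    qed
  qed
  then obtain l where l: "(\<lambda>n. f (real n)) \<longlonglongrightarrow> l"
    using Cauchy_convergent convergent_def by blast
  have "\<bar>l - f a\<bar> \<le> K / a" if "c \<le> a" for a
  proof (rule Lim_bounded)
    show "(\<lambda>n. \<bar>f (real n) - f a\<bar>) \<longlonglongrightarrow> \<bar>l - f a\<bar>"
      by (intro tendsto_intros l)
    show "\<forall>n\<ge>nat \<lceil>a\<rceil>. \<bar>f (real n) - f a\<bar> \<le> K / a"
      using assms[OF that] by (auto simp: nat_le_iff ceiling_le_iff)
  qed
  then have "((\<lambda>a. f a - l) \<longlongrightarrow> 0) at_top"
    by (intro Lim_null_comparison[OF _ lim0] eventually_mono[OF eventually_ge_at_top[of c]])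
       (simp add: abs_minus_commute)
  then show thesis using that Lim_null by blast
qed

text \<open>Up to a constant this is \<open>\<bar>1 / \<Gamma>(\<alpha> + \<i> v)\<bar>\<close> for large \<open>v\<close>.\<close>

definition rGamma_growth :: "real \<Rightarrow> real \<Rightarrow> real" where
  "rGamma_growth \<alpha> v = v powr (1/2 - \<alpha>) * exp (pi * v / 2)"

lemma rGamma_growth_pos: "v > 0 \<Longrightarrow> rGamma_growth \<alpha> v > 0"
  by (simp add: rGamma_growth_def)

lemma inverse_rGamma_growth:
  "inverse (rGamma_growth \<alpha> v) = v powr (\<alpha> - 1/2) * exp (- (pi * v / 2))"
  using powr_minus[of v "\<alpha> - 1/2"] by (simp add: rGamma_growth_def exp_minus)

text \<open>The modulus part of Stirling's formula on a vertical line, with an unspecified constant \<open>l\<close>. The logarithm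
  of the quotient has derivative \<open>Im (Digamma (\<alpha> + \<i> v)) - \<pi> / 2 + (\<alpha> - 1/2) / v\<close>, which is of order \<open>1 / v\<^sup>2\<close>;
  so the logarithm converges.\<close>

lemma norm_rGamma_over_growth_tendsto:
  fixes \<alpha> :: real
  assumes "\<alpha> > 0"
  obtains l where "l > 0"
    "((\<lambda>v. cmod (rGamma (of_real \<alpha> + \<i> * of_real v) / of_real (rGamma_growth \<alpha> v))) \<longlongrightarrow> l) at_top"
proof -
  define z where "z v = of_real \<alpha> + \<i> * complex_of_real v" for v
  define f where "f v = Re (ln_Gamma (z v)) + pi * v / 2 - (\<alpha> - 1/2) * ln v" for v
  define K where "K = 2 + \<alpha>\<^sup>2 + \<alpha>"
  have "K > 0" using assms by (simp add: K_def add_pos_pos)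
  have nonpos: "z v \<notin> \<real>\<^sub>\<le>\<^sub>0" for v
    using assms by (auto simp: z_def complex_nonpos_Reals_iff)
  have deriv: "(f has_vector_derivative (- Im (Digamma (z v)) + pi / 2 - (\<alpha> - 1/2) / v)) (at v)" if "v > 0" for v
  proof -
    have "((\<lambda>v. ln_Gamma (z v)) has_vector_derivative \<i> * Digamma (z v)) (at v)"
      unfolding z_def using nonpos[of v] 
      by (auto intro!: derivative_eq_intros has_vector_derivative_real_field simp: z_def)
    from bounded_linear.has_vector_derivative[OF bounded_linear_Re this]
    have d1: "((\<lambda>v. Re (ln_Gamma (z v))) has_real_derivative - Im (Digamma (z v))) (at v)"
      by (simp add: has_real_derivative_iff_has_vector_derivative)
    have d2: "((\<lambda>v. pi * v / 2) has_real_derivative pi / 2) (at v)"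
      by (auto intro!: derivative_eq_intros)
    have d3: "((\<lambda>v. (\<alpha> - 1/2) * ln v) has_real_derivative (\<alpha> - 1/2) / v) (at v)"
      using that by (auto intro!: derivative_eq_intros)
    show ?thesis
      using DERIV_diff[OF DERIV_add[OF d1 d2] d3]
      unfolding f_def has_real_derivative_iff_has_vector_derivative .
  qed
  have "\<bar>f b - f a\<bar> \<le> K / a" if ab: "2 \<le> a" "a \<le> b" for a b
  proof (cases "a = b")
    case False
    have "norm (f b - f a) \<le> (- K / b) - (- K / a)"
    proof (rule differentiable_bound_general)
      show "a < b" using ab False by simp
      show "continuous_on {a..b} f"
        using ab by (intro continuous_at_imp_continuous_on ballI has_vector_derivative_continuous[OF deriv]) auto
      show "continuous_on {a..b} (\<lambda>x. - K / x)"
        using ab by (intro continuous_intros) auto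
      fix x assume x: "a < x" "x < b"
      show "(f has_vector_derivative (- Im (Digamma (z x)) + pi / 2 - (\<alpha> - 1/2) / x)) (at x)"
        using x ab by (intro deriv) auto
      show "((\<lambda>x. - K / x) has_vector_derivative K / x\<^sup>2) (at x)"
        unfolding has_real_derivative_iff_has_vector_derivative[symmetric] using x ab
        by (auto intro!: derivative_eq_intros simp: power2_eq_square)
      have "\<bar>Im (Digamma (z x) - (of_real (ln x) + \<i> * of_real (pi / 2) - \<i> * of_real ((\<alpha> - 1/2) / x)))\<bar> \<le> K / x\<^sup>2"
        using order.trans[OF abs_Im_le_cmod norm_Digamma_vertical_line[OF assms, of x]] x ab
        by (simp add: z_def K_def)
      then show "norm (- Im (Digamma (z x)) + pi / 2 - (\<alpha> - 1/2) / x) \<le> K / x\<^sup>2"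
        by (simp add: abs_le_iff) 
    qed
    also have "\<dots> \<le> K / a" using ab \<open>K > 0\<close> by simp
    finally show ?thesis by simp
  qed (use ab assms in \<open>auto simp: K_def\<close>)
  then obtain l where l: "(f \<longlongrightarrow> l) at_top" by (rule tendsto_at_top_if_tail_bound)
  show thesis
  proof
    show "exp (- l) > 0" by simp
    have "((\<lambda>v. exp (- f v)) \<longlongrightarrow> exp (- l)) at_top" by (intro tendsto_intros l)
    moreover have "eventually (\<lambda>v. exp (- f v) = cmod (rGamma (z v) / of_real (rGamma_growth \<alpha> v))) at_top"
      using eventually_gt_at_top[of 0]
    proof eventually_elim
      case (elim v)
      have "z v \<notin> \<int>\<^sub>\<le>\<^sub>0" using nonpos[of v] nonpos_Ints_subset_nonpos_Reals by blast
      then have "cmod (rGamma (z v)) = exp (- Re (ln_Gamma (z v)))"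
        by (simp add: rGamma_complex_altdef)
      then have "cmod (rGamma (z v)) * inverse (rGamma_growth \<alpha> v)
          = exp (- Re (ln_Gamma (z v))) * exp ((\<alpha> - 1/2) * ln v) * exp (- (pi * v / 2))"
        unfolding inverse_rGamma_growth using elim by (simp add: powr_def)
      also have "\<dots> = exp (- f v)"
        unfolding exp_add[symmetric] by (simp add: f_def)
      finally have "cmod (rGamma (z v)) * inverse (rGamma_growth \<alpha> v) = exp (- f v)" .
      then show ?case
        using rGamma_growth_pos[OF elim, of \<alpha>] by (simp add: norm_divide divide_inverse norm_mult norm_inverse)
    qed
    ultimately show "((\<lambda>v. cmod (rGamma (of_real \<alpha> + \<i> * of_real v) / of_real (rGamma_growth \<alpha> v)))
        \<longlongrightarrow> exp (- l)) at_top"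
      unfolding z_def by (rule Lim_transform_eventually)
  qed
qed

section \<open>Integrals of the reciprocal Gamma function against oscillations\<close>

text \<open>The integrand of the estimator for one observation: \<open>y\<close> is an affine function of the logarithm of the
  observation.\<close>

definition rGamma_wave :: "real \<Rightarrow> real \<Rightarrow> real \<Rightarrow> complex" where
  "rGamma_wave \<alpha> y v = exp (\<i> * of_real (v * y)) * rGamma (of_real \<alpha> + \<i> * of_real v)"

text \<open>The leading part of the logarithmic derivative \<open>\<i> (y - Digamma (\<alpha> + \<i> v))\<close> of \<open>rGamma_wave \<alpha> y\<close>, obtained
  from \<open>Digamma (\<alpha> + \<i> v) \<approx> ln v + \<i> \<pi> / 2\<close>.\<close>

definition wave_slope :: "real \<Rightarrow> real \<Rightarrow> complex" where
  "wave_slope y v = of_real (pi / 2) + \<i> * of_real (y - ln v)"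

lemma norm_rGamma_wave: "cmod (rGamma_wave \<alpha> y v) = cmod (rGamma (of_real \<alpha> + \<i> * of_real v))"
  by (simp add: rGamma_wave_def norm_mult del: of_real_mult)

lemma norm_wave_slope_ge:
  "cmod (wave_slope y v) \<ge> 1" "cmod (wave_slope y v) \<ge> \<bar>y - ln v\<bar>" "wave_slope y v \<noteq> 0"
proof -
  show "cmod (wave_slope y v) \<ge> 1"
    using abs_Re_le_cmod[of "wave_slope y v"] pi_ge_two by (simp add: wave_slope_def)
  then show "wave_slope y v \<noteq> 0" by auto
  show "cmod (wave_slope y v) \<ge> \<bar>y - ln v\<bar>"
    using abs_Im_le_cmod[of "wave_slope y v"] by (simp add: wave_slope_def)
qed

lemma rGamma_wave_has_vector_derivative:
  assumes "\<alpha> > 0"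
  shows "(rGamma_wave \<alpha> y has_vector_derivative
     (\<i> * of_real y - \<i> * Digamma (of_real \<alpha> + \<i> * of_real v)) * rGamma_wave \<alpha> y v) (at v)"
proof -
  define z where "z v = of_real \<alpha> + \<i> * complex_of_real v" for v
  have "z v \<notin> \<int>\<^sub>\<le>\<^sub>0"
    using assms by (auto simp: z_def elim!: nonpos_Ints_cases simp: complex_eq_iff)
  then have "((\<lambda>v. rGamma (z v)) has_vector_derivative (- rGamma (z v) * Digamma (z v) * \<i>)) (at v)"
    unfolding z_def by (auto intro!: derivative_eq_intros has_vector_derivative_real_field)
  moreover have "((\<lambda>v. exp (\<i> * of_real (v * y))) has_vector_derivative (\<i> * of_real y * exp (\<i> * of_real (v * y)))) (at v)"
    by (auto intro!: derivative_eq_intros has_vector_derivative_real_field)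
  ultimately have "((\<lambda>v. exp (\<i> * of_real (v * y)) * rGamma (z v)) has_vector_derivative
     (exp (\<i> * of_real (v * y)) * (- rGamma (z v) * Digamma (z v) * \<i>)
       + (\<i> * of_real y * exp (\<i> * of_real (v * y))) * rGamma (z v))) (at v)"
    by (rule has_vector_derivative_mult[rotated])
  then show ?thesis
    by (simp add: rGamma_wave_def[abs_def] z_def algebra_simps)
qed

lemma continuous_on_rGamma_wave [continuous_intros]: "continuous_on S (rGamma_wave \<alpha> y)"
  unfolding rGamma_wave_def[abs_def]
  by (intro continuous_intros continuous_on_compose2[OF continuous_on_rGamma[of UNIV]]) auto

lemma wave_slope_inverse_has_vector_derivative:
  assumes "v > 0"
  shows "((\<lambda>v. inverse (wave_slope y v)) has_vector_derivative \<i> / (of_real v * wave_slope y v ^ 2)) (at v)"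
proof -
  have 1: "(wave_slope y has_vector_derivative (- \<i> / of_real v)) (at v)"
    unfolding wave_slope_def[abs_def] using assms
    by (auto intro!: derivative_eq_intros simp: field_simps has_real_derivative_iff_has_vector_derivative[symmetric])
  have "(inverse has_field_derivative - (inverse (wave_slope y v) ^ Suc (Suc 0))) (at (wave_slope y v))"
    by (rule DERIV_inverse[OF norm_wave_slope_ge(3)])
  from field_vector_diff_chain_at[OF 1 this]
  show ?thesis
    by (simp add: o_def divide_inverse power2_eq_square mult_ac)
qed

text \<open>One integration by parts. With \<open>E\<close> the wave, \<open>D\<close> its slope and \<open>E' = (D + r) E\<close>, the derivative of
  \<open>E / D\<close> is \<open>E\<close> up to the terms \<open>r E / D\<close> and \<open>\<i> E / (v D\<^sup>2)\<close>, both smaller than \<open>E / D\<close> by a factor of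
  order \<open>1 / v\<close>. Since \<open>E\<close> grows exponentially, the integral of these errors is again controlled by their
  value at the upper end. The constants do not depend on \<open>y\<close>, which runs over all values of a random
  variable.\<close>

lemma rGamma_wave_integral_asymptotics:
  assumes "\<alpha> > 0"
  obtains v0 C where "v0 \<ge> 2" "C \<ge> 0"
    "\<And>V y. V \<ge> v0 \<Longrightarrow> cmod (integral {v0..V} (rGamma_wave \<alpha> y) - rGamma_wave \<alpha> y V / wave_slope y V)
        \<le> C * (1 + rGamma_growth \<alpha> V / (V * cmod (wave_slope y V)))"
proof -
  obtain l where l: "l > 0"
    "((\<lambda>v. cmod (rGamma (of_real \<alpha> + \<i> * of_real v) / of_real (rGamma_growth \<alpha> v))) \<longlongrightarrow> l) at_top"
    by (rule norm_rGamma_over_growth_tendsto[OF assms])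
  have "eventually (\<lambda>v. cmod (rGamma (of_real \<alpha> + \<i> * of_real v) / of_real (rGamma_growth \<alpha> v)) < l + 1) at_top"
    by (rule order_tendstoD(2)[OF l(2)]) simp
  then obtain v1 where v1: "\<And>v. v \<ge> v1 \<Longrightarrow>
      cmod (rGamma (of_real \<alpha> + \<i> * of_real v) / of_real (rGamma_growth \<alpha> v)) < l + 1"
    by (auto simp: eventually_at_top_linorder)
  have G_le: "cmod (rGamma (of_real \<alpha> + \<i> * of_real v)) \<le> (l + 1) * rGamma_growth \<alpha> v" if "v \<ge> v1" "v > 0" for v
    using v1[OF that(1)] rGamma_growth_pos[OF that(2), of \<alpha>]
    by (simp only: norm_divide norm_of_real abs_of_pos pos_divide_less_eq less_imp_le)
  \<comment> \<open>The error at \<open>v\<close> is at most a multiple of \<open>\<Phi> v / \<bar>D V\<bar>\<close>, and \<open>\<Phi> \<le> \<Phi>'\<close> beyond \<open>2 \<beta>\<close>, so that \<open>\<Phi>\<close> itself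
     majorises the integral of the error.\<close>
  define \<beta> where "\<beta> = \<alpha> + 3/2"
  define v0 where "v0 = Max {2, v1, 2 * \<beta>}"
  have v0: "v0 \<ge> 2" "v0 \<ge> v1" "v0 \<ge> 2 * \<beta>" by (auto simp: v0_def)
  define \<Phi> where "\<Phi> v = v powr (- \<beta>) * exp (pi * v / 2)" for v
  define \<Phi>' where "\<Phi>' v = (pi / 2 - \<beta> / v) * \<Phi> v" for v
  define K where "K = (2 + \<alpha>\<^sup>2 + \<alpha>) + \<alpha> + 1"
  have K: "K > 0" using assms by (simp add: K_def add_pos_pos)
  define K2 where "K2 = (l + 1) * (K + 1)"
  have K2: "K2 > 0" using K l by (simp add: K2_def)
  have \<Phi>_eq: "\<Phi> v = rGamma_growth \<alpha> v / v\<^sup>2" if "v > 0" for v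
  proof -
    have "v powr (1/2 - \<alpha>) = v powr (- \<beta> + 2)" by (simp add: \<beta>_def)
    also have "\<dots> = v powr (- \<beta>) * v\<^sup>2" using that by (simp only: powr_add powr_numeral)
    finally show ?thesis using that by (simp add: \<Phi>_def rGamma_growth_def)
  qed
  have \<Phi>_nonneg: "\<Phi> v \<ge> 0" for v by (simp add: \<Phi>_def)
  have \<Phi>_deriv: "(\<Phi> has_vector_derivative \<Phi>' v) (at v)" if "v > 0" for v
  proof -
    have "(\<Phi> has_real_derivative (- \<beta> * v powr (- \<beta> - 1) * exp (pi * v / 2) + v powr (- \<beta>) * (exp (pi * v / 2) * (pi / 2)))) (at v)"
      unfolding \<Phi>_def[abs_def] using that by (auto intro!: derivative_eq_intros)
    also have "(- \<beta> * v powr (- \<beta> - 1) * exp (pi * v / 2) + v powr (- \<beta>) * (exp (pi * v / 2) * (pi / 2))) = \<Phi>' v"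
      using that by (simp add: \<Phi>'_def \<Phi>_def powr_diff field_simps)
    finally show ?thesis by (simp add: has_real_derivative_iff_has_vector_derivative)
  qed
  have \<Phi>'_ge: "\<Phi> v \<le> \<Phi>' v" if "v \<ge> v0" for v
  proof -
    have "\<beta> / v \<le> 1 / 2" using that v0 by (simp add: field_simps)
    then have "1 \<le> pi / 2 - \<beta> / v" using pi_gt3 by linarith
    then show ?thesis using mult_right_mono[OF _ \<Phi>_nonneg, of 1] by (simp add: \<Phi>'_def)
  qed
  have main: "cmod (integral {v0..V} (rGamma_wave \<alpha> y) - rGamma_wave \<alpha> y V / wave_slope y V)
        \<le> cmod (rGamma (of_real \<alpha> + \<i> * of_real v0)) + K2 * (rGamma_growth \<alpha> V / (V * cmod (wave_slope y V)))"
    if V: "V \<ge> v0" for V y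
  proof -
    define E D where "E = rGamma_wave \<alpha> y" and "D = wave_slope y"
    define \<psi> where "\<psi> v = Digamma (of_real \<alpha> + \<i> * of_real v)" for v
    define r where "r v = \<i> * of_real y - \<i> * \<psi> v - D v" for v
    define R where "R v = integral {v0..v} E - E v / D v" for v
    define R' where "R' v = - (r v * E v / D v) - \<i> * E v / (of_real v * D v ^ 2)" for v
    have D0: "D v \<noteq> 0" "cmod (D v) \<ge> 1" for v by (simp_all add: D_def norm_wave_slope_ge)
    have RV0: "cmod (R v0) \<le> cmod (rGamma (of_real \<alpha> + \<i> * of_real v0))"
    proof -
      have "cmod (R v0) = cmod (E v0) / cmod (D v0)" by (simp add: R_def norm_divide)
      also have "\<dots> \<le> cmod (E v0) / 1" using D0 by (intro divide_left_mono) auto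
      finally show ?thesis by (simp add: E_def norm_rGamma_wave)
    qed
    have r_le: "cmod (r v) \<le> K / v" if "v \<ge> 2" for v
    proof -
      have "r v = - \<i> * ((\<psi> v - (of_real (ln v) + \<i> * of_real (pi / 2) - \<i> * of_real ((\<alpha> - 1/2) / v)))
           - \<i> * of_real ((\<alpha> - 1/2) / v))"
        by (simp add: r_def D_def wave_slope_def algebra_simps)
      also have "cmod \<dots> = cmod ((\<psi> v - (of_real (ln v) + \<i> * of_real (pi / 2) - \<i> * of_real ((\<alpha> - 1/2) / v)))
           - \<i> * of_real ((\<alpha> - 1/2) / v))"
        by (simp only: norm_mult norm_minus_cancel norm_ii mult_1)
      also have "\<dots> \<le> (2 + \<alpha>\<^sup>2 + \<alpha>) / v\<^sup>2 + cmod (\<i> * of_real ((\<alpha> - 1/2) / v))"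
        unfolding \<psi>_def
        by (intro order.trans[OF norm_triangle_ineq4] add_mono norm_Digamma_vertical_line assms that order.refl)
      also have "cmod (\<i> * of_real ((\<alpha> - 1/2) / v)) = \<bar>\<alpha> - 1/2\<bar> / v"
        using that by (simp only: norm_mult norm_ii norm_of_real abs_divide)
      also have "(2 + \<alpha>\<^sup>2 + \<alpha>) / v\<^sup>2 \<le> (2 + \<alpha>\<^sup>2 + \<alpha>) / v"
        using that assms by (intro divide_left_mono) (auto simp: power2_eq_square)
      also have "\<bar>\<alpha> - 1/2\<bar> / v \<le> (\<alpha> + 1) / v"
        using that assms by (intro divide_right_mono) auto
      finally show ?thesis by (simp add: K_def add_divide_distrib)
    qed
    show ?thesis
    proof (cases "V = v0")
      case True
      then have "R V = R v0" by simp
      moreover have "0 \<le> K2 * (rGamma_growth \<alpha> V / (V * cmod (wave_slope y V)))"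
        using K2 V v0 rGamma_growth_pos[of V \<alpha>] by (intro mult_nonneg_nonneg divide_nonneg_nonneg) auto
      ultimately show ?thesis using RV0 by (simp add: R_def E_def D_def)
    next
      case False
      have "norm (R V - R v0) \<le> K2 * V / cmod (D V) * \<Phi> V - K2 * V / cmod (D V) * \<Phi> v0"
      proof (rule differentiable_bound_general[where f' = R' and \<phi>' = "\<lambda>v. K2 * V / cmod (D V) * \<Phi>' v"])
        show "v0 < V" using V False by simp
        have contE: "continuous_on S E" for S
          unfolding E_def by (rule continuous_on_rGamma_wave)
        have "continuous_on {v0..V} D"
          unfolding D_def wave_slope_def[abs_def] using v0 by (intro continuous_intros) auto
        then show "continuous_on {v0..V} R"
          unfolding R_def[abs_def] using D0
          by (intro continuous_intros indefinite_integral_continuous_1 integrable_continuous_real contE) auto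
        have "continuous_on {v0..V} \<Phi>"
          using v0 by (intro continuous_at_imp_continuous_on ballI has_vector_derivative_continuous[OF \<Phi>_deriv]) auto
        then show "continuous_on {v0..V} (\<lambda>v. K2 * V / cmod (D V) * \<Phi> v)"
          by (intro continuous_intros)
        fix v assume v: "v0 < v" "v < V"
        have v2: "v > 0" "v \<ge> 2" using v v0 by auto
        show "((\<lambda>v. K2 * V / cmod (D V) * \<Phi> v) has_vector_derivative K2 * V / cmod (D V) * \<Phi>' v) (at v)"
          by (intro has_vector_derivative_mult_right \<Phi>_deriv v2)
        have "((\<lambda>u. integral {v0..u} E) has_vector_derivative E v) (at v within {v0..V})"
          using v by (intro integral_has_vector_derivative contE) auto
        then have I: "((\<lambda>u. integral {v0..u} E) has_vector_derivative E v) (at v)"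
          using v by (simp add: at_within_Icc_at)
        have "((\<lambda>v. E v * inverse (D v)) has_vector_derivative
            (E v * (\<i> / (of_real v * D v ^ 2)) + ((\<i> * of_real y - \<i> * \<psi> v) * E v) * inverse (D v))) (at v)"
          unfolding E_def D_def \<psi>_def
          by (intro has_vector_derivative_mult rGamma_wave_has_vector_derivative assms
                wave_slope_inverse_has_vector_derivative v2)
        from has_vector_derivative_diff[OF I this]
        have "(R has_vector_derivative (E v - (E v * (\<i> / (of_real v * D v ^ 2)) + ((\<i> * of_real y - \<i> * \<psi> v) * E v) * inverse (D v)))) (at v)"
          by (simp add: R_def[abs_def] divide_inverse)
        also have "E v - (E v * (\<i> / (of_real v * D v ^ 2)) + ((\<i> * of_real y - \<i> * \<psi> v) * E v) * inverse (D v)) = R' v"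
        proof -
          have e: "\<i> * of_real y - \<i> * \<psi> v = D v + r v" by (simp add: r_def)
          show ?thesis unfolding e R'_def using D0(1)[of v] by (simp add: field_simps)
        qed
        finally show "(R has_vector_derivative R' v) (at v)" .
        \<comment> \<open>The slope changes only logarithmically, so passing from \<open>D v\<close> to \<open>D V\<close> costs at most a power of
           \<open>V / v\<close>.\<close>
        have Dle: "cmod (D V) \<le> cmod (D v) * (V / v)"
        proof -
          have "D V = D v + \<i> * of_real (ln v - ln V)" by (simp add: D_def wave_slope_def algebra_simps)
          then have "cmod (D V) \<le> cmod (D v) + cmod (\<i> * of_real (ln v - ln V))"
            by (simp only: norm_triangle_ineq)
          also have "cmod (\<i> * of_real (ln v - ln V)) = \<bar>ln v - ln V\<bar>"
            by (simp only: norm_mult norm_ii norm_of_real mult_1)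
          also have "\<dots> = ln (V / v)" using v v2 by (simp add: ln_div)
          also have "\<dots> \<le> V / v - 1" using v v2 by (intro ln_le_minus_one) auto
          also have "\<dots> \<le> cmod (D v) * (V / v - 1)"
            using mult_right_mono[OF D0(2)[of v], of "V / v - 1"] v v2 by (simp add: field_simps)
          finally show ?thesis by (simp add: algebra_simps)
        qed
        have "norm (R' v) \<le> cmod (r v * E v / D v) + cmod (\<i> * E v / (of_real v * D v ^ 2))"
          unfolding R'_def by (rule order.trans[OF norm_triangle_ineq4]) simp
        also have "\<dots> = cmod (E v) / cmod (D v) * (cmod (r v) + 1 / (v * cmod (D v)))"
          using v2 D0(1)[of v] by (simp add: norm_mult norm_divide norm_power field_simps power2_eq_square)
        also have "\<dots> \<le> cmod (E v) / cmod (D v) * (K / v + 1 / v)"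
        proof (intro mult_left_mono add_mono r_le v2)
          show "1 / (v * cmod (D v)) \<le> 1 / v"
            using v2 D0(2)[of v] by (intro frac_le) auto
        qed auto
        also have "\<dots> = cmod (E v) * (K + 1) / v * (1 / cmod (D v))" by (simp add: add_divide_distrib field_simps)
        also have "\<dots> \<le> ((l + 1) * rGamma_growth \<alpha> v) * (K + 1) / v * (V / v / cmod (D V))"
        proof (intro mult_mono divide_right_mono mult_right_mono)
          show "cmod (E v) \<le> (l + 1) * rGamma_growth \<alpha> v"
            unfolding E_def norm_rGamma_wave using v v0 by (intro G_le) auto
          show "1 / cmod (D v) \<le> V / v / cmod (D V)"
            using Dle D0[of v] D0[of V] v2 by (simp add: field_simps)
        qed (use K v2 l rGamma_growth_pos[of v \<alpha>] in auto)
        also have "\<dots> = K2 * V / cmod (D V) * \<Phi> v"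
          using v2 by (simp add: \<Phi>_eq K2_def power2_eq_square mult_ac)
        also have "\<dots> \<le> K2 * V / cmod (D V) * \<Phi>' v"
          using v K2 v2 by (intro mult_left_mono \<Phi>'_ge) auto
        finally show "norm (R' v) \<le> K2 * V / cmod (D V) * \<Phi>' v" .
      qed
      also have "\<dots> \<le> K2 * V / cmod (D V) * \<Phi> V"
        using K2 V v0 \<Phi>_nonneg[of v0] by simp
      also have "\<dots> = K2 * (rGamma_growth \<alpha> V / (V * cmod (D V)))"
        using V v0 by (simp add: \<Phi>_eq power2_eq_square)
      finally have "cmod (R V) \<le> cmod (R v0) + K2 * (rGamma_growth \<alpha> V / (V * cmod (D V)))"
        using norm_triangle_sub[of "R V" "R v0"] by linarith
      then show ?thesis using RV0 by (simp add: R_def E_def D_def)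
    qed
  qed
  define C where "C = max K2 (cmod (rGamma (of_real \<alpha> + \<i> * of_real v0)))"
  show thesis
  proof
    show "v0 \<ge> 2" "C \<ge> 0" using v0 K2 by (auto simp: C_def)
    fix V y assume V: "V \<ge> v0"
    have "0 \<le> rGamma_growth \<alpha> V / (V * cmod (wave_slope y V))"
      using V v0 rGamma_growth_pos[of V \<alpha>] by (intro divide_nonneg_nonneg) auto
    then have "K2 * (rGamma_growth \<alpha> V / (V * cmod (wave_slope y V))) \<le> C * (rGamma_growth \<alpha> V / (V * cmod (wave_slope y V)))"
      by (intro mult_right_mono) (auto simp: C_def)
    moreover have "cmod (rGamma (of_real \<alpha> + \<i> * of_real v0)) \<le> C" by (simp add: C_def)
    ultimately show "cmod (integral {v0..V} (rGamma_wave \<alpha> y) - rGamma_wave \<alpha> y V / wave_slope y V)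
        \<le> C * (1 + rGamma_growth \<alpha> V / (V * cmod (wave_slope y V)))"
      using main[OF V, of y] by (simp add: distrib_left)
  qed
qed

text \<open>The wave at \<open>- v\<close> is the complex conjugate of the wave at \<open>v\<close>.\<close>

lemma Re_integral_rGamma_wave_symmetric:
  assumes "V \<ge> 0"
  shows "Re (integral {-V..V} (rGamma_wave \<alpha> y)) = 2 * Re (integral {0..V} (rGamma_wave \<alpha> y))"
proof -
  define f where "f v = Re (rGamma_wave \<alpha> y v)" for v
  have int: "rGamma_wave \<alpha> y integrable_on {a..b}" for a b
    by (intro integrable_continuous_real continuous_intros)
  have Re_int: "Re (integral {a..b} (rGamma_wave \<alpha> y)) = integral {a..b} f" for a b
    using integral_linear[OF int bounded_linear_Re, of a b] by (simp add: o_def f_def[abs_def])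
  have f_int: "f integrable_on {a..b}" for a b
    using integrable_linear[OF int bounded_linear_Re, of a b] by (simp add: o_def f_def[abs_def])
  have even: "f (- v) = f v" for v
  proof -
    have "rGamma_wave \<alpha> y (- v) = cnj (rGamma_wave \<alpha> y v)"
      by (simp add: rGamma_wave_def exp_cnj cnj_rGamma)
    then show ?thesis by (simp add: f_def)
  qed
  have "integral {-V..V} f = integral {-V..0} f + integral {0..V} f"
    using assms by (intro Henstock_Kurzweil_Integration.integral_combine[symmetric] f_int) auto
  also have "integral {-V..0} f = integral {0..V} f"
    using Henstock_Kurzweil_Integration.integral_reflect_real[of V 0 f] by (simp add: even)
  finally show ?thesis by (simp add: Re_int)
qed

text \<open>Only the two ends of \<open>[-V, V]\<close> matter; they are conjugate to each other, whence the factor \<open>2\<close>.\<close>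

lemma Re_integral_rGamma_wave_asymptotics:
  assumes "\<alpha> > 0"
  obtains v0 C where "v0 \<ge> 2" "C \<ge> 0"
    "\<And>V y. V \<ge> v0 \<Longrightarrow>
       \<bar>Re (integral {-V..V} (rGamma_wave \<alpha> y)) - 2 * Re (rGamma_wave \<alpha> y V / wave_slope y V)\<bar>
        \<le> C * (1 + rGamma_growth \<alpha> V / (V * cmod (wave_slope y V)))"
proof -
  obtain v0 C where v0: "v0 \<ge> 2" and "C \<ge> 0" and C:
    "\<And>V y. V \<ge> v0 \<Longrightarrow> cmod (integral {v0..V} (rGamma_wave \<alpha> y) - rGamma_wave \<alpha> y V / wave_slope y V)
        \<le> C * (1 + rGamma_growth \<alpha> V / (V * cmod (wave_slope y V)))"
    by (rule rGamma_wave_integral_asymptotics[OF assms]) (rule that; assumption?; blast)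
  define C0 where "C0 = integral {0..v0} (\<lambda>v. cmod (rGamma_wave \<alpha> 0 v))"
  have int: "rGamma_wave \<alpha> y integrable_on {a..b}" for a b y
    by (intro integrable_continuous_real continuous_intros)
  have C0: "cmod (integral {0..v0} (rGamma_wave \<alpha> y)) \<le> C0" for y
    unfolding C0_def
    by (intro integral_norm_bound_integral int integrable_continuous_real continuous_intros)
       (simp add: norm_rGamma_wave)
  have "C0 \<ge> 0" using order.trans[OF norm_ge_zero C0] .
  show thesis
  proof
    show "v0 \<ge> 2" by fact
    show "2 * (C0 + C) \<ge> 0" using \<open>C0 \<ge> 0\<close> \<open>C \<ge> 0\<close> by simp
    fix V y assume V: "V \<ge> v0"
    define Q where "Q = rGamma_growth \<alpha> V / (V * cmod (wave_slope y V))"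
    have "Q \<ge> 0"
      using V v0 rGamma_growth_pos[of V \<alpha>] unfolding Q_def by (intro divide_nonneg_nonneg) auto
    define I1 I2 W where "I1 = integral {0..v0} (rGamma_wave \<alpha> y)" and "I2 = integral {v0..V} (rGamma_wave \<alpha> y)"
      and "W = rGamma_wave \<alpha> y V / wave_slope y V"
    have "integral {0..V} (rGamma_wave \<alpha> y) = I1 + I2"
      unfolding I1_def I2_def using V v0 
      by (intro Henstock_Kurzweil_Integration.integral_combine[symmetric] int) auto
    then have "Re (integral {-V..V} (rGamma_wave \<alpha> y)) - 2 * Re W = 2 * Re (I1 + (I2 - W))"
      using V v0 by (simp add: Re_integral_rGamma_wave_symmetric)
    then have "\<bar>Re (integral {-V..V} (rGamma_wave \<alpha> y)) - 2 * Re W\<bar> \<le> 2 * cmod (I1 + (I2 - W))"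
      using abs_Re_le_cmod[of "I1 + (I2 - W)"] by linarith
    also have "\<dots> \<le> 2 * (C0 + C * (1 + Q))"
      unfolding I1_def I2_def W_def Q_def
      by (intro mult_left_mono norm_triangle_mono C0 C V) simp
    also have "\<dots> \<le> 2 * (C0 + C) * (1 + Q)"
      using \<open>Q \<ge> 0\<close> \<open>C0 \<ge> 0\<close> by (simp add: algebra_simps)
    finally show "\<bar>Re (integral {-V..V} (rGamma_wave \<alpha> y)) - 2 * Re (rGamma_wave \<alpha> y V / wave_slope y V)\<bar>
        \<le> 2 * (C0 + C) * (1 + rGamma_growth \<alpha> V / (V * cmod (wave_slope y V)))"
      by (simp add: W_def Q_def)
  qed
qed

lemma ln_over_rGamma_growth_tendsto_0: "((\<lambda>V::real. ln V / rGamma_growth \<alpha> V) \<longlongrightarrow> 0) at_top"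
proof (rule Lim_null_comparison)
  define k where "k = nat \<lceil>\<alpha> + 1/2\<rceil>"
  have "((\<lambda>V::real. ln V / V * (V ^ k / exp V)) \<longlongrightarrow> 0 * 0) at_top"
    by (intro tendsto_mult ln_x_over_x_tendsto_0 tendsto_power_div_exp_0)
  then show "((\<lambda>V::real. ln V / V * (V ^ k / exp V)) \<longlongrightarrow> 0) at_top"
    by (simp only: mult_zero_left)
  show "eventually (\<lambda>V. norm (ln V / rGamma_growth \<alpha> V) \<le> ln V / V * (V ^ k / exp V)) at_top"
    using eventually_ge_at_top[of 1]
  proof eventually_elim
    case (elim V)
    have "V powr (1/2 - \<alpha>) * exp (pi * V / 2) = V / V powr (\<alpha> + 1/2) * exp (pi * V / 2)"
      using elim powr_diff[of V 1 "\<alpha> + 1/2"] by simp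
    also have "\<dots> \<ge> V / V ^ k * exp V"
    proof (intro mult_mono divide_left_mono)
      have "V powr (\<alpha> + 1/2) \<le> V powr real k"
        using elim by (intro powr_mono) (auto simp: k_def of_nat_ceiling)
      then show "V powr (\<alpha> + 1/2) \<le> V ^ k" using elim by (simp add: powr_realpow)
      show "exp V \<le> exp (pi * V / 2)" using elim pi_gt3 by simp
    qed (use elim in auto)
    finally have "ln V / rGamma_growth \<alpha> V \<le> ln V / (V / V ^ k * exp V)"
      using elim unfolding rGamma_growth_def by (intro divide_left_mono) auto
    then show ?case using elim rGamma_growth_pos[of V \<alpha>] by simp
  qed
qed

text \<open>The slope is \<open>\<pi> / 2 + \<i> (y - ln V)\<close>. It has order \<open>ln V\<close> unless \<open>y\<close> is comparable with \<open>ln V\<close>, and in that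
  case \<open>ln V\<close> is bounded by a multiple of \<open>y\<close>.\<close>

lemma ln_over_norm_wave_slope_le:
  assumes "V \<ge> 1"
  shows "ln V / cmod (wave_slope y V) \<le> 2 * (1 + max 0 y)"
proof (cases "y \<le> ln V / 2")
  case True
  have "ln V / 2 \<le> cmod (wave_slope y V)" using norm_wave_slope_ge(2)[of y V] True by linarith
  then have "ln V / cmod (wave_slope y V) \<le> 2"
    using norm_wave_slope_ge(3)[of y V] by (simp add: field_simps)
  then show ?thesis by simp
next
  case False
  have "ln V / cmod (wave_slope y V) \<le> ln V / 1"
    using norm_wave_slope_ge(1)[of y V] assms by (intro divide_left_mono) auto
  then show ?thesis using False by simp
qed

text \<open>The bound is uniform in \<open>V\<close> and grows only linearly in \<open>y\<close>: it yields a square integrable envelope of the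
  normalised scores.\<close>

lemma normalised_rGamma_wave_integral_bound:
  assumes "\<alpha> > 0"
  obtains v0 C where "v0 \<ge> 2" "C \<ge> 0"
    "\<And>V y. V \<ge> v0 \<Longrightarrow>
       \<bar>Re (integral {-V..V} (rGamma_wave \<alpha> y)) * (ln V / rGamma_growth \<alpha> V)\<bar> \<le> C * (1 + max 0 y)"
proof -
  obtain v1 C where v1: "v1 \<ge> 2" and "C \<ge> 0" and C:
    "\<And>V y. V \<ge> v1 \<Longrightarrow>
       \<bar>Re (integral {-V..V} (rGamma_wave \<alpha> y)) - 2 * Re (rGamma_wave \<alpha> y V / wave_slope y V)\<bar>
        \<le> C * (1 + rGamma_growth \<alpha> V / (V * cmod (wave_slope y V)))"
    by (rule Re_integral_rGamma_wave_asymptotics[OF assms]) (rule that; assumption?; blast)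
  obtain l where l: "l > 0"
    "((\<lambda>v. cmod (rGamma (of_real \<alpha> + \<i> * of_real v) / of_real (rGamma_growth \<alpha> v))) \<longlongrightarrow> l) at_top"
    by (rule norm_rGamma_over_growth_tendsto[OF assms])
  have "eventually (\<lambda>v. cmod (rGamma (of_real \<alpha> + \<i> * of_real v) / of_real (rGamma_growth \<alpha> v)) < l + 1
      \<and> ln v / rGamma_growth \<alpha> v < 1) at_top"
    by (intro eventually_conj order_tendstoD(2)[OF l(2)] order_tendstoD(2)[OF ln_over_rGamma_growth_tendsto_0]) auto
  then obtain v2 where v2: "\<And>v. v \<ge> v2 \<Longrightarrow> cmod (rGamma (of_real \<alpha> + \<i> * of_real v) / of_real (rGamma_growth \<alpha> v)) < l + 1"
      "\<And>v. v \<ge> v2 \<Longrightarrow> ln v / rGamma_growth \<alpha> v < 1"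
    by (auto simp: eventually_at_top_linorder)
  show thesis
  proof
    show "max v1 v2 \<ge> 2" using v1 by simp
    show "4 * (l + 1) + 3 * C \<ge> 0" using l \<open>C \<ge> 0\<close> by simp
    fix V y assume "V \<ge> max v1 v2"
    then have V: "V \<ge> v1" "V \<ge> v2" "V \<ge> 2" using v1 by auto
    define A D L J where "A = rGamma_growth \<alpha> V" and "D = cmod (wave_slope y V)" and "L = ln V"
      and "J = Re (integral {-V..V} (rGamma_wave \<alpha> y))"
    define G where "G = cmod (rGamma (of_real \<alpha> + \<i> * of_real V))"
    have A: "A > 0" using V by (simp add: A_def rGamma_growth_pos)
    have D: "D \<ge> 1" by (simp add: D_def norm_wave_slope_ge)
    have L: "L > 0" using V by (simp add: L_def)
    have G: "G / A \<le> l + 1" using v2(1)[OF V(2)] A by (simp add: G_def A_def norm_divide)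
    have LD: "L / D \<le> 2 * (1 + max 0 y)"
      unfolding L_def D_def using V by (intro ln_over_norm_wave_slope_le) simp
    have LA: "L / A \<le> 1" using v2(2)[OF V(2)] by (simp add: L_def A_def)
    have "\<bar>2 * Re (rGamma_wave \<alpha> y V / wave_slope y V)\<bar> \<le> 2 * (G / D)"
      using abs_Re_le_cmod[of "rGamma_wave \<alpha> y V / wave_slope y V"]
      by (simp add: norm_divide norm_rGamma_wave G_def D_def abs_mult)
    then have "\<bar>J\<bar> \<le> 2 * (G / D) + C * (1 + A / (V * D))"
      using C[OF V(1), of y] unfolding J_def A_def D_def by linarith
    then have "\<bar>J\<bar> * (L / A) \<le> (2 * (G / D) + C * (1 + A / (V * D))) * (L / A)"
      using A L by (intro mult_right_mono) auto
    also have "\<dots> = 2 * ((G / A) * (L / D)) + C * (L / A + L / D / V)"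
      using A D V by (simp add: field_simps)
    also have "\<dots> \<le> 2 * ((l + 1) * (2 * (1 + max 0 y))) + C * (1 + 2 * (1 + max 0 y))"
    proof (intro add_mono mult_left_mono mult_mono G LD LA \<open>C \<ge> 0\<close>)
      have "L / D / V \<le> L / D / 1" using L D V by (intro divide_left_mono) auto
      then show "L / D / V \<le> 2 * (1 + max 0 y)" using LD by simp
    qed (use l L D in auto)
    also have "\<dots> \<le> (4 * (l + 1) + 3 * C) * (1 + max 0 y)"
      using mult_left_mono[of 1 "1 + max 0 y" C] \<open>C \<ge> 0\<close> by (simp add: algebra_simps)
    finally have "\<bar>J * (L / A)\<bar> \<le> (4 * (l + 1) + 3 * C) * (1 + max 0 y)"
      using A L by (simp add: abs_mult)
    then show "\<bar>Re (integral {-V..V} (rGamma_wave \<alpha> y)) * (ln V / rGamma_growth \<alpha> V)\<bar>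
        \<le> (4 * (l + 1) + 3 * C) * (1 + max 0 y)"
      by (simp only: J_def L_def A_def)
  qed
qed

text \<open>For fixed \<open>y\<close> the quotient \<open>ln V / (\<pi> / 2 + \<i> (y - ln V))\<close> tends to \<open>\<i>\<close>. This is where the factor
  \<open>1 / log (1 / h)\<close> of the rate comes from.\<close>

lemma normalised_rGamma_wave_integral_tendsto:
  assumes "\<alpha> > 0"
  shows "((\<lambda>V. Re (integral {-V..V} (rGamma_wave \<alpha> y)) * (ln V / rGamma_growth \<alpha> V)
     - 2 * Re (\<i> * rGamma_wave \<alpha> y V / of_real (rGamma_growth \<alpha> V))) \<longlongrightarrow> 0) at_top"
proof -
  obtain v1 C where v1: "v1 \<ge> 2" and "C \<ge> 0" and C:
    "\<And>V y. V \<ge> v1 \<Longrightarrow>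
       \<bar>Re (integral {-V..V} (rGamma_wave \<alpha> y)) - 2 * Re (rGamma_wave \<alpha> y V / wave_slope y V)\<bar>
        \<le> C * (1 + rGamma_growth \<alpha> V / (V * cmod (wave_slope y V)))"
    by (rule Re_integral_rGamma_wave_asymptotics[OF assms]) (rule that; assumption?; blast)
  obtain l where l: "l > 0"
    "((\<lambda>v. cmod (rGamma (of_real \<alpha> + \<i> * of_real v) / of_real (rGamma_growth \<alpha> v))) \<longlongrightarrow> l) at_top"
    by (rule norm_rGamma_over_growth_tendsto[OF assms])
  define B where "B V = C * (ln V / rGamma_growth \<alpha> V + ln V / V) +
     2 * cmod (rGamma (of_real \<alpha> + \<i> * of_real V) / of_real (rGamma_growth \<alpha> V)) * ((\<bar>y\<bar> + pi / 2) / (ln V - y))" for V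
  have "(B \<longlongrightarrow> C * (0 + 0) + 2 * l * 0) at_top"
    unfolding B_def[abs_def]
  proof (intro tendsto_intros ln_over_rGamma_growth_tendsto_0 l(2))
    show "((\<lambda>V. (\<bar>y\<bar> + pi / 2) / (ln V - y)) \<longlongrightarrow> 0) at_top"
    proof (rule tendsto_divide_0[OF tendsto_const filterlim_at_top_imp_at_infinity])
      show "filterlim (\<lambda>V. ln V - y) at_top at_top"
        using filterlim_tendsto_add_at_top[OF tendsto_const[of "- y"] ln_at_top] by simp
    qed
  qed (rule ln_x_over_x_tendsto_0)
  then have "(B \<longlongrightarrow> 0) at_top" by simp
  moreover have "eventually (\<lambda>V. V > exp y) at_top" by (rule eventually_gt_at_top)
  then have "eventually (\<lambda>V. norm (Re (integral {-V..V} (rGamma_wave \<alpha> y)) * (ln V / rGamma_growth \<alpha> V)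
     - 2 * Re (\<i> * rGamma_wave \<alpha> y V / of_real (rGamma_growth \<alpha> V))) \<le> B V) at_top"
    using eventually_ge_at_top[of v1]
  proof eventually_elim
    case (elim V)
    then have V: "V \<ge> 2" "ln V > y" using v1 by (auto intro: exp_gt_zero less_trans simp: ln_less_cancel_iff[of "exp y" V, symmetric])
    define A D L J E where "A = rGamma_growth \<alpha> V" and "D = wave_slope y V" and "L = ln V"
      and "J = Re (integral {-V..V} (rGamma_wave \<alpha> y))" and "E = rGamma_wave \<alpha> y V"
    have A: "A > 0" using V by (simp add: A_def rGamma_growth_pos)
    have D: "cmod D \<ge> 1" "D \<noteq> 0" "cmod D \<ge> \<bar>y - L\<bar>" by (simp_all add: D_def norm_wave_slope_ge L_def)
    have L: "L > 0" using V by (simp add: L_def)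
    have "J * (L / A) - 2 * Re (\<i> * E / of_real A)
       = (J - 2 * Re (E / D)) * (L / A) + 2 * Re (E / of_real A * (of_real L / D - \<i>))"
    proof -
      have "Re (E / D) * (L / A) = Re (of_real (L / A) * (E / D))"
        by (simp only: times_complex.sel Re_complex_of_real Im_complex_of_real) simp
      also have "of_real (L / A) * (E / D) = E / of_real A * (of_real L / D)" by simp
      finally have "Re (E / D) * (L / A) = Re (E / of_real A * (of_real L / D))" .
      moreover have "\<i> * E / of_real A = E / of_real A * \<i>" by simp
      ultimately show ?thesis
        by (simp only: left_diff_distrib right_diff_distrib minus_complex.sel mult.assoc)
    qed
    also have "\<bar>\<dots>\<bar> \<le> \<bar>J - 2 * Re (E / D)\<bar> * (L / A) + 2 * (cmod (E / of_real A) * cmod (of_real L / D - \<i>))"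
    proof (intro order.trans[OF abs_triangle_ineq] add_mono)
      have "\<bar>Re (E / of_real A * (of_real L / D - \<i>))\<bar> \<le> cmod (E / of_real A) * cmod (of_real L / D - \<i>)"
        using abs_Re_le_cmod[of "E / of_real A * (of_real L / D - \<i>)"] by (simp only: norm_mult)
      then show "\<bar>2 * Re (E / of_real A * (of_real L / D - \<i>))\<bar>
          \<le> 2 * (cmod (E / of_real A) * cmod (of_real L / D - \<i>))"
        by (simp only: abs_mult)
    qed (use A L in \<open>simp add: abs_mult\<close>)
    also have "\<dots> \<le> C * (1 + A / (V * cmod D)) * (L / A)
       + 2 * (cmod (E / of_real A) * ((\<bar>y\<bar> + pi / 2) / (L - y)))"
    proof (intro add_mono mult_right_mono mult_left_mono)
      show "\<bar>J - 2 * Re (E / D)\<bar> \<le> C * (1 + A / (V * cmod D))"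
        using C[of V y] elim unfolding J_def A_def D_def E_def by simp
      have "of_real L / D - \<i> = (of_real y - \<i> * of_real (pi / 2)) / D"
        using D(2) by (simp add: divide_simps) (simp add: D_def wave_slope_def L_def algebra_simps)
      also have "cmod \<dots> \<le> (\<bar>y\<bar> + pi / 2) / (L - y)"
        unfolding norm_divide
      proof (intro frac_le)
        have "cmod (of_real y - \<i> * of_real (pi / 2)) \<le> cmod (of_real y) + cmod (\<i> * of_real (pi / 2))"
          by (rule norm_triangle_ineq4)
        also have "cmod (\<i> * of_real (pi / 2)) = pi / 2"
          by (simp only: norm_mult norm_ii norm_of_real) simp
        finally show "cmod (of_real y - \<i> * of_real (pi / 2)) \<le> \<bar>y\<bar> + pi / 2" by simp
      qed (use D V in \<open>auto simp: L_def\<close>)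
      finally show "cmod (of_real L / D - \<i>) \<le> (\<bar>y\<bar> + pi / 2) / (L - y)" .
    qed (use A L in auto)
    also have "C * (1 + A / (V * cmod D)) * (L / A) = C * (L / A + L / V / cmod D)"
      using A D V by (simp add: field_simps)
    also have "L / V / cmod D \<le> L / V / 1"
      using L D V by (intro divide_left_mono) auto
    finally have "\<bar>J * (L / A) - 2 * Re (\<i> * E / of_real A)\<bar> \<le> C * (L / A + L / V)
        + 2 * (cmod (E / of_real A) * ((\<bar>y\<bar> + pi / 2) / (L - y)))"
      using \<open>C \<ge> 0\<close> by (simp add: mult_left_mono)
    also have "\<dots> = B V"
      by (simp add: B_def A_def L_def E_def norm_divide norm_rGamma_wave)
    finally show ?case by (simp only: real_norm_def J_def A_def L_def E_def)
  qed
  ultimately show ?thesis by (rule Lim_null_comparison[rotated])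
qed

section \<open>A central limit theorem for dominated arrays\<close>

lemma weak_conv_m_eventually_cong:
  assumes "weak_conv_m P Q" "eventually (\<lambda>n. P n = P' n) sequentially"
  shows "weak_conv_m P' Q"
  unfolding weak_conv_m_def weak_conv_def
proof (intro allI impI)
  fix x assume "isCont (cdf Q) x"
  then have "(\<lambda>n. cdf (P n) x) \<longlonglongrightarrow> cdf Q x"
    using assms(1) by (simp add: weak_conv_m_def weak_conv_def)
  then show "(\<lambda>n. cdf (P' n) x) \<longlonglongrightarrow> cdf Q x"
    by (rule Lim_transform_eventually) (use assms(2) in \<open>auto elim: eventually_mono\<close>)
qed

lemma normal_distribution_conv_std:
  assumes "\<sigma> > 0"
  shows "density lborel (normal_density 0 \<sigma>) = distr std_normal_distribution borel (\<lambda>x. \<sigma> * x)"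
proof -
  interpret prob_space std_normal_distribution by (rule prob_space_normal_density) simp
  have "distributed std_normal_distribution lborel (\<lambda>x. x) (normal_density 0 1)"
    by (simp add: distributed_def distr_id2)
  from normal_density_affine[OF this zero_less_one, of \<sigma> 0]
  have "distributed std_normal_distribution lborel (\<lambda>x. \<sigma> * x) (normal_density 0 \<sigma>)"
    using assms by simp
  then show ?thesis by (simp add: distributed_def cong: distr_cong)
qed

lemma char_normal_distribution:
  assumes "\<sigma> > 0"
  shows "char (density lborel (normal_density 0 \<sigma>)) t = exp (of_real (- (t\<^sup>2 * \<sigma>\<^sup>2 / 2)))"
proof -
  have "char (density lborel (normal_density 0 \<sigma>)) t = char std_normal_distribution (t * \<sigma>)"
    unfolding normal_distribution_conv_std[OF assms] char_def
    by (subst integral_distr) (auto simp: mult_ac)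
  then show ?thesis
    by (simp add: char_std_normal_distribution power_mult_distrib exp_of_real[symmetric])
qed

lemma eventually_dominated_integral_tendsto_0:
  fixes f :: "nat \<Rightarrow> 'a \<Rightarrow> real"
  assumes [measurable]: "\<And>n. f n \<in> borel_measurable M"
    and w: "integrable M w"
    and lim: "\<And>x. (\<lambda>n. f n x) \<longlonglongrightarrow> 0"
    and bound: "eventually (\<lambda>n. \<forall>x. \<bar>f n x\<bar> \<le> w x) sequentially"
  shows "(\<lambda>n. \<integral>x. f n x \<partial>M) \<longlonglongrightarrow> 0"
proof -
  obtain n0 where n0: "\<And>n x. n \<ge> n0 \<Longrightarrow> \<bar>f n x\<bar> \<le> w x"
    using bound by (auto simp: eventually_sequentially)
  have "(\<lambda>n. \<integral>x. f (n + n0) x \<partial>M) \<longlonglongrightarrow> (\<integral>x. 0 \<partial>M)"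
  proof (rule integral_dominated_convergence[OF _ _ w])
    show "AE x in M. (\<lambda>n. f (n + n0) x) \<longlonglongrightarrow> 0"
      by (rule AE_I2) (rule LIMSEQ_ignore_initial_segment[OF lim])
    show "AE x in M. norm (f (n + n0) x) \<le> w x" for n
      using n0[of "n + n0"] by simp
  qed measurable
  then have "(\<lambda>n. \<integral>x. f (n + n0) x \<partial>M) \<longlonglongrightarrow> 0" by simp
  then show ?thesis by (rule LIMSEQ_offset)
qed

text \<open>The rows are independent and identically distributed, and one square integrable envelope \<open>H\<close> dominates
  all of them. So the third-order error in the expansion of the characteristic function of a single summand
  vanishes by dominated convergence, and convergence of the variances is all that remains to be assumed.\<close>

lemma weak_conv_iid_rows_dominated:
  fixes \<mu> :: "real measure" and N :: "'b measure" and X :: "nat \<Rightarrow> 'b \<Rightarrow> real"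
    and g :: "nat \<Rightarrow> real \<Rightarrow> real" and H :: "real \<Rightarrow> real"
  assumes "prob_space N"
    and indep: "prob_space.indep_vars N (\<lambda>_. borel) X {1..}"
    and distr: "\<And>k. 1 \<le> k \<Longrightarrow> distr N borel (X k) = \<mu>"
    and g[measurable]: "\<And>n. g n \<in> borel_measurable borel"
    and H[measurable]: "H \<in> borel_measurable borel"
    and H2: "integrable \<mu> (\<lambda>x. (H x)\<^sup>2)"
    and bound: "eventually (\<lambda>n. \<forall>x. \<bar>g n x\<bar> \<le> H x) sequentially"
    and var: "(\<lambda>n. (\<integral>x. (g n x)\<^sup>2 \<partial>\<mu>) - (\<integral>x. g n x \<partial>\<mu>)\<^sup>2) \<longlonglongrightarrow> \<sigma>\<^sup>2"
    and \<sigma>: "\<sigma> > 0"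
  shows "weak_conv_m
     (\<lambda>n. distr N borel (\<lambda>\<omega>. (\<Sum>k=1..n. g n (X k \<omega>) - (\<integral>x. g n x \<partial>\<mu>)) / sqrt (real n)))
     (density lborel (normal_density 0 \<sigma>))"
proof (rule levy_continuity)
  interpret N: prob_space N by fact
  have X[measurable]: "X k \<in> borel_measurable N" if "k \<ge> 1" for k
    using indep that unfolding N.indep_vars_def2 by auto
  interpret \<mu>: real_distribution \<mu>
    unfolding distr[of 1, OF order.refl, symmetric] by (rule N.real_distribution_distr) simp
  define m where "m n = (\<integral>x. g n x \<partial>\<mu>)" for n
  define v where "v n = (\<integral>x. (g n x)\<^sup>2 \<partial>\<mu>) - (m n)\<^sup>2" for n
  define \<nu> where "\<nu> n = distr \<mu> borel (\<lambda>x. g n x - m n)" for n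
  have v_lim: "v \<longlonglongrightarrow> \<sigma>\<^sup>2" using var by (simp add: v_def[abs_def] m_def)
  have sum_meas[measurable]: "(\<lambda>\<omega>. \<Sum>k=1..n. g n (X k \<omega>) - m n) \<in> borel_measurable N" for n
    by (intro borel_measurable_sum borel_measurable_diff borel_measurable_const
        measurable_compose[OF X g]) auto
  show "real_distribution (distr N borel (\<lambda>\<omega>. (\<Sum>k=1..n. g n (X k \<omega>) - (\<integral>x. g n x \<partial>\<mu>)) / sqrt (real n)))" for n
    unfolding m_def[symmetric] by (rule N.real_distribution_distr) measurable
  show "real_distribution (density lborel (normal_density 0 \<sigma>))"
    using prob_space_normal_density[OF \<sigma>] by (simp add: real_distribution_def real_distribution_axioms_def)
  have H_meas[measurable]: "H \<in> borel_measurable \<mu>" "g n \<in> borel_measurable \<mu>" for n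
    unfolding measurable_cong_sets[OF \<mu>.events_eq_borel refl] by auto
  have H1: "integrable \<mu> H" by (rule \<mu>.square_integrable_imp_integrable[OF _ H2]) measurable
  define H' where "H' x = H x + (\<integral>x. H x \<partial>\<mu>)" for x
  have H'_meas[measurable]: "H' \<in> borel_measurable \<mu>" by (simp add: H'_def[abs_def])
  have H'2: "integrable \<mu> (\<lambda>x. (H' x)\<^sup>2)"
    unfolding H'_def power2_sum using H1 H2 by simp
  fix t
  define s where "s n = t / sqrt (real n)" for n
  define I where "I n = (\<integral>x. min (6 * (g n x - m n)\<^sup>2) (\<bar>s n\<bar> * \<bar>g n x - m n\<bar> ^ 3) \<partial>\<mu>)" for n
  have int: "integrable \<mu> (\<lambda>x. (g n x)\<^sup>2)" "integrable \<mu> (g n)" "\<And>x. \<bar>g n x - m n\<bar> \<le> H' x"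
    if "\<forall>x. \<bar>g n x\<bar> \<le> H x" for n
  proof -
    have H0: "0 \<le> H x" for x using that abs_ge_zero order.trans by blast
    show 2: "integrable \<mu> (\<lambda>x. (g n x)\<^sup>2)"
      using that by (intro Bochner_Integration.integrable_bound[OF H2] AE_I2)
         (auto simp: abs_le_square_iff[symmetric] H0)
    show 1: "integrable \<mu> (g n)"
      using that by (intro Bochner_Integration.integrable_bound[OF H1] AE_I2) (auto simp: H0)
    have "\<bar>m n\<bar> \<le> (\<integral>x. \<bar>g n x\<bar> \<partial>\<mu>)" unfolding m_def by (rule integral_abs_bound)
    also have "\<dots> \<le> (\<integral>x. H x \<partial>\<mu>)"
      using 1 H1 that by (intro integral_mono) auto
    finally have "\<bar>m n\<bar> \<le> (\<integral>x. H x \<partial>\<mu>)" .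
    with that show "\<bar>g n x - m n\<bar> \<le> H' x" for x
      unfolding H'_def by (smt (verit))
  qed
  have H'_ev: "\<forall>\<^sub>F n in sequentially. \<forall>x. \<bar>g n x - m n\<bar> \<le> H' x"
    using bound by eventually_elim (blast intro: int(3))
  have I_lim: "I \<longlonglongrightarrow> 0"
    unfolding I_def[abs_def]
  proof (rule eventually_dominated_integral_tendsto_0)
    show "integrable \<mu> (\<lambda>x. 6 * (H' x)\<^sup>2)" using H'2 by simp
    show "\<forall>\<^sub>F n in sequentially. \<forall>x.
        \<bar>min (6 * (g n x - m n)\<^sup>2) (\<bar>s n\<bar> * \<bar>g n x - m n\<bar> ^ 3)\<bar> \<le> 6 * (H' x)\<^sup>2"
      using H'_ev
    proof eventually_elim
      case (elim n)
      show ?case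
      proof
        fix x
        have "(g n x - m n)\<^sup>2 \<le> (H' x)\<^sup>2"
          using power_mono[of "\<bar>g n x - m n\<bar>" "H' x" 2] elim by simp
        then show "\<bar>min (6 * (g n x - m n)\<^sup>2) (\<bar>s n\<bar> * \<bar>g n x - m n\<bar> ^ 3)\<bar> \<le> 6 * (H' x)\<^sup>2"
          by (auto simp: min_def)
      qed
    qed
    fix x
    have "\<forall>\<^sub>F n in sequentially.
        norm (min (6 * (g n x - m n)\<^sup>2) (\<bar>s n\<bar> * \<bar>g n x - m n\<bar> ^ 3)) \<le> \<bar>s n\<bar> * H' x ^ 3"
      using H'_ev
    proof eventually_elim
      case (elim n)
      have "\<bar>s n\<bar> * \<bar>g n x - m n\<bar> ^ 3 \<le> \<bar>s n\<bar> * H' x ^ 3"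
        using elim by (intro mult_left_mono power_mono) auto
      then show ?case by (auto simp: min_def)
    qed
    moreover have "s \<longlonglongrightarrow> 0"
      unfolding s_def[abs_def]
      by (intro tendsto_divide_0[OF tendsto_const] filterlim_at_top_imp_at_infinity
          filterlim_compose[OF sqrt_at_top filterlim_real_sequentially])
    then have "(\<lambda>n. \<bar>s n\<bar> * H' x ^ 3) \<longlonglongrightarrow> 0"
      by (rule tendsto_mult_left_zero[OF tendsto_rabs_zero])
    ultimately show "(\<lambda>n. min (6 * (g n x - m n)\<^sup>2) (\<bar>s n\<bar> * \<bar>g n x - m n\<bar> ^ 3)) \<longlonglongrightarrow> 0"
      by (rule Lim_null_comparison)
  qed measurable
  define \<phi> where "\<phi> n = char (distr N borel (\<lambda>\<omega>. (\<Sum>k=1..n. g n (X k \<omega>) - m n) / sqrt (real n))) t" for n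
  have \<phi>_eq: "\<phi> n = char (\<nu> n) (s n) ^ n" for n
  proof -
    define Y where "Y k \<omega> = (g n (X k \<omega>) - m n) / sqrt (real n)" for k \<omega>
    have "N.indep_vars (\<lambda>_. borel) X {1..n}"
      using indep by (rule N.indep_vars_subset) auto
    then have "N.indep_vars (\<lambda>_. borel) Y {1..n}"
      unfolding Y_def[abs_def] by (rule N.indep_vars_compose2) measurable
    then have "char (distr N borel (\<lambda>\<omega>. \<Sum>k=1..n. Y k \<omega>)) t = (\<Prod>k=1..n. char (distr N borel (Y k)) t)"
      by (rule N.char_distr_sum)
    also have "\<dots> = (\<Prod>k=1..n. char (\<nu> n) (s n))"
    proof (rule prod.cong[OF refl])
      fix k assume k: "k \<in> {1..n}"
      then have [measurable]: "X k \<in> borel_measurable N" by (intro X) simp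
      have "distr N borel (Y k) = distr (distr N borel (X k)) borel (\<lambda>x. (g n x - m n) / sqrt (real n))"
        by (subst distr_distr) (auto simp: o_def Y_def[abs_def])
      also have "distr N borel (X k) = \<mu>" using k by (intro distr) simp
      finally have "char (distr N borel (Y k)) t = (CLINT x|\<mu>. iexp (t * ((g n x - m n) / sqrt (real n))))"
        unfolding char_def by (simp add: integral_distr)
      also have "\<dots> = char (\<nu> n) (s n)"
        unfolding char_def \<nu>_def by (simp add: integral_distr s_def)
      finally show "char (distr N borel (Y k)) t = char (\<nu> n) (s n)" .
    qed
    finally show ?thesis by (simp add: \<phi>_def Y_def sum_divide_distrib)
  qed
  have main: "eventually (\<lambda>n. cmod (\<phi> n - of_real ((1 + (- (t\<^sup>2 * \<sigma>\<^sup>2 / 2)) / real n) ^ n))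
        \<le> t\<^sup>2 / 6 * I n + t\<^sup>2 / 2 * \<bar>v n - \<sigma>\<^sup>2\<bar>) sequentially"
    using bound eventually_gt_at_top[of 0] eventually_ge_at_top[of "nat \<lceil>t\<^sup>2 * \<sigma>\<^sup>2 / 4\<rceil>"]
  proof eventually_elim
    case (elim n)
    have n: "n > 0" "t\<^sup>2 * \<sigma>\<^sup>2 / 4 \<le> real n" using elim by (auto simp: nat_le_iff ceiling_le_iff)
    note int = int[OF elim(1)]
    interpret \<nu>: real_distribution "\<nu> n"
      unfolding \<nu>_def by (rule \<mu>.real_distribution_distr) measurable
    have s2: "(s n)\<^sup>2 = t\<^sup>2 / real n" by (simp add: s_def power_divide)
    have "integrable \<mu> (\<lambda>x. g n x - m n)" using int by simp
    moreover have "integrable \<mu> (\<lambda>x. (g n x - m n)\<^sup>2)" unfolding power2_diff using int by simp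
    moreover have m0: "\<mu>.expectation (\<lambda>x. g n x - m n) = 0" using int \<mu>.prob_space by (simp add: m_def)
    moreover have "\<mu>.variance (\<lambda>x. g n x - m n) = v n"
      unfolding m0 using \<mu>.variance_eq[OF int(2,1)] by (simp add: v_def m_def)
    ultimately have A: "cmod (char (\<nu> n) (s n) - (1 - (s n)\<^sup>2 * v n / 2)) \<le> (s n)\<^sup>2 / 6 * I n"
      unfolding I_def by (intro \<mu>.char_approx3') (auto simp: \<nu>_def)
    have B: "cmod (of_real (1 - (s n)\<^sup>2 * v n / 2) - of_real (1 + (- (t\<^sup>2 * \<sigma>\<^sup>2 / 2)) / real n))
        = (s n)\<^sup>2 / 2 * \<bar>v n - \<sigma>\<^sup>2\<bar>"
    proof -
      have "(1 - (s n)\<^sup>2 * v n / 2) - (1 + (- (t\<^sup>2 * \<sigma>\<^sup>2 / 2)) / real n)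
         = - ((s n)\<^sup>2 / 2 * (v n - \<sigma>\<^sup>2))"
        unfolding s2 using n by (simp add: field_simps)
      then show ?thesis
        by (simp only: of_real_diff[symmetric] norm_of_real abs_minus_cancel) (simp add: abs_mult)
    qed
    \<comment> \<open>Two errors: Taylor expansion of the characteristic function with the variance \<open>v n\<close> of the row, then
       replacement of \<open>v n\<close> by its limit.\<close>
    have diff: "cmod (char (\<nu> n) (s n) - of_real (1 + (- (t\<^sup>2 * \<sigma>\<^sup>2 / 2)) / real n))
        \<le> (s n)\<^sup>2 / 6 * I n + (s n)\<^sup>2 / 2 * \<bar>v n - \<sigma>\<^sup>2\<bar>"
      by (rule norm_diff_triangle_le[OF A eq_refl[OF B]])
    have "cmod (\<phi> n - of_real (1 + (- (t\<^sup>2 * \<sigma>\<^sup>2 / 2)) / real n) ^ n)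
      \<le> real n * cmod (char (\<nu> n) (s n) - of_real (1 + (- (t\<^sup>2 * \<sigma>\<^sup>2 / 2)) / real n))"
      unfolding \<phi>_eq
    proof (rule norm_power_diff)
      show "cmod (char (\<nu> n) (s n)) \<le> 1" by (rule \<nu>.cmod_char_le_1)
      have "\<bar>1 + (- (t\<^sup>2 * \<sigma>\<^sup>2 / 2)) / real n\<bar> \<le> 1"
        using n by (auto simp: abs_le_iff field_simps)
      then show "cmod (of_real (1 + (- (t\<^sup>2 * \<sigma>\<^sup>2 / 2)) / real n)) \<le> 1"
        by (simp only: norm_of_real)
    qed
    also have "\<dots> \<le> real n * ((s n)\<^sup>2 / 6 * I n + (s n)\<^sup>2 / 2 * \<bar>v n - \<sigma>\<^sup>2\<bar>)"
      by (intro mult_left_mono diff) simp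
    also have "\<dots> = t\<^sup>2 / 6 * I n + t\<^sup>2 / 2 * \<bar>v n - \<sigma>\<^sup>2\<bar>"
      unfolding s2 using n by (simp add: field_simps)
    finally show ?case by simp
  qed
  have "(\<lambda>n. t\<^sup>2 / 6 * I n + t\<^sup>2 / 2 * \<bar>v n - \<sigma>\<^sup>2\<bar>) \<longlonglongrightarrow> t\<^sup>2 / 6 * 0 + t\<^sup>2 / 2 * \<bar>\<sigma>\<^sup>2 - \<sigma>\<^sup>2\<bar>"
    by (intro tendsto_intros I_lim v_lim)
  then have "(\<lambda>n. t\<^sup>2 / 6 * I n + t\<^sup>2 / 2 * \<bar>v n - \<sigma>\<^sup>2\<bar>) \<longlonglongrightarrow> 0" by simp
  with main have "(\<lambda>n. \<phi> n - of_real ((1 + (- (t\<^sup>2 * \<sigma>\<^sup>2 / 2)) / real n) ^ n)) \<longlonglongrightarrow> 0"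
    by (rule Lim_null_comparison)
  moreover have "(\<lambda>n. complex_of_real ((1 + (- (t\<^sup>2 * \<sigma>\<^sup>2 / 2)) / real n) ^ n)) \<longlonglongrightarrow> of_real (exp (- (t\<^sup>2 * \<sigma>\<^sup>2 / 2)))"
    by (intro tendsto_of_real tendsto_exp_limit_sequentially)
  ultimately have "\<phi> \<longlonglongrightarrow> of_real (exp (- (t\<^sup>2 * \<sigma>\<^sup>2 / 2)))"
    by (rule Lim_transform[rotated])
  then show "(\<lambda>n. char (distr N borel (\<lambda>\<omega>. (\<Sum>k=1..n. g n (X k \<omega>) - (\<integral>x. g n x \<partial>\<mu>)) / sqrt (real n))) t)
     \<longlonglongrightarrow> char (density lborel (normal_density 0 \<sigma>)) t"
    unfolding char_normal_distribution[OF \<sigma>] exp_of_real \<phi>_def[abs_def] m_def .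
qed

section \<open>Brownian motion at an independent random time\<close>

lemma standard_brownian_motion_char:
  assumes B: "standard_brownian_motion M B" and t: "t \<ge> 0"
  shows "(CLINT \<omega>|M. iexp (u * B t \<omega>)) = of_real (exp (- (u\<^sup>2 * t / 2)))"
proof -
  interpret prob_space M using B by (simp add: standard_brownian_motion_def)
  have [measurable]: "B s \<in> borel_measurable M" if "s \<ge> 0" for s
    using B that by (simp add: standard_brownian_motion_def)
  have [measurable]: "B 0 \<in> borel_measurable M" "B t \<in> borel_measurable M" using t by simp_all
  have B0: "AE \<omega> in M. B 0 \<omega> = 0" using B by (simp add: standard_brownian_motion_def)
  show ?thesis
  proof (cases "t = 0")
    case True
    have "(CLINT \<omega>|M. iexp (u * B t \<omega>)) = (CLINT \<omega>|M. 1)"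
      unfolding True using B0 by (intro integral_cong_AE) auto
    then show ?thesis using True by (simp add: prob_space)
  next
    case False
    have D: "distributed M lborel (\<lambda>\<omega>. B t \<omega> - B 0 \<omega>) (normal_density 0 (sqrt t))"
    proof -
      have "\<forall>s t. 0 \<le> s \<longrightarrow> s < t \<longrightarrow>
          distributed M lborel (\<lambda>\<omega>. B t \<omega> - B s \<omega>) (normal_density 0 (sqrt (t - s)))"
        using B unfolding standard_brownian_motion_def by (elim conjE)
      from this[rule_format, of 0 t]
      have "distributed M lborel (\<lambda>\<omega>. B t \<omega> - B 0 \<omega>) (normal_density 0 (sqrt (t - 0)))"
        using t False by simp
      then show ?thesis by simp
    qed
    have "(CLINT \<omega>|M. iexp (u * B t \<omega>)) = (CLINT \<omega>|M. iexp (u * (B t \<omega> - B 0 \<omega>)))"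
      using B0 by (intro integral_cong_AE) auto
    also have "\<dots> = char (distr M lborel (\<lambda>\<omega>. B t \<omega> - B 0 \<omega>)) u"
      unfolding char_def by (subst integral_distr) auto
    also have "distr M lborel (\<lambda>\<omega>. B t \<omega> - B 0 \<omega>) = density lborel (normal_density 0 (sqrt t))"
      using D by (simp add: distributed_def)
    also have "char \<dots> u = exp (of_real (- (u\<^sup>2 * (sqrt t)\<^sup>2 / 2)))"
      using t False by (intro char_normal_distribution) simp
    finally show ?thesis using t by (simp add: exp_of_real[symmetric])
  qed
qed

lemma floor_grid_tendsto:
  fixes t :: real
  assumes "t \<ge> 0"
  shows "(\<lambda>n. real (nat \<lfloor>real (Suc n) * t\<rfloor>) / real (Suc n)) \<longlonglongrightarrow> t"
proof (rule real_tendsto_sandwich)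
  show "\<forall>\<^sub>F n in sequentially. t - inverse (real (Suc n)) \<le> real (nat \<lfloor>real (Suc n) * t\<rfloor>) / real (Suc n)"
  proof (intro always_eventually allI)
    fix n
    have "real (Suc n) * t - 1 \<le> of_int \<lfloor>real (Suc n) * t\<rfloor>" by linarith
    also have "\<dots> = real (nat \<lfloor>real (Suc n) * t\<rfloor>)" using assms by simp
    finally show "t - inverse (real (Suc n)) \<le> real (nat \<lfloor>real (Suc n) * t\<rfloor>) / real (Suc n)"
      by (simp add: pos_le_divide_eq left_diff_distrib mult.commute[of t] del: of_nat_Suc)
  qed
  show "\<forall>\<^sub>F n in sequentially. real (nat \<lfloor>real (Suc n) * t\<rfloor>) / real (Suc n) \<le> t"
  proof (intro always_eventually allI)
    fix n
    have "real (nat \<lfloor>real (Suc n) * t\<rfloor>) \<le> real (Suc n) * t" using assms by simp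
    then show "real (nat \<lfloor>real (Suc n) * t\<rfloor>) / real (Suc n) \<le> t"
      by (simp add: pos_divide_le_eq mult.commute del: of_nat_Suc)
  qed
  show "(\<lambda>n. t - inverse (real (Suc n))) \<longlonglongrightarrow> t"
    using tendsto_diff[OF tendsto_const LIMSEQ_inverse_real_of_nat] by simp
qed (rule tendsto_const)

text \<open>The random time is discretised to the grid of width \<open>1 / (n + 1)\<close>. At a grid point the path is evaluated
  by countably many coordinate maps, so that the independence of \<open>T\<close> from the process on the product
  \<open>\<sigma>\<close>-algebra can be used by Fubini's theorem. Continuity of the paths and dominated convergence give the
  characteristic function \<open>E exp (- u\<^sup>2 T / 2)\<close>, which is also that of \<open>sqrt T\<close> times an independent standard
  normal variable.\<close>

lemma stopped_brownian_motion:
  fixes T :: "'a \<Rightarrow> real"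
  assumes B: "standard_brownian_motion M B"
    and T_nonneg: "\<And>\<omega>. \<omega> \<in> space M \<Longrightarrow> 0 \<le> T \<omega>"
    and T[measurable]: "T \<in> borel_measurable M"
    and indep: "prob_space.indep_set M
           (sets (vimage_algebra (space M) T borel))
           (sets (vimage_algebra (space M) (\<lambda>\<omega>. \<lambda>t\<in>{0..}. B t \<omega>) (\<Pi>\<^sub>M t\<in>{0..}. borel)))"
  shows measurable_stopped_brownian_motion: "(\<lambda>\<omega>. B (T \<omega>) \<omega>) \<in> borel_measurable M"
    and distr_stopped_brownian_motion: "distr M borel (\<lambda>\<omega>. B (T \<omega>) \<omega>)
      = distr (distr M borel T \<Otimes>\<^sub>M std_normal_distribution) borel (\<lambda>(t, z). sqrt t * z)"
proof -
  interpret prob_space M using B by (simp add: standard_brownian_motion_def)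
  interpret std: prob_space std_normal_distribution by (rule prob_space_normal_density) simp
  have B_meas: "B s \<in> borel_measurable M" if "s \<ge> 0" for s
    using B that by (simp add: standard_brownian_motion_def)
  have B_cont: "continuous_on {0..} (\<lambda>t. B t \<omega>)" if "\<omega> \<in> space M" for \<omega>
    using B that by (simp add: standard_brownian_motion_def)
  define d where "d n t = real (nat \<lfloor>real (Suc n) * t\<rfloor>) / real (Suc n)" for n and t :: real
  have d_nonneg: "d n t \<ge> 0" for n t by (simp add: d_def)
  have d_lim: "(\<lambda>n. B (d n (T \<omega>)) \<omega>) \<longlonglongrightarrow> B (T \<omega>) \<omega>" if "\<omega> \<in> space M" for \<omega>
  proof (rule continuous_on_tendsto_compose[OF B_cont[OF that]])
    show "(\<lambda>n. d n (T \<omega>)) \<longlonglongrightarrow> T \<omega>"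
      unfolding d_def by (rule floor_grid_tendsto[OF T_nonneg[OF that]])
  qed (use T_nonneg[OF that] d_nonneg in auto)
  have Bd_meas[measurable]: "(\<lambda>\<omega>. B (d n (T \<omega>)) \<omega>) \<in> borel_measurable M" for n
  proof -
    have "(\<lambda>\<omega>. B (real (nat \<lfloor>real (Suc n) * T \<omega>\<rfloor>) / real (Suc n)) \<omega>) \<in> borel_measurable M"
      by (rule measurable_compose_countable[where f = "\<lambda>i \<omega>. B (real i / real (Suc n)) \<omega>" and g = "\<lambda>\<omega>. nat \<lfloor>real (Suc n) * T \<omega>\<rfloor>"])
         (auto intro!: B_meas)
    then show ?thesis by (simp add: d_def)
  qed
  show BT[measurable]: "(\<lambda>\<omega>. B (T \<omega>) \<omega>) \<in> borel_measurable M"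
    by (rule borel_measurable_LIMSEQ_real[OF d_lim Bd_meas])
  define \<tau> where "\<tau> = distr M borel T"
  interpret \<tau>: prob_space \<tau> unfolding \<tau>_def by (rule prob_space_distr) simp
  interpret P: pair_prob_space \<tau> std_normal_distribution ..
  have sets_\<tau>[measurable_cong]: "sets \<tau> = sets borel" by (simp add: \<tau>_def)
  have \<tau>_nonneg: "AE t in \<tau>. t \<ge> 0"
    unfolding \<tau>_def using T_nonneg by (subst AE_distr_iff) auto
  define \<Omega> where "\<Omega> = (\<Pi>\<^sub>M t\<in>{0::real..}. (borel :: real measure))"
  define path where "path \<omega> = (\<lambda>t\<in>{0..}. B t \<omega>)" for \<omega>
  have path[measurable]: "path \<in> measurable M \<Omega>"
    unfolding path_def[abs_def] \<Omega>_def by (intro measurable_restrict B_meas) auto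
  interpret \<Omega>: prob_space "distr M \<Omega> path" by (rule prob_space_distr) simp
  interpret Q: pair_prob_space \<tau> "distr M \<Omega> path" ..
  have joint: "\<tau> \<Otimes>\<^sub>M distr M \<Omega> path = distr M (borel \<Otimes>\<^sub>M \<Omega>) (\<lambda>\<omega>. (T \<omega>, path \<omega>))"
  proof (rule pair_measure_eqI)
    show "sets (\<tau> \<Otimes>\<^sub>M distr M \<Omega> path) = sets (distr M (borel \<Otimes>\<^sub>M \<Omega>) (\<lambda>\<omega>. (T \<omega>, path \<omega>)))"
      by (simp add: \<tau>_def cong: sets_pair_measure_cong)
    fix A C assume "A \<in> sets \<tau>" "C \<in> sets (distr M \<Omega> path)"
    then have [measurable]: "A \<in> sets borel" "C \<in> sets \<Omega>" by (simp_all add: \<tau>_def)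
    have "T -` A \<inter> space M \<in> sets (vimage_algebra (space M) T borel)"
      by (rule in_vimage_algebra) measurable
    moreover have "path -` C \<inter> space M \<in> sets (vimage_algebra (space M) (\<lambda>\<omega>. \<lambda>t\<in>{0..}. B t \<omega>) (\<Pi>\<^sub>M t\<in>{0..}. borel))"
      unfolding path_def[abs_def] \<Omega>_def[symmetric] by (rule in_vimage_algebra) measurable
    ultimately have "prob ((T -` A \<inter> space M) \<inter> (path -` C \<inter> space M))
        = prob (T -` A \<inter> space M) * prob (path -` C \<inter> space M)"
      by (rule indep_setD[OF indep])
    moreover have "(\<lambda>\<omega>. (T \<omega>, path \<omega>)) -` (A \<times> C) \<inter> space M = (T -` A \<inter> space M) \<inter> (path -` C \<inter> space M)"
      by auto
    ultimately show "emeasure \<tau> A * emeasure (distr M \<Omega> path) C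
        = emeasure (distr M (borel \<Otimes>\<^sub>M \<Omega>) (\<lambda>\<omega>. (T \<omega>, path \<omega>))) (A \<times> C)"
      by (simp add: \<tau>_def emeasure_distr emeasure_eq_measure ennreal_mult)
  qed (rule \<tau>.sigma_finite_measure_axioms \<Omega>.sigma_finite_measure_axioms)+
  have eq_d: "(CLINT \<omega>|M. iexp (u * B (d n (T \<omega>)) \<omega>)) = (CLINT t|\<tau>. of_real (exp (- (u\<^sup>2 * d n t / 2))))" for u n
  proof -
    define F where "F = (\<lambda>(t, b). iexp (u * b (d n t)))"
    have F_meas[measurable]: "F \<in> borel_measurable (borel \<Otimes>\<^sub>M \<Omega>)"
    proof -
      have "(\<lambda>x. snd x (real (nat \<lfloor>real (Suc n) * fst x\<rfloor>) / real (Suc n))) \<in> borel_measurable (borel \<Otimes>\<^sub>M \<Omega>)"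
        by (rule measurable_compose_countable[where f = "\<lambda>i x. snd x (real i / real (Suc n))" and g = "\<lambda>x. nat \<lfloor>real (Suc n) * fst x\<rfloor>"])
           (auto simp: \<Omega>_def intro!: measurable_compose[OF measurable_snd measurable_component_singleton])
      then have "(\<lambda>x. iexp (u * snd x (d n (fst x)))) \<in> borel_measurable (borel \<Otimes>\<^sub>M \<Omega>)"
        unfolding d_def by measurable
      then show ?thesis by (simp add: F_def case_prod_beta')
    qed
    have "(CLINT \<omega>|M. iexp (u * B (d n (T \<omega>)) \<omega>)) = (CLINT \<omega>|M. F (T \<omega>, path \<omega>))"
      using d_nonneg by (simp add: F_def path_def)
    also have "\<dots> = (CLINT x|distr M (borel \<Otimes>\<^sub>M \<Omega>) (\<lambda>\<omega>. (T \<omega>, path \<omega>)). F x)"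
      by (subst integral_distr) auto
    also have "\<dots> = (CLINT x|\<tau> \<Otimes>\<^sub>M distr M \<Omega> path. F x)"
      by (simp only: joint)
    also have "\<dots> = (CLINT t|\<tau>. CLINT b|distr M \<Omega> path. F (t, b))"
    proof (rule Q.integral_fst'[symmetric])
      show "integrable (\<tau> \<Otimes>\<^sub>M distr M \<Omega> path) F"
      proof (rule Q.P.integrable_const_bound[of _ 1])
        show "F \<in> borel_measurable (\<tau> \<Otimes>\<^sub>M distr M \<Omega> path)"
          using F_meas by (simp add: \<tau>_def cong: measurable_cong_sets)
      qed (auto simp: F_def)
    qed
    also have "\<dots> = (CLINT t|\<tau>. of_real (exp (- (u\<^sup>2 * d n t / 2))))"
    proof (rule Bochner_Integration.integral_cong[OF refl])
      fix t
      have [measurable]: "(\<lambda>b. F (t, b)) \<in> borel_measurable \<Omega>"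
        by (rule measurable_compose[OF _ F_meas]) simp
      have "(CLINT b|distr M \<Omega> path. F (t, b)) = (CLINT \<omega>|M. F (t, path \<omega>))"
        by (rule integral_distr) measurable
      also have "\<dots> = (CLINT \<omega>|M. iexp (u * B (d n t) \<omega>))"
        using d_nonneg by (simp add: F_def path_def)
      also have "\<dots> = of_real (exp (- (u\<^sup>2 * d n t / 2)))"
        by (rule standard_brownian_motion_char[OF B d_nonneg])
      finally show "(CLINT b|distr M \<Omega> path. F (t, b)) = of_real (exp (- (u\<^sup>2 * d n t / 2)))" .
    qed
    finally show ?thesis .
  qed
  have eq: "(CLINT \<omega>|M. iexp (u * B (T \<omega>) \<omega>)) = (CLINT t|\<tau>. of_real (exp (- (u\<^sup>2 * t / 2))))" for u
  proof (rule LIMSEQ_unique)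
    show "(\<lambda>n. CLINT \<omega>|M. iexp (u * B (d n (T \<omega>)) \<omega>)) \<longlonglongrightarrow> (CLINT \<omega>|M. iexp (u * B (T \<omega>) \<omega>))"
    proof (rule integral_dominated_convergence[where w = "\<lambda>_. 1"])
      show "AE \<omega> in M. (\<lambda>n. iexp (u * B (d n (T \<omega>)) \<omega>)) \<longlonglongrightarrow> iexp (u * B (T \<omega>) \<omega>)"
        by (intro AE_I2 tendsto_intros d_lim)
    qed auto
    have d_meas[measurable]: "d n \<in> borel_measurable \<tau>" for n
      unfolding d_def by measurable
    show "(\<lambda>n. CLINT \<omega>|M. iexp (u * B (d n (T \<omega>)) \<omega>)) \<longlonglongrightarrow> (CLINT t|\<tau>. of_real (exp (- (u\<^sup>2 * t / 2))))"
      unfolding eq_d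
    proof (rule integral_dominated_convergence[where w = "\<lambda>_. 1"])
      show "AE t in \<tau>. (\<lambda>n. complex_of_real (exp (- (u\<^sup>2 * d n t / 2)))) \<longlonglongrightarrow> of_real (exp (- (u\<^sup>2 * t / 2)))"
        using \<tau>_nonneg
      proof eventually_elim
        case (elim t)
        then have "(\<lambda>n. d n t) \<longlonglongrightarrow> t" unfolding d_def by (rule floor_grid_tendsto)
        then show ?case by (intro tendsto_intros) auto
      qed
      show "AE t in \<tau>. norm (complex_of_real (exp (- (u\<^sup>2 * d n t / 2)))) \<le> 1" for n
        using d_nonneg by simp
    qed measurable
  qed
  define g where "g = (\<lambda>(t, z). sqrt t * z :: real)"
  have g_meas[measurable]: "g \<in> borel_measurable (\<tau> \<Otimes>\<^sub>M std_normal_distribution)"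
    unfolding g_def by measurable
  have "distr M borel (\<lambda>\<omega>. B (T \<omega>) \<omega>) = distr (\<tau> \<Otimes>\<^sub>M std_normal_distribution) borel g"
  proof (rule Levy_uniqueness)
    show "real_distribution (distr M borel (\<lambda>\<omega>. B (T \<omega>) \<omega>))"
      by (rule real_distribution_distr) simp
    show "real_distribution (distr (\<tau> \<Otimes>\<^sub>M std_normal_distribution) borel g)"
      by (rule P.P.real_distribution_distr) simp
    show "char (distr M borel (\<lambda>\<omega>. B (T \<omega>) \<omega>)) = char (distr (\<tau> \<Otimes>\<^sub>M std_normal_distribution) borel g)"
    proof
      fix u
      have "char (distr (\<tau> \<Otimes>\<^sub>M std_normal_distribution) borel g) u = (CLINT x|\<tau> \<Otimes>\<^sub>M std_normal_distribution. iexp (u * g x))"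
        unfolding char_def by (rule integral_distr) measurable
      also have "\<dots> = (CLINT t|\<tau>. CLINT z|std_normal_distribution. iexp (u * g (t, z)))"
        by (intro P.integral_fst'[symmetric] P.P.integrable_iexp) auto
      also have "\<dots> = (CLINT t|\<tau>. char std_normal_distribution (u * sqrt t))"
        by (simp add: char_def g_def mult.assoc)
      also have "\<dots> = (CLINT t|\<tau>. of_real (exp (- (u\<^sup>2 * t / 2))))"
        using \<tau>_nonneg by (intro integral_cong_AE) (auto simp: char_std_normal_distribution power_mult_distrib)
      also have "\<dots> = char (distr M borel (\<lambda>\<omega>. B (T \<omega>) \<omega>)) u"
        unfolding eq[symmetric] char_def by (rule integral_distr[symmetric]) measurable
      finally show "char (distr M borel (\<lambda>\<omega>. B (T \<omega>) \<omega>)) u = char (distr (\<tau> \<Otimes>\<^sub>M std_normal_distribution) borel g) u" ..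
    qed
  qed
  then show "distr M borel (\<lambda>\<omega>. B (T \<omega>) \<omega>)
      = distr (distr M borel T \<Otimes>\<^sub>M std_normal_distribution) borel (\<lambda>(t, z). sqrt t * z)"
    by (simp add: g_def \<tau>_def)
qed

section \<open>Powers and oscillating powers of normal mixtures\<close>

text \<open>The integrand of the Gamma function at \<open>s + 1\<close> and its reflection.\<close>

lemma integrable_abs_powr_times_exp:
  fixes s :: real
  assumes "s > -1"
  shows "integrable lborel (\<lambda>z. \<bar>z\<bar> powr s * exp (- \<bar>z\<bar>))"
proof -
  define f where "f t = indicator {0<..} t * (t powr s * exp (- t))" for t :: real
  have f_meas[measurable]: "f \<in> borel_measurable borel" unfolding f_def by measurable
  have "integrable lebesgue (\<lambda>t. indicator {0<..} t *\<^sub>R (complex_of_real t powr (of_real (s + 1) - 1) / of_real (exp t)))"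
    using absolutely_integrable_Gamma_integral'[of "of_real (s + 1)"] assms
    by (simp add: set_integrable_def)
  then have "integrable lebesgue (\<lambda>t. norm (indicator {0<..} t *\<^sub>R (complex_of_real t powr (of_real (s + 1) - 1) / of_real (exp t))))"
    by (rule integrable_norm)
  also have "(\<lambda>t. norm (indicator {0<..} t *\<^sub>R (complex_of_real t powr (of_real (s + 1) - 1) / of_real (exp t)))) = f"
    by (auto simp: fun_eq_iff f_def indicator_def norm_divide norm_powr_real_powr exp_minus divide_inverse norm_mult norm_inverse)
  finally have f: "integrable lborel f"
    by (simp add: integrable_completion)
  have "integrable lborel (\<lambda>z. f (0 + (- 1) * z))"
    by (rule lborel_integrable_real_affine[OF f]) simp
  with f have "integrable lborel (\<lambda>z. f z + f (0 + (- 1) * z))" by (rule Bochner_Integration.integrable_add)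
  also have "(\<lambda>z. f z + f (0 + (- 1) * z)) = (\<lambda>z. \<bar>z\<bar> powr s * exp (- \<bar>z\<bar>))"
    by (auto simp: fun_eq_iff f_def indicator_def)
  finally show ?thesis .
qed

text \<open>Since \<open>z\<^sup>2 / 2 \<ge> \<bar>z\<bar> - 1 / 2\<close>, the Gaussian factor is dominated by an exponential.\<close>

lemma integrable_abs_powr_std_normal_density:
  fixes s :: real
  assumes "s > -1"
  shows "integrable lborel (\<lambda>z. \<bar>z\<bar> powr s * std_normal_density z)"
proof (rule Bochner_Integration.integrable_bound)
  show "integrable lborel (\<lambda>z. exp (1 / 2) * (\<bar>z\<bar> powr s * exp (- \<bar>z\<bar>)))"
    using integrable_abs_powr_times_exp[OF assms] by simp
  show "AE z in lborel. norm (\<bar>z\<bar> powr s * std_normal_density z) \<le> norm (exp (1 / 2) * (\<bar>z\<bar> powr s * exp (- \<bar>z\<bar>)))"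
  proof (rule AE_I2)
    fix z :: real
    have "0 \<le> (\<bar>z\<bar> - 1)\<^sup>2" by simp
    then have "- z\<^sup>2 / 2 \<le> 1 / 2 + - \<bar>z\<bar>" by (simp add: power2_diff)
    then have "exp (- z\<^sup>2 / 2) \<le> exp (1 / 2) * exp (- \<bar>z\<bar>)"
      unfolding exp_add[symmetric] by (simp only: exp_le_cancel_iff)
    moreover have "1 / sqrt (2 * pi) \<le> 1" using pi_gt3 by simp
    ultimately have "std_normal_density z \<le> 1 * (exp (1 / 2) * exp (- \<bar>z\<bar>))"
      unfolding std_normal_density_def by (intro mult_mono) auto
    then have "\<bar>z\<bar> powr s * std_normal_density z \<le> \<bar>z\<bar> powr s * (exp (1 / 2) * exp (- \<bar>z\<bar>))"
      by (intro mult_left_mono) auto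
    then show "norm (\<bar>z\<bar> powr s * std_normal_density z) \<le> norm (exp (1 / 2) * (\<bar>z\<bar> powr s * exp (- \<bar>z\<bar>)))"
      by (simp add: abs_mult mult_ac)
  qed
qed simp

lemma integrable_std_normal_distribution_abs_powr:
  fixes s :: real
  assumes "s > -1"
  shows "integrable std_normal_distribution (\<lambda>z. \<bar>z\<bar> powr s)"
  using integrable_abs_powr_std_normal_density[OF assms]
  by (subst integrable_density) (auto simp: mult.commute)

text \<open>For \<open>x \<noteq> 0\<close> this is the complex power \<open>\<bar>x\<bar> powr (s + \<i> u)\<close>; the split form separates modulus and phase and
  vanishes at \<open>x = 0\<close>.\<close>

definition osc_powr :: "real \<Rightarrow> real \<Rightarrow> real \<Rightarrow> complex" where
  "osc_powr s u x = of_real (\<bar>x\<bar> powr s) * iexp (u * ln \<bar>x\<bar>)"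

lemma norm_osc_powr: "cmod (osc_powr s u x) = \<bar>x\<bar> powr s"
  by (simp add: osc_powr_def norm_mult)

lemma measurable_osc_powr[measurable]: "osc_powr s u \<in> borel_measurable borel"
  unfolding osc_powr_def[abs_def] by measurable

lemma osc_powr_mult: "osc_powr s u (x * y) = osc_powr s u x * osc_powr s u y"
proof (cases "x = 0 \<or> y = 0")
  case False
  then have "ln \<bar>x * y\<bar> = ln \<bar>x\<bar> + ln \<bar>y\<bar>" by (simp add: abs_mult ln_mult)
  then show ?thesis
    by (simp add: osc_powr_def abs_mult powr_mult exp_add[symmetric] algebra_simps)
qed (auto simp: osc_powr_def)

text \<open>The Riemann-Lebesgue lemma on the multiplicative group: rescaling the variable by \<open>r = exp (\<pi> / u)\<close>
  multiplies the oscillating factor by \<open>-1\<close>. Hence twice the integral is the integral of the oscillating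
  factor against \<open>f z - r f (r z)\<close>, where \<open>f\<close> is \<open>\<bar>z\<bar> powr s\<close> times the density, and \<open>r\<close> tends to \<open>1\<close>.\<close>

lemma std_normal_osc_powr_tendsto_0:
  fixes s :: real
  assumes s: "s > -1"
  shows "((\<lambda>u. CLINT z|std_normal_distribution. osc_powr s u z) \<longlongrightarrow> 0) at_top"
proof -
  define f where "f z = \<bar>z\<bar> powr s * std_normal_density z" for z
  define r where "r u = exp (pi / u)" for u :: real
  define I where "I u = (LINT z|lborel. \<bar>f z - r u * f (r u * z)\<bar>)" for u
  have f: "integrable lborel f"
    unfolding f_def using integrable_abs_powr_std_normal_density[OF s] .
  have f_nonneg: "f z \<ge> 0" for z by (simp add: f_def normal_density_nonneg)
  have f_meas[measurable]: "f \<in> borel_measurable borel" unfolding f_def[abs_def] by measurable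
  have bound: "norm (CLINT z|std_normal_distribution. osc_powr s u z) \<le> I u / 2" if u: "u > 0" for u
  proof -
    define q where "q = (CLINT z|lborel. of_real (f z) * iexp (u * ln \<bar>z\<bar>))"
    have r: "r u > 0" "ln (r u) = pi / u" by (simp_all add: r_def)
    have "(CLINT z|std_normal_distribution. osc_powr s u z) = q"
      unfolding q_def
      by (subst integral_density) (auto simp: osc_powr_def f_def normal_density_nonneg scaleR_conv_of_real mult_ac)
    have int: "integrable lborel (\<lambda>z. of_real (f z) * iexp (u * ln \<bar>z\<bar>))"
      by (rule Bochner_Integration.integrable_bound[OF f]) (auto simp: norm_mult)
    have fr: "integrable lborel (\<lambda>z. f (0 + r u * z))"
      by (rule lborel_integrable_real_affine[OF f]) (use r in auto)
    have intr: "integrable lborel (\<lambda>z. of_real (r u * f (r u * z)) * iexp (u * ln \<bar>z\<bar>))"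
      by (rule Bochner_Integration.integrable_bound[OF integrable_mult_right[OF fr, of "r u"]])
         (auto simp: norm_mult)
    have "q = r u *\<^sub>R (CLINT z|lborel. of_real (f (0 + r u * z)) * iexp (u * ln \<bar>0 + r u * z\<bar>))"
      unfolding q_def using r by (subst lborel_integral_real_affine[of "r u" _ 0]) auto
    also have "(CLINT z|lborel. of_real (f (0 + r u * z)) * iexp (u * ln \<bar>0 + r u * z\<bar>))
       = (CLINT z|lborel. - (of_real (f (r u * z)) * iexp (u * ln \<bar>z\<bar>)))"
    proof (rule Bochner_Integration.integral_cong[OF refl])
      fix z :: real
      show "of_real (f (0 + r u * z)) * iexp (u * ln \<bar>0 + r u * z\<bar>) = - (of_real (f (r u * z)) * iexp (u * ln \<bar>z\<bar>))"
      proof (cases "z = 0")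
        case False
        have "u * ln \<bar>r u * z\<bar> = pi + u * ln \<bar>z\<bar>"
          using False r u by (simp add: abs_mult ln_mult field_simps)
        then have "iexp (u * ln \<bar>r u * z\<bar>) = - iexp (u * ln \<bar>z\<bar>)"
          by (simp add: distrib_left exp_add)
        then show ?thesis by simp
      qed (simp add: f_def)
    qed
    finally have "q = - (CLINT z|lborel. of_real (r u * f (r u * z)) * iexp (u * ln \<bar>z\<bar>))"
      by (simp add: scaleR_conv_of_real mult.assoc)
    then have "2 * q = q - (CLINT z|lborel. of_real (r u * f (r u * z)) * iexp (u * ln \<bar>z\<bar>))"
      by simp
    also have "\<dots> = (CLINT z|lborel. of_real (f z) * iexp (u * ln \<bar>z\<bar>) - of_real (r u * f (r u * z)) * iexp (u * ln \<bar>z\<bar>))"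
      unfolding q_def by (rule Bochner_Integration.integral_diff[OF int intr, symmetric])
    also have "\<dots> = (CLINT z|lborel. of_real (f z - r u * f (r u * z)) * iexp (u * ln \<bar>z\<bar>))"
      by (simp add: left_diff_distrib)
    finally have "norm (2 * q) \<le> (LINT z|lborel. norm (of_real (f z - r u * f (r u * z)) * iexp (u * ln \<bar>z\<bar>)))"
      by (simp only: integral_norm_bound)
    also have "\<dots> = I u"
      unfolding I_def norm_mult norm_of_real by simp
    finally have "norm q \<le> I u / 2" by (simp add: norm_mult)
    with \<open>_ = q\<close> show ?thesis by simp
  qed
  have r_lim: "(r \<longlongrightarrow> 1) at_top"
  proof -
    have "((\<lambda>u::real. pi / u) \<longlongrightarrow> 0) at_top"
      by (rule tendsto_divide_0[OF tendsto_const filterlim_at_top_imp_at_infinity[OF filterlim_ident]])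
    from tendsto_exp[OF this] show ?thesis by (simp add: r_def[abs_def])
  qed
  have "(I \<longlongrightarrow> (LINT z::real|lborel. (0::real))) at_top"
    unfolding I_def[abs_def]
  proof (rule integral_dominated_convergence_at_top[where s = "\<lambda>u z. \<bar>f z - r u * f (r u * z)\<bar>" and f = "\<lambda>_. 0" and M = lborel and w = "\<lambda>z. (1 + exp pi * exp (\<bar>s\<bar> * pi)) * f z"])
    show "integrable lborel (\<lambda>z. (1 + exp pi * exp (\<bar>s\<bar> * pi)) * f z)" using f by simp
    show "AE z in lborel. ((\<lambda>u. \<bar>f z - r u * f (r u * z)\<bar>) \<longlongrightarrow> 0) at_top"
    proof (rule AE_I2)
      fix z :: real
      show "((\<lambda>u. \<bar>f z - r u * f (r u * z)\<bar>) \<longlongrightarrow> 0) at_top"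
      proof (cases "z = 0")
        case False
        have "((\<lambda>u. f z - r u * f (r u * z)) \<longlongrightarrow> f z - 1 * f (1 * z)) at_top"
          unfolding f_def std_normal_density_def using False
          by (intro tendsto_intros r_lim) auto
        then show ?thesis by (intro tendsto_rabs_zero) simp
      qed (simp add: f_def)
    qed
    show "\<forall>\<^sub>F u in at_top. AE z in lborel. norm \<bar>f z - r u * f (r u * z)\<bar> \<le> (1 + exp pi * exp (\<bar>s\<bar> * pi)) * f z"
      using eventually_ge_at_top[of 1]
    proof eventually_elim
      case (elim u)
      have r1: "1 \<le> r u" "r u \<le> exp pi"
        using elim pi_gt3 by (auto simp: r_def field_simps)
      show ?case
      proof (rule AE_I2)
        fix z :: real
        have "r u powr s \<le> r u powr \<bar>s\<bar>" using r1 by (intro powr_mono) auto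
        also have "\<dots> \<le> exp pi powr \<bar>s\<bar>" using r1 by (intro powr_mono2) auto
        also have "\<dots> = exp (\<bar>s\<bar> * pi)" by (simp add: powr_def)
        finally have "r u powr s * \<bar>z\<bar> powr s \<le> exp (\<bar>s\<bar> * pi) * \<bar>z\<bar> powr s" by (intro mult_right_mono) auto
        moreover have "std_normal_density (r u * z) \<le> std_normal_density z"
        proof -
          have "1 * z\<^sup>2 \<le> (r u)\<^sup>2 * z\<^sup>2" using r1 by (intro mult_right_mono) auto
          then have "exp (- (r u * z)\<^sup>2 / 2) \<le> exp (- z\<^sup>2 / 2)" by (simp add: power_mult_distrib)
          then show ?thesis unfolding std_normal_density_def by (intro mult_left_mono) auto
        qed
        ultimately have "(r u powr s * \<bar>z\<bar> powr s) * std_normal_density (r u * z) \<le> (exp (\<bar>s\<bar> * pi) * \<bar>z\<bar> powr s) * std_normal_density z"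
          by (rule mult_mono) (auto simp: normal_density_nonneg)
        then have "f (r u * z) \<le> exp (\<bar>s\<bar> * pi) * f z"
          using r1 by (simp add: f_def abs_mult powr_mult mult_ac)
        then have "r u * f (r u * z) \<le> exp pi * (exp (\<bar>s\<bar> * pi) * f z)"
          using r1 f_nonneg by (intro mult_mono) auto
        moreover have "0 \<le> r u * f (r u * z)" using r1 f_nonneg by simp
        ultimately show "norm \<bar>f z - r u * f (r u * z)\<bar> \<le> (1 + exp pi * exp (\<bar>s\<bar> * pi)) * f z"
          using f_nonneg[of z] by (simp add: distrib_right)
      qed
    qed
  qed measurable
  then have "((\<lambda>u. I u / 2) \<longlongrightarrow> 0) at_top" using tendsto_divide_zero by simp
  moreover have "\<forall>\<^sub>F u in at_top. norm (CLINT z|std_normal_distribution. osc_powr s u z) \<le> I u / 2"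
    using eventually_gt_at_top[of 0] by eventually_elim (rule bound)
  ultimately show ?thesis by (rule Lim_null_comparison[rotated])
qed

lemma (in prob_space) integral_pos_of_AE_pos:
  fixes f :: "'a \<Rightarrow> real"
  assumes "integrable M f" "AE x in M. f x > 0"
  shows "0 < (\<integral>x. f x \<partial>M)"
  using integral_less_AE_space[of "\<lambda>_. 0" f] assms by (simp add: emeasure_space_1)

text \<open>The functions \<open>osc_powr s u\<close> are multiplicative, so their integral with respect to the law of \<open>sqrt T\<close>
  times an independent standard normal \<open>Z\<close> factorises. The factor of \<open>Z\<close> carries the decay in \<open>u\<close>.\<close>

lemma (in prob_space) normal_mixture_powr:
  fixes s :: real and T :: "'a \<Rightarrow> real"
  defines "\<mu> \<equiv> distr (distr M borel T \<Otimes>\<^sub>M std_normal_distribution) borel (\<lambda>(t, z). sqrt t * z)"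
  assumes T[measurable]: "T \<in> borel_measurable M"
    and T_pos: "AE \<omega> in M. T \<omega> > 0"
    and s: "s > -1"
    and int: "integrable M (\<lambda>\<omega>. T \<omega> powr (s / 2))"
  shows integrable_normal_mixture_powr: "integrable \<mu> (\<lambda>x. \<bar>x\<bar> powr s)"
    and integral_normal_mixture_powr_pos: "0 < (\<integral>x. \<bar>x\<bar> powr s \<partial>\<mu>)"
    and normal_mixture_osc_powr_tendsto_0: "((\<lambda>u. CLINT x|\<mu>. osc_powr s u x) \<longlongrightarrow> 0) at_top"
proof -
  define \<tau> where "\<tau> = distr M borel T"
  define \<nu> where "\<nu> = \<tau> \<Otimes>\<^sub>M std_normal_distribution"
  interpret std: prob_space std_normal_distribution by (rule prob_space_normal_density) simp
  interpret \<tau>: prob_space \<tau> unfolding \<tau>_def by (rule prob_space_distr) simp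
  interpret P: pair_prob_space \<tau> std_normal_distribution ..
  have sets_\<tau>[measurable_cong]: "sets \<tau> = sets borel" by (simp add: \<tau>_def)
  have \<tau>_pos: "AE t in \<tau>. t > 0"
    unfolding \<tau>_def using T_pos by (subst AE_distr_iff) auto
  have std_nz: "AE z in std_normal_distribution. z \<noteq> 0"
    by (subst AE_density) (auto intro: AE_mp[OF AE_lborel_singleton[of 0]])
  have g_meas[measurable]: "(\<lambda>(t, z). sqrt t * z) \<in> borel_measurable (\<tau> \<Otimes>\<^sub>M std_normal_distribution)"
    by measurable
  have \<mu>: "\<mu> = distr \<nu> borel (\<lambda>(t, z). sqrt t * z)" by (simp add: \<mu>_def \<nu>_def \<tau>_def)
  have norm_eq: "cmod (osc_powr s u (sqrt t)) = t powr (s / 2)" if "t > 0" for t u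
    using that by (simp add: norm_osc_powr powr_half_sqrt[symmetric] powr_powr)
  have int_\<tau>: "integrable \<tau> (\<lambda>t. t powr (s / 2))"
    using int by (simp add: \<tau>_def integrable_distr_eq)
  have int_\<tau>': "integrable \<tau> (\<lambda>t. osc_powr s u (sqrt t))" for u
  proof (rule Bochner_Integration.integrable_bound[OF int_\<tau>])
    show "AE t in \<tau>. norm (osc_powr s u (sqrt t)) \<le> norm (t powr (s / 2))"
      using \<tau>_pos by eventually_elim (simp add: norm_eq)
  qed measurable
  have int_std: "integrable std_normal_distribution (\<lambda>z. \<bar>z\<bar> powr s)"
    by (rule integrable_std_normal_distribution_abs_powr[OF s])
  have int_std': "integrable std_normal_distribution (osc_powr s u)" for u
    by (rule Bochner_Integration.integrable_bound[OF int_std]) (auto simp: norm_osc_powr)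
  have int_\<nu>: "integrable \<nu> (\<lambda>x. osc_powr s u (sqrt (fst x)) * osc_powr s u (snd x))" for u
    unfolding \<nu>_def
  proof (rule P.Fubini_integrable)
    have "(\<lambda>t. \<integral>z. norm (osc_powr s u (sqrt (fst (t, z))) * osc_powr s u (snd (t, z))) \<partial>std_normal_distribution)
       = (\<lambda>t. norm (osc_powr s u (sqrt t)) * (\<integral>z. \<bar>z\<bar> powr s \<partial>std_normal_distribution))"
      by (simp add: norm_mult norm_osc_powr[of s u] fun_eq_iff)
    then show "integrable \<tau> (\<lambda>t. \<integral>z. norm (osc_powr s u (sqrt (fst (t, z))) * osc_powr s u (snd (t, z))) \<partial>std_normal_distribution)"
      using integrable_norm[OF int_\<tau>'[of u]] by simp
    show "AE t in \<tau>. integrable std_normal_distribution (\<lambda>z. osc_powr s u (sqrt (fst (t, z))) * osc_powr s u (snd (t, z)))"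
      using int_std'[of u] by simp
  qed measurable
  have osc_\<nu>: "osc_powr s u ((\<lambda>(t, z). sqrt t * z) x) = osc_powr s u (sqrt (fst x)) * osc_powr s u (snd x)" for u x
    by (simp add: case_prod_beta osc_powr_mult)
  have int_\<mu>: "integrable \<mu> (osc_powr s u)" for u
    unfolding \<mu> using int_\<nu>[of u] by (subst integrable_distr_eq) (auto simp: \<nu>_def osc_\<nu>)
  have "integrable \<mu> (\<lambda>x. cmod (osc_powr s 0 x))"
    by (rule integrable_norm[OF int_\<mu>])
  then show int_\<mu>_abs: "integrable \<mu> (\<lambda>x. \<bar>x\<bar> powr s)" by (simp only: norm_osc_powr)
  have "(CLINT x|\<mu>. osc_powr s u x) = (CLINT t|\<tau>. osc_powr s u (sqrt t)) * (CLINT z|std_normal_distribution. osc_powr s u z)" for u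
  proof -
    have "(CLINT x|\<mu>. osc_powr s u x) = (CLINT x|\<nu>. osc_powr s u (sqrt (fst x)) * osc_powr s u (snd x))"
      unfolding \<mu> by (subst integral_distr) (auto simp: \<nu>_def osc_\<nu>)
    also have "\<dots> = (CLINT t|\<tau>. CLINT z|std_normal_distribution. osc_powr s u (sqrt t) * osc_powr s u z)"
      using P.integral_fst'[OF int_\<nu>[unfolded \<nu>_def], of u] by (simp add: \<nu>_def)
    also have "\<dots> = (CLINT t|\<tau>. osc_powr s u (sqrt t)) * (CLINT z|std_normal_distribution. osc_powr s u z)"
      by simp
    finally show ?thesis .
  qed
  moreover have "((\<lambda>u. (CLINT t|\<tau>. osc_powr s u (sqrt t)) * (CLINT z|std_normal_distribution. osc_powr s u z)) \<longlongrightarrow> 0) at_top"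
  proof (rule Lim_null_comparison)
    show "\<forall>\<^sub>F u in at_top. norm ((CLINT t|\<tau>. osc_powr s u (sqrt t)) * (CLINT z|std_normal_distribution. osc_powr s u z))
        \<le> (\<integral>t. t powr (s / 2) \<partial>\<tau>) * norm (CLINT z|std_normal_distribution. osc_powr s u z)"
    proof (intro always_eventually allI)
      fix u
      have "norm (CLINT t|\<tau>. osc_powr s u (sqrt t)) \<le> (\<integral>t. norm (osc_powr s u (sqrt t)) \<partial>\<tau>)"
        by (rule integral_norm_bound)
      also have "\<dots> = (\<integral>t. t powr (s / 2) \<partial>\<tau>)"
      proof (rule integral_cong_AE)
        show "AE t in \<tau>. norm (osc_powr s u (sqrt t)) = t powr (s / 2)"
          using \<tau>_pos by eventually_elim (simp add: norm_eq)
      qed measurable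
      finally show "norm ((CLINT t|\<tau>. osc_powr s u (sqrt t)) * (CLINT z|std_normal_distribution. osc_powr s u z))
        \<le> (\<integral>t. t powr (s / 2) \<partial>\<tau>) * norm (CLINT z|std_normal_distribution. osc_powr s u z)"
        unfolding norm_mult by (intro mult_right_mono) auto
    qed
    show "((\<lambda>u. (\<integral>t. t powr (s / 2) \<partial>\<tau>) * norm (CLINT z|std_normal_distribution. osc_powr s u z)) \<longlongrightarrow> 0) at_top"
      by (intro tendsto_mult_right_zero tendsto_norm_zero std_normal_osc_powr_tendsto_0 s)
  qed
  ultimately show "((\<lambda>u. CLINT x|\<mu>. osc_powr s u x) \<longlongrightarrow> 0) at_top" by simp
  show "0 < (\<integral>x. \<bar>x\<bar> powr s \<partial>\<mu>)"
  proof -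
    have "(\<integral>x. \<bar>x\<bar> powr s \<partial>\<mu>) = (\<integral>x. norm (osc_powr s 0 (sqrt (fst x)) * osc_powr s 0 (snd x)) \<partial>\<nu>)"
      unfolding \<mu> by (subst integral_distr) (auto simp: \<nu>_def osc_\<nu>[symmetric] norm_osc_powr)
    also have "\<dots> = (\<integral>t. (\<integral>z. norm (osc_powr s 0 (sqrt t) * osc_powr s 0 z) \<partial>std_normal_distribution) \<partial>\<tau>)"
      using P.integral_fst'[OF integrable_norm[OF int_\<nu>[unfolded \<nu>_def], of 0]] by (simp add: \<nu>_def)
    also have "\<dots> = (\<integral>t. norm (osc_powr s 0 (sqrt t)) \<partial>\<tau>) * (\<integral>z. \<bar>z\<bar> powr s \<partial>std_normal_distribution)"
      by (simp add: norm_mult norm_osc_powr)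
    also have "\<dots> > 0"
    proof (rule mult_pos_pos)
      show "0 < (\<integral>t. norm (osc_powr s 0 (sqrt t)) \<partial>\<tau>)"
        using \<tau>_pos by (intro \<tau>.integral_pos_of_AE_pos integrable_norm int_\<tau>') (auto simp: norm_osc_powr)
      show "0 < (\<integral>z. \<bar>z\<bar> powr s \<partial>std_normal_distribution)"
        using std_nz by (intro std.integral_pos_of_AE_pos int_std) auto
    qed
    finally show ?thesis .
  qed
qed

section \<open>The estimator as a mean of scores\<close>

text \<open>The contribution of one observation \<open>r\<close> to the estimator with bandwidth \<open>1 / V\<close>.\<close>

definition score :: "real \<Rightarrow> real \<Rightarrow> real \<Rightarrow> real \<Rightarrow> real" where
  "score \<gamma> x V r = (2 * x) powr (- \<gamma>) / sqrt pi * \<bar>r\<bar> powr (2 * \<gamma> - 2) *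
     Re (integral {-V..V} (rGamma_wave (\<gamma> - 1/2) (2 * ln \<bar>r\<bar> - ln (2 * x))))"

lemma integral_rGamma_wave_eq_lebesgue:
  "integral {-V..V} (rGamma_wave \<alpha> y) = (CLBINT v:{-V..V}. rGamma_wave \<alpha> y v)"
  by (intro set_borel_integral_eq_integral(2)[symmetric] borel_integrable_atLeastAtMost' continuous_on_rGamma_wave)

lemma measurable_score[measurable]: "score \<gamma> x V \<in> borel_measurable borel"
proof -
  have rG: "(\<lambda>v. rGamma (of_real \<alpha> + \<i> * of_real v)) \<in> borel_measurable borel" for \<alpha> :: real
    by (intro borel_measurable_continuous_onI continuous_intros continuous_on_compose2[OF continuous_on_rGamma[of UNIV]]) auto
  note [measurable] = measurable_compose[OF measurable_snd rG]
  have [measurable]: "(\<lambda>(y, v). indicat_real {-V..V} v *\<^sub>R rGamma_wave \<alpha> y v) \<in> borel_measurable (borel \<Otimes>\<^sub>M lborel)" for \<alpha>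
    unfolding rGamma_wave_def case_prod_beta by measurable
  have [measurable]: "(\<lambda>y. integral {-V..V} (rGamma_wave \<alpha> y)) \<in> borel_measurable borel" for \<alpha>
    unfolding integral_rGamma_wave_eq_lebesgue set_lebesgue_integral_def
    by (rule lborel.borel_measurable_lebesgue_integral) measurable
  show ?thesis unfolding score_def[abs_def] by measurable
qed

lemma powr_complex_polar:
  assumes "r > 0"
  shows "complex_of_real r powr (of_real s + \<i> * of_real v) = of_real (r powr s) * iexp (v * ln r)"
proof -
  have "complex_of_real r powr (of_real s + \<i> * of_real v) = exp ((of_real s + \<i> * of_real v) * of_real (ln r))"
    using assms by (simp add: powr_def Ln_of_real)
  also have "\<dots> = exp (of_real (s * ln r)) * iexp (v * ln r)"
    by (simp add: exp_add[symmetric] algebra_simps)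
  also have "exp (complex_of_real (s * ln r)) = of_real (r powr s)"
    using assms by (simp add: powr_def exp_of_real[symmetric])
  finally show ?thesis .
qed

lemma pT_estimator_eq_mean_score:
  assumes x: "x > 0"
  shows "pT_estimator \<gamma> h n Y x = (\<Sum>k=1..n. score \<gamma> x (1 / h) (Y k)) / real n"
proof -
  define \<alpha> where "\<alpha> = \<gamma> - 1/2"
  define y where "y k = 2 * ln \<bar>Y k\<bar> - ln (2 * x)" for k
  define c where "c k = (2 * x) powr (- \<gamma>) * \<bar>Y k\<bar> powr (2 * \<gamma> - 2)" for k
  have term_eq: "complex_of_real \<bar>Y k\<bar> powr (2 * (of_real \<gamma> + \<i> * of_real v - 1)) *
      (complex_of_real x powr (- of_real \<gamma> - \<i> * of_real v) /
       (2 powr (of_real \<gamma> + \<i> * of_real v) * Gamma (of_real \<gamma> - 1/2 + \<i> * of_real v)))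
    = of_real (c k) * rGamma_wave \<alpha> (y k) v" for k v
  proof (cases "Y k = 0")
    case False
    have 1: "complex_of_real \<bar>Y k\<bar> powr (2 * (of_real \<gamma> + \<i> * of_real v - 1))
        = of_real (\<bar>Y k\<bar> powr (2 * \<gamma> - 2)) * iexp (2 * v * ln \<bar>Y k\<bar>)"
      using powr_complex_polar[of "\<bar>Y k\<bar>" "2 * \<gamma> - 2" "2 * v"] False by (simp add: algebra_simps)
    have 2: "complex_of_real x powr (- of_real \<gamma> - \<i> * of_real v) = of_real (x powr (- \<gamma>)) * iexp (- v * ln x)"
      using powr_complex_polar[of x "- \<gamma>" "- v"] x by simp
    have 3: "2 powr (of_real \<gamma> + \<i> * of_real v) = complex_of_real (2 powr \<gamma>) * iexp (v * ln 2)"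
      using powr_complex_polar[of 2 \<gamma> v] by simp
    have 4: "iexp (2 * v * ln \<bar>Y k\<bar>) * iexp (- v * ln x) / iexp (v * ln 2) = iexp (v * y k)"
    proof -
      have "\<i> * of_real (2 * v * ln \<bar>Y k\<bar>) + \<i> * of_real (- v * ln x) - \<i> * of_real (v * ln 2)
          = \<i> * complex_of_real (v * y k)"
        using x by (simp add: y_def ln_mult algebra_simps)
      then show ?thesis by (simp only: exp_add[symmetric] exp_diff[symmetric])
    qed
    have 5: "\<bar>Y k\<bar> powr (2 * \<gamma> - 2) * x powr (- \<gamma>) / 2 powr \<gamma> = c k"
      using x by (simp add: c_def powr_mult powr_minus divide_inverse)
    have alg: "of_real A * e1 * (of_real B * e2 / (of_real C * e3 * g)) = of_real (A * B / C) * (e1 * e2 / e3) * inverse g"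
      for A B C :: real and e1 e2 e3 g :: complex
      by (simp add: divide_inverse mult_ac)
    have z: "of_real \<alpha> + \<i> * of_real v = of_real \<gamma> - 1/2 + \<i> * of_real v"
      by (simp add: \<alpha>_def)
    have "complex_of_real \<bar>Y k\<bar> powr (2 * (of_real \<gamma> + \<i> * of_real v - 1)) *
      (complex_of_real x powr (- of_real \<gamma> - \<i> * of_real v) /
       (2 powr (of_real \<gamma> + \<i> * of_real v) * Gamma (of_real \<gamma> - 1/2 + \<i> * of_real v)))
      = of_real (\<bar>Y k\<bar> powr (2 * \<gamma> - 2) * x powr (- \<gamma>) / 2 powr \<gamma>) *
        (iexp (2 * v * ln \<bar>Y k\<bar>) * iexp (- v * ln x) / iexp (v * ln 2)) *
        rGamma (of_real \<alpha> + \<i> * of_real v)"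
      by (simp only: 1 2 3 alg z rGamma_inverse_Gamma)
    also have "\<dots> = of_real (c k) * rGamma_wave \<alpha> (y k) v"
      by (simp only: 4 5) (simp only: rGamma_wave_def mult.assoc)
    finally show ?thesis .
  qed (simp add: c_def)
  have integrand: "pT_estimator_integrand \<gamma> n Y x v = (\<Sum>k=1..n. of_real (c k / real n) * rGamma_wave \<alpha> (y k) v)" for v
    unfolding pT_estimator_integrand_def sum_distrib_left sum_distrib_right mult.assoc term_eq
    by (intro sum.cong refl) simp
  have cont: "continuous_on {-1/h..1/h} (pT_estimator_integrand \<gamma> n Y x)"
    unfolding integrand[abs_def] by (intro continuous_intros)
  have int: "rGamma_wave \<alpha> z integrable_on {-1/h..1/h}" for z
    by (intro integrable_continuous_real continuous_intros)
  have "(CLBINT v:{-1/h..1/h}. pT_estimator_integrand \<gamma> n Y x v) = integral {-1/h..1/h} (pT_estimator_integrand \<gamma> n Y x)"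
    by (intro set_borel_integral_eq_integral(2) borel_integrable_atLeastAtMost' cont)
  also have "\<dots> = (\<Sum>k=1..n. integral {-1/h..1/h} (\<lambda>v. of_real (c k / real n) * rGamma_wave \<alpha> (y k) v))"
    unfolding integrand[abs_def]
    by (intro Henstock_Kurzweil_Integration.integral_sum integrable_on_mult_right int) auto
  also have "\<dots> = (\<Sum>k=1..n. of_real (c k / real n) * integral {-1/h..1/h} (rGamma_wave \<alpha> (y k)))"
    by (simp only: Henstock_Kurzweil_Integration.integral_mult_right)
  finally have I: "(CLBINT v:{-1/h..1/h}. pT_estimator_integrand \<gamma> n Y x v)
      = (\<Sum>k=1..n. of_real (c k / real n) * integral {-1/h..1/h} (rGamma_wave \<alpha> (y k)))" .
  have "pT_estimator \<gamma> h n Y x = Re (of_real (1 / sqrt pi) * (\<Sum>k=1..n. of_real (c k / real n) * integral {-1/h..1/h} (rGamma_wave \<alpha> (y k))))"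
    unfolding pT_estimator_def I by simp
  also have "\<dots> = (\<Sum>k=1..n. c k / sqrt pi * Re (integral {-1/h..1/h} (rGamma_wave \<alpha> (y k))) / real n)"
    by (simp add: sum_distrib_left Re_sum sum_divide_distrib del: of_real_divide)
  also have "\<dots> = (\<Sum>k=1..n. score \<gamma> x (1 / h) (Y k)) / real n"
    by (simp add: score_def c_def y_def \<alpha>_def sum_divide_distrib)
  finally show ?thesis .
qed

text \<open>Used with \<open>y\<close> affine in \<open>ln \<bar>r\<bar>\<close>: the square of the logarithm costs only a small power of \<open>\<bar>r\<bar>\<close>.\<close>

lemma one_plus_max_square_le:
  fixes \<epsilon> y :: real
  assumes "\<epsilon> > 0"
  shows "(1 + max 0 y)\<^sup>2 \<le> (1 + 1 / \<epsilon>)\<^sup>2 * (1 + exp (2 * \<epsilon> * y))"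
proof -
  define t where "t = max 0 y"
  have t: "t \<ge> 0" by (simp add: t_def)
  have "\<epsilon> * t \<le> exp (\<epsilon> * t)" using exp_ge_add_one_self[of "\<epsilon> * t"] by linarith
  then have "t \<le> 1 / \<epsilon> * exp (\<epsilon> * t)" using assms by (simp add: field_simps)
  moreover have "1 \<le> exp (\<epsilon> * t)" using assms t by simp
  ultimately have "1 + t \<le> (1 + 1 / \<epsilon>) * exp (\<epsilon> * t)"
    unfolding distrib_right mult_1 by linarith
  then have "(1 + t)\<^sup>2 \<le> ((1 + 1 / \<epsilon>) * exp (\<epsilon> * t))\<^sup>2" using t by (intro power_mono) auto
  also have "\<dots> = (1 + 1 / \<epsilon>)\<^sup>2 * exp (2 * \<epsilon> * t)"
    by (simp add: power_mult_distrib exp_double[symmetric] mult.assoc)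
  also have "\<dots> \<le> (1 + 1 / \<epsilon>)\<^sup>2 * (1 + exp (2 * \<epsilon> * y))"
    by (intro mult_left_mono) (auto simp: t_def max_def)
  finally show ?thesis by (simp add: t_def)
qed

text \<open>The normalised scores \<open>g n\<close> are dominated by \<open>H\<close>, a multiple of \<open>\<bar>r\<bar> powr (2 \<gamma> - 2)\<close> times a logarithm,
  which is square integrable thanks to the moment of order \<open>2 q - 2 > 4 \<gamma> - 4\<close>. Pointwise they are asymptotic
  to the pure oscillation \<open>\<eta> n r = 2 K \<bar>r\<bar> powr (2 \<gamma> - 2) Re (\<i> \<theta>)\<close> with \<open>\<bar>\<theta>\<bar> \<rightarrow> l\<close> and a phase that rotates with
  speed \<open>2 V n\<close> in \<open>ln \<bar>r\<bar>\<close>. So the means vanish in the limit, and in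
  \<open>(Re p)\<^sup>2 = (\<bar>p\<bar>\<^sup>2 + Re (p\<^sup>2)) / 2\<close> only the first summand survives. It gives the limit variance
  \<open>2 K\<^sup>2 l\<^sup>2 \<integral> \<bar>r\<bar> powr (4 \<gamma> - 4)\<close>, which is positive.\<close>

lemma score_asymptotic_moments:
  fixes \<mu> :: "real measure" and V c :: "nat \<Rightarrow> real" and g :: "nat \<Rightarrow> real \<Rightarrow> real"
  assumes \<mu>: "real_distribution \<mu>"
    and \<gamma>: "\<gamma> > 1/2" and x: "x > 0" and q: "q > 2 * \<gamma> - 1"
    and V: "filterlim V at_top sequentially" and c: "c \<longlonglongrightarrow> 1"
    and int_g2: "integrable \<mu> (\<lambda>r. \<bar>r\<bar> powr (4 * \<gamma> - 4))"
    and int_q: "integrable \<mu> (\<lambda>r. \<bar>r\<bar> powr (2 * q - 2))"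
    and pos: "0 < (\<integral>r. \<bar>r\<bar> powr (4 * \<gamma> - 4) \<partial>\<mu>)"
    and osc1: "((\<lambda>u. CLINT r|\<mu>. osc_powr (2 * \<gamma> - 2) u r) \<longlongrightarrow> 0) at_top"
    and osc2: "((\<lambda>u. CLINT r|\<mu>. osc_powr (4 * \<gamma> - 4) u r) \<longlongrightarrow> 0) at_top"
  defines "g \<equiv> \<lambda>n r. c n * (ln (V n) / rGamma_growth (\<gamma> - 1/2) (V n)) * score \<gamma> x (V n) r"
  obtains \<sigma> H where "\<sigma> > 0" "H \<in> borel_measurable borel" "integrable \<mu> (\<lambda>r. (H r)\<^sup>2)"
    "eventually (\<lambda>n. \<forall>r. \<bar>g n r\<bar> \<le> H r) sequentially"
    "(\<lambda>n. (\<integral>r. (g n r)\<^sup>2 \<partial>\<mu>) - (\<integral>r. g n r \<partial>\<mu>)\<^sup>2) \<longlonglongrightarrow> \<sigma>\<^sup>2"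
proof -
  interpret \<mu>: real_distribution \<mu> by (rule \<mu>)
  note [measurable_cong] = \<mu>.events_eq_borel
  define \<alpha> where "\<alpha> = \<gamma> - 1/2"
  have \<alpha>: "\<alpha> > 0" using \<gamma> by (simp add: \<alpha>_def)
  define A where "A = rGamma_growth \<alpha>"
  define y where "y r = 2 * ln \<bar>r\<bar> - ln (2 * x)" for r
  define J where "J v z = Re (integral {-v..v} (rGamma_wave \<alpha> z)) * (ln v / A v)" for v z
  define K where "K = (2 * x) powr (- \<gamma>) / sqrt pi"
  have K: "K > 0" using x by (simp add: K_def)
  define G where "G r = \<bar>r\<bar> powr (2 * \<gamma> - 2)" for r :: real
  have G0: "G r \<ge> 0" for r by (simp add: G_def)
  have G2: "(G r)\<^sup>2 = \<bar>r\<bar> powr (4 * \<gamma> - 4)" for r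
    by (simp add: G_def power2_eq_square powr_add[symmetric])
  have g_eq: "g n r = c n * (K * G r * J (V n) (y r))" for n r
    unfolding g_def score_def K_def G_def J_def y_def A_def \<alpha>_def by (simp only: mult_ac)
  have g_meas[measurable]: "g n \<in> borel_measurable \<mu>" for n
    unfolding g_def by measurable
  have G_meas[measurable]: "G \<in> borel_measurable borel" unfolding G_def[abs_def] by measurable
  have int_g: "integrable \<mu> (\<lambda>r. \<bar>r\<bar> powr (2 * \<gamma> - 2))"
    unfolding G_def[symmetric]
    by (rule \<mu>.square_integrable_imp_integrable) (use int_g2 in \<open>simp_all add: G2\<close>)
  have y_meas[measurable]: "y \<in> borel_measurable borel" unfolding y_def[abs_def] by measurable
  obtain v0 C where v0: "v0 \<ge> 2" and C0: "C \<ge> 0"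
    and C': "\<And>v z. v \<ge> v0 \<Longrightarrow>
      \<bar>Re (integral {-v..v} (rGamma_wave \<alpha> z)) * (ln v / rGamma_growth \<alpha> v)\<bar> \<le> C * (1 + max 0 z)"
    by (rule normalised_rGamma_wave_integral_bound[OF \<alpha>]) (rule that; assumption?; blast)
  have C: "\<bar>J v z\<bar> \<le> C * (1 + max 0 z)" if "v \<ge> v0" for v z
    unfolding J_def A_def by (rule C'[OF that])
  define w where "w n = rGamma (of_real \<alpha> + \<i> * of_real (V n)) / of_real (A (V n))" for n
  obtain l where l: "l > 0" "(\<lambda>n. cmod (w n)) \<longlonglongrightarrow> l"
  proof -
    obtain l where l: "l > 0"
      "((\<lambda>v. cmod (rGamma (of_real \<alpha> + \<i> * of_real v) / of_real (A v))) \<longlongrightarrow> l) at_top"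
      unfolding A_def by (rule norm_rGamma_over_growth_tendsto[OF \<alpha>])
    have "(\<lambda>n. cmod (w n)) \<longlonglongrightarrow> l"
      unfolding w_def by (rule filterlim_compose[OF l(2) V])
    with l(1) show thesis by (rule that)
  qed
  define \<theta> where "\<theta> n r = iexp (V n * y r) * w n" for n r
  define \<eta> where "\<eta> n r = 2 * K * G r * Re (\<i> * \<theta> n r)" for n r
  have norm_\<theta>: "cmod (\<theta> n r) = cmod (w n)" for n r
    by (simp add: \<theta>_def norm_mult del: of_real_mult)
  have \<eta>_meas[measurable]: "\<eta> n \<in> borel_measurable \<mu>" for n
    unfolding \<eta>_def[abs_def] \<theta>_def by measurable
  define H where "H r = (2 * K * C + 2 * K * (l + 1)) * (G r * (1 + max 0 (y r)))" for r
  have H_meas[measurable]: "H \<in> borel_measurable borel" unfolding H_def[abs_def] by measurable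
  have H0: "H r \<ge> 0" for r
    unfolding H_def using K C0 l G0[of r] by (intro mult_nonneg_nonneg add_nonneg_nonneg) auto
  have ev: "eventually (\<lambda>n. (\<forall>r. \<bar>g n r\<bar> \<le> H r) \<and> (\<forall>r. \<bar>\<eta> n r\<bar> \<le> H r)) sequentially"
  proof -
    have "eventually (\<lambda>n. \<bar>c n\<bar> < 2 \<and> cmod (w n) < l + 1 \<and> v0 \<le> V n) sequentially"
      using V by (intro eventually_conj order_tendstoD(2)[OF tendsto_rabs[OF c]] order_tendstoD(2)[OF l(2)])
         (auto simp: filterlim_at_top)
    then show ?thesis
    proof eventually_elim
      case (elim n)
      show ?case
      proof (intro conjI allI)
        fix r
        have 1: "0 \<le> G r * (1 + max 0 (y r))" "G r * 1 \<le> G r * (1 + max 0 (y r))"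
          using G0[of r] mult_left_mono[OF _ G0[of r], of 1 "1 + max 0 (y r)"] by auto
        have "\<bar>g n r\<bar> = \<bar>c n\<bar> * (K * G r * \<bar>J (V n) (y r)\<bar>)"
          using K G0[of r] by (simp add: g_eq abs_mult)
        also have "\<dots> \<le> 2 * (K * G r * (C * (1 + max 0 (y r))))"
          using elim K G0[of r] C0 by (intro mult_mono mult_left_mono C) auto
        also have "\<dots> = (2 * K * C) * (G r * (1 + max 0 (y r)))" by simp
        also have "\<dots> \<le> H r" unfolding H_def
          using K l 1 by (intro mult_right_mono) auto
        finally show "\<bar>g n r\<bar> \<le> H r" .
        have "\<bar>Re (\<i> * \<theta> n r)\<bar> \<le> l + 1"
          using abs_Re_le_cmod[of "\<i> * \<theta> n r"] elim by (simp only: norm_mult norm_ii norm_\<theta>) simp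
        then have "\<bar>\<eta> n r\<bar> \<le> 2 * K * G r * (l + 1)"
          unfolding \<eta>_def abs_mult using K G0[of r] by (intro mult_mono) (auto simp del: times_complex.sel)
        also have "\<dots> = (2 * K * (l + 1)) * (G r * 1)" by simp
        also have "\<dots> \<le> (2 * K * (l + 1)) * (G r * (1 + max 0 (y r)))"
          by (rule mult_left_mono[OF 1(2)]) (use K l in simp)
        also have "\<dots> \<le> H r" unfolding H_def
          using K C0 1 by (intro mult_right_mono) auto
        finally show "\<bar>\<eta> n r\<bar> \<le> H r" .
      qed
    qed
  qed
  have H2: "integrable \<mu> (\<lambda>r. (H r)\<^sup>2)"
  proof -
    \<comment> \<open>Chosen such that \<open>(4 \<gamma> - 4) + 4 \<epsilon> = 2 q - 2\<close>.\<close>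
    define \<epsilon> where "\<epsilon> = (q - (2 * \<gamma> - 1)) / 2"
    have \<epsilon>: "\<epsilon> > 0" using q by (simp add: \<epsilon>_def)
    define D where "D = (2 * K * C + 2 * K * (l + 1))\<^sup>2 * (1 + 1 / \<epsilon>)\<^sup>2"
    have "integrable \<mu> (\<lambda>r. D * (\<bar>r\<bar> powr (4 * \<gamma> - 4) + (2 * x) powr (- 2 * \<epsilon>) * \<bar>r\<bar> powr (2 * q - 2)))"
      using int_g2 int_q by simp
    then show ?thesis
    proof (rule Bochner_Integration.integrable_bound)
      show "AE r in \<mu>. norm ((H r)\<^sup>2) \<le> norm (D * (\<bar>r\<bar> powr (4 * \<gamma> - 4) + (2 * x) powr (- 2 * \<epsilon>) * \<bar>r\<bar> powr (2 * q - 2)))"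
      proof (rule AE_I2)
        fix r
        have "(H r)\<^sup>2 = (2 * K * C + 2 * K * (l + 1))\<^sup>2 * ((G r)\<^sup>2 * (1 + max 0 (y r))\<^sup>2)"
          by (simp only: H_def power_mult_distrib)
        also have "\<dots> \<le> (2 * K * C + 2 * K * (l + 1))\<^sup>2 * ((G r)\<^sup>2 * ((1 + 1 / \<epsilon>)\<^sup>2 * (1 + exp (2 * \<epsilon> * y r))))"
          by (intro mult_left_mono one_plus_max_square_le \<epsilon>) auto
        also have "\<dots> = D * ((G r)\<^sup>2 * (1 + exp (2 * \<epsilon> * y r)))" by (simp add: D_def)
        also have "(G r)\<^sup>2 * (1 + exp (2 * \<epsilon> * y r)) = \<bar>r\<bar> powr (4 * \<gamma> - 4) + (2 * x) powr (- 2 * \<epsilon>) * \<bar>r\<bar> powr (2 * q - 2)"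
        proof (cases "r = 0")
          case False
          have "2 * \<epsilon> * y r = (4 * \<epsilon>) * ln \<bar>r\<bar> + (- 2 * \<epsilon>) * ln (2 * x)"
            by (simp add: y_def algebra_simps)
          then have "exp (2 * \<epsilon> * y r) = exp ((4 * \<epsilon>) * ln \<bar>r\<bar>) * exp ((- 2 * \<epsilon>) * ln (2 * x))"
            by (simp only: exp_add)
          also have "\<dots> = \<bar>r\<bar> powr (4 * \<epsilon>) * (2 * x) powr (- 2 * \<epsilon>)"
            using False x by (simp only: powr_def) simp
          finally have "(G r)\<^sup>2 * exp (2 * \<epsilon> * y r) = (2 * x) powr (- 2 * \<epsilon>) * \<bar>r\<bar> powr ((4 * \<gamma> - 4) + 4 * \<epsilon>)"
            by (simp only: G2 powr_add mult_ac)
          also have "(4 * \<gamma> - 4) + 4 * \<epsilon> = 2 * q - 2" by (simp add: \<epsilon>_def field_simps)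
          finally show ?thesis by (simp only: distrib_left G2 mult_1_right)
        qed (simp add: G2)
        finally show "norm ((H r)\<^sup>2) \<le> norm (D * (\<bar>r\<bar> powr (4 * \<gamma> - 4) + (2 * x) powr (- 2 * \<epsilon>) * \<bar>r\<bar> powr (2 * q - 2)))"
          by (simp add: D_def)
      qed
    qed measurable
  qed
  have point: "(\<lambda>n. g n r - \<eta> n r) \<longlonglongrightarrow> 0" for r
  proof -
    define j where "j n = J (V n) (y r)" for n
    have jlim: "(\<lambda>n. j n - 2 * Re (\<i> * \<theta> n r)) \<longlonglongrightarrow> 0"
    proof -
      have "\<i> * rGamma_wave \<alpha> (y r) (V n) / of_real (rGamma_growth \<alpha> (V n)) = \<i> * \<theta> n r" for n
        by (simp add: rGamma_wave_def \<theta>_def w_def A_def del: of_real_mult)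
      then show ?thesis
        using filterlim_compose[OF normalised_rGamma_wave_integral_tendsto[OF \<alpha>, of "y r"] V]
        unfolding j_def J_def A_def by (simp only:)
    qed
    have cj: "(\<lambda>n. (c n - 1) * j n) \<longlonglongrightarrow> 0"
    proof (rule Lim_null_comparison)
      have "eventually (\<lambda>n. v0 \<le> V n) sequentially" using V by (auto simp: filterlim_at_top)
      then show "eventually (\<lambda>n. norm ((c n - 1) * j n) \<le> \<bar>c n - 1\<bar> * (C * (1 + max 0 (y r)))) sequentially"
        by eventually_elim (auto simp: abs_mult j_def intro!: mult_left_mono C)
      have "(\<lambda>n. \<bar>c n - 1\<bar> * (C * (1 + max 0 (y r)))) \<longlonglongrightarrow> \<bar>1 - 1\<bar> * (C * (1 + max 0 (y r)))"
        by (intro tendsto_intros c)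
      then show "(\<lambda>n. \<bar>c n - 1\<bar> * (C * (1 + max 0 (y r)))) \<longlonglongrightarrow> 0" by simp
    qed
    have "(\<lambda>n. K * G r * ((c n - 1) * j n + (j n - 2 * Re (\<i> * \<theta> n r)))) \<longlonglongrightarrow> K * G r * (0 + 0)"
      by (intro tendsto_intros cj jlim)
    moreover have "K * G r * ((c n - 1) * j n + (j n - 2 * Re (\<i> * \<theta> n r))) = g n r - \<eta> n r" for n
      unfolding g_eq \<eta>_def j_def by (simp only: algebra_simps)
    ultimately show ?thesis by (simp only: add_0_right mult_zero_right)
  qed
  \<comment> \<open>The part of the phase that does not depend on \<open>r\<close> is pulled out of the integrals.\<close>
  have phase: "\<theta> n r = (iexp (- V n * ln (2 * x)) * w n) * iexp (2 * V n * ln \<bar>r\<bar>)" for n r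
  proof -
    have "iexp (V n * y r) = iexp (- V n * ln (2 * x)) * iexp (2 * V n * ln \<bar>r\<bar>)"
      unfolding exp_add[symmetric] by (simp add: y_def algebra_simps)
    then show ?thesis by (simp only: \<theta>_def mult_ac)
  qed
  have osc_lim: "(\<lambda>n. z n * (CLINT r|\<mu>. osc_powr s (k * V n) r)) \<longlonglongrightarrow> 0"
    if "Bseq z" "k > 0" "((\<lambda>u. CLINT r|\<mu>. osc_powr s u r) \<longlongrightarrow> 0) at_top" for z :: "nat \<Rightarrow> complex" and s k
  proof -
    have "filterlim (\<lambda>n. k * V n) at_top sequentially"
      using that(2) V by (intro filterlim_tendsto_pos_mult_at_top[OF tendsto_const])
    from filterlim_compose[OF that(3) this]
    have "(\<lambda>n. CLINT r|\<mu>. osc_powr s (k * V n) r) \<longlonglongrightarrow> 0" .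
    then have "Zfun (\<lambda>n. CLINT r|\<mu>. osc_powr s (k * V n) r) sequentially" by (simp add: tendsto_Zfun_iff)
    from bounded_bilinear.Bfun_prod_Zfun[OF bounded_bilinear_mult that(1) this]
    show ?thesis by (simp add: tendsto_Zfun_iff)
  qed
  have int_osc: "integrable \<mu> (osc_powr s u)" if "integrable \<mu> (\<lambda>r. \<bar>r\<bar> powr s)" for s u
    by (rule Bochner_Integration.integrable_bound[OF that]) (auto simp: norm_osc_powr)
  have mean_\<eta>: "(\<lambda>n. \<integral>r. \<eta> n r \<partial>\<mu>) \<longlonglongrightarrow> 0"
  proof -
    define z where "z n = of_real (2 * K) * \<i> * (iexp (- V n * ln (2 * x)) * w n)" for n
    have "Bseq z"
    proof (rule BfunI)
      show "eventually (\<lambda>n. norm (z n) \<le> 2 * K * (l + 1)) sequentially"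
        using order_tendstoD(2)[OF l(2), of "l + 1"] K
        by (auto elim!: eventually_mono simp: z_def norm_mult simp del: of_real_mult)
    qed
    have "\<eta> n r = Re (z n * osc_powr (2 * \<gamma> - 2) (2 * V n) r)" for n r
    proof -
      have "z n * osc_powr (2 * \<gamma> - 2) (2 * V n) r = of_real (2 * K * G r) * (\<i> * \<theta> n r)"
        unfolding phase z_def osc_powr_def G_def of_real_mult by (simp only: mult_ac)
      then show ?thesis by (simp add: \<eta>_def)
    qed
    then have "(\<integral>r. \<eta> n r \<partial>\<mu>) = Re (z n * (CLINT r|\<mu>. osc_powr (2 * \<gamma> - 2) (2 * V n) r))" for n
      using int_osc[OF int_g] by (simp del: times_complex.sel)
    moreover have "(\<lambda>n. Re (z n * (CLINT r|\<mu>. osc_powr (2 * \<gamma> - 2) (2 * V n) r))) \<longlonglongrightarrow> Re 0"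
      by (intro tendsto_Re osc_lim \<open>Bseq z\<close> osc1) simp
    ultimately show ?thesis by simp
  qed
  define m where "m = (\<integral>r. \<bar>r\<bar> powr (4 * \<gamma> - 4) \<partial>\<mu>)"
  have square_\<eta>: "(\<lambda>n. \<integral>r. (\<eta> n r)\<^sup>2 \<partial>\<mu>) \<longlonglongrightarrow> 2 * K\<^sup>2 * l\<^sup>2 * m"
  proof -
    define z where "z n = (iexp (- V n * ln (2 * x)) * w n)\<^sup>2" for n
    have "Bseq z"
    proof (rule BfunI)
      show "eventually (\<lambda>n. norm (z n) \<le> (l + 1)\<^sup>2) sequentially"
        using order_tendstoD(2)[OF l(2), of "l + 1"]
        by (auto elim!: eventually_mono simp: z_def norm_mult norm_power simp del: of_real_mult intro!: power_mono)
    qed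
    have sq: "(\<eta> n r)\<^sup>2 = 2 * K\<^sup>2 * ((cmod (w n))\<^sup>2 * \<bar>r\<bar> powr (4 * \<gamma> - 4) - Re (z n * osc_powr (4 * \<gamma> - 4) (4 * V n) r))" for n r
    proof -
      have re2: "(Re p)\<^sup>2 = ((cmod p)\<^sup>2 + Re (p\<^sup>2)) / 2" for p
        by (simp add: cmod_power2 Re_power2)
      have "(iexp (2 * V n * ln \<bar>r\<bar>))\<^sup>2 = iexp (4 * V n * ln \<bar>r\<bar>)"
        by (simp add: exp_double[symmetric] mult_ac)
      then have "\<bar>r\<bar> powr (4 * \<gamma> - 4) * Re ((\<theta> n r)\<^sup>2) = Re (of_real (\<bar>r\<bar> powr (4 * \<gamma> - 4)) * (z n * iexp (4 * V n * ln \<bar>r\<bar>)))"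
        unfolding phase power_mult_distrib[of _ "iexp (2 * V n * ln \<bar>r\<bar>)"] z_def[symmetric] by simp
      also have "of_real (\<bar>r\<bar> powr (4 * \<gamma> - 4)) * (z n * iexp (4 * V n * ln \<bar>r\<bar>)) = z n * osc_powr (4 * \<gamma> - 4) (4 * V n) r"
        by (simp only: osc_powr_def mult_ac)
      finally have e: "\<bar>r\<bar> powr (4 * \<gamma> - 4) * Re ((\<theta> n r)\<^sup>2) = Re (z n * osc_powr (4 * \<gamma> - 4) (4 * V n) r)" .
      have "(\<eta> n r)\<^sup>2 = 4 * K\<^sup>2 * \<bar>r\<bar> powr (4 * \<gamma> - 4) * (Re (\<i> * \<theta> n r))\<^sup>2"
        unfolding \<eta>_def power_mult_distrib G2 by simp
      also have "(Re (\<i> * \<theta> n r))\<^sup>2 = ((cmod (w n))\<^sup>2 - Re ((\<theta> n r)\<^sup>2)) / 2"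
        unfolding re2 by (simp add: norm_mult norm_\<theta> power_mult_distrib)
      also have "4 * K\<^sup>2 * \<bar>r\<bar> powr (4 * \<gamma> - 4) * (((cmod (w n))\<^sup>2 - Re ((\<theta> n r)\<^sup>2)) / 2)
         = 2 * K\<^sup>2 * ((cmod (w n))\<^sup>2 * \<bar>r\<bar> powr (4 * \<gamma> - 4) - \<bar>r\<bar> powr (4 * \<gamma> - 4) * Re ((\<theta> n r)\<^sup>2))"
        by (simp only: right_diff_distrib diff_divide_distrib mult_ac)
      finally show ?thesis unfolding e .
    qed
    have "(\<integral>r. (\<eta> n r)\<^sup>2 \<partial>\<mu>) = 2 * K\<^sup>2 * ((cmod (w n))\<^sup>2 * m - Re (z n * (CLINT r|\<mu>. osc_powr (4 * \<gamma> - 4) (4 * V n) r)))" for n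
    proof -
      have 1: "integrable \<mu> (\<lambda>r. z n * osc_powr (4 * \<gamma> - 4) (4 * V n) r)"
        by (intro integrable_mult_right int_osc int_g2)
      have 2: "integrable \<mu> (\<lambda>r. Re (z n * osc_powr (4 * \<gamma> - 4) (4 * V n) r))"
        by (rule integrable_Re[OF 1])
      have "(\<integral>r. (\<eta> n r)\<^sup>2 \<partial>\<mu>) = 2 * K\<^sup>2 * ((cmod (w n))\<^sup>2 * m - (\<integral>r. Re (z n * osc_powr (4 * \<gamma> - 4) (4 * V n) r) \<partial>\<mu>))"
        unfolding sq m_def using 2 int_g2 by (simp del: times_complex.sel)
      also have "(\<integral>r. Re (z n * osc_powr (4 * \<gamma> - 4) (4 * V n) r) \<partial>\<mu>) = Re (z n * (CLINT r|\<mu>. osc_powr (4 * \<gamma> - 4) (4 * V n) r))"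
        using 1 int_osc[OF int_g2] by (simp del: times_complex.sel)
      finally show ?thesis .
    qed
    moreover have "(\<lambda>n. 2 * K\<^sup>2 * ((cmod (w n))\<^sup>2 * m - Re (z n * (CLINT r|\<mu>. osc_powr (4 * \<gamma> - 4) (4 * V n) r))))
        \<longlonglongrightarrow> 2 * K\<^sup>2 * (l\<^sup>2 * m - Re 0)"
      by (intro tendsto_mult tendsto_diff tendsto_power tendsto_const l(2) tendsto_Re osc_lim \<open>Bseq z\<close> osc2) simp
    ultimately show ?thesis by (simp add: mult.assoc del: times_complex.sel)
  qed
  have bound_g: "eventually (\<lambda>n. \<forall>r. \<bar>g n r\<bar> \<le> H r) sequentially"
    using ev by eventually_elim blast
  show thesis
  proof
    show "K * l * sqrt (2 * m) > 0" using K l pos by (simp add: m_def)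
    show "H \<in> borel_measurable borel" "integrable \<mu> (\<lambda>r. (H r)\<^sup>2)" by (fact H_meas H2)+
    show "eventually (\<lambda>n. \<forall>r. \<bar>g n r\<bar> \<le> H r) sequentially" by fact
    have H0le: "\<bar>H r\<bar> = H r" for r using H0 by simp
    have int_g2n: "integrable \<mu> (\<lambda>r. (g n r)\<^sup>2)" if "\<forall>r. \<bar>g n r\<bar> \<le> H r" for n
      using that by (intro Bochner_Integration.integrable_bound[OF H2] AE_I2)
        (auto simp: H0 abs_le_square_iff[symmetric])
    have dsq: "(\<lambda>n. \<integral>r. (g n r)\<^sup>2 - (\<eta> n r)\<^sup>2 \<partial>\<mu>) \<longlonglongrightarrow> 0"
    proof (rule eventually_dominated_integral_tendsto_0)
      show "integrable \<mu> (\<lambda>r. (H r)\<^sup>2 + (H r)\<^sup>2)" using H2 by simp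
      show "eventually (\<lambda>n. \<forall>r. \<bar>(g n r)\<^sup>2 - (\<eta> n r)\<^sup>2\<bar> \<le> (H r)\<^sup>2 + (H r)\<^sup>2) sequentially"
        using ev
      proof eventually_elim
        case (elim n)
        show ?case
        proof
          fix r
          have "(g n r)\<^sup>2 \<le> (H r)\<^sup>2" "(\<eta> n r)\<^sup>2 \<le> (H r)\<^sup>2"
            using elim by (auto simp: abs_le_square_iff[symmetric] H0le)
          then show "\<bar>(g n r)\<^sup>2 - (\<eta> n r)\<^sup>2\<bar> \<le> (H r)\<^sup>2 + (H r)\<^sup>2"
            using zero_le_power2[of "g n r"] zero_le_power2[of "\<eta> n r"] by linarith
        qed
      qed
      fix r
      have "(\<lambda>n. \<bar>g n r - \<eta> n r\<bar> * (H r + H r)) \<longlonglongrightarrow> 0"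
        by (intro tendsto_mult_left_zero tendsto_rabs_zero point)
      moreover have "eventually (\<lambda>n. norm ((g n r)\<^sup>2 - (\<eta> n r)\<^sup>2) \<le> \<bar>g n r - \<eta> n r\<bar> * (H r + H r)) sequentially"
        using ev
      proof eventually_elim
        case (elim n)
        have "\<bar>g n r + \<eta> n r\<bar> \<le> H r + H r"
          using elim by (intro order.trans[OF abs_triangle_ineq] add_mono) auto
        moreover have "(g n r)\<^sup>2 - (\<eta> n r)\<^sup>2 = (g n r - \<eta> n r) * (g n r + \<eta> n r)"
          by (simp add: power2_eq_square algebra_simps)
        ultimately show ?case by (simp only: real_norm_def abs_mult) (intro mult_left_mono abs_ge_zero)
      qed
      ultimately show "(\<lambda>n. (g n r)\<^sup>2 - (\<eta> n r)\<^sup>2) \<longlonglongrightarrow> 0" by (rule Lim_null_comparison[rotated])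
    qed measurable
    have H1: "integrable \<mu> H"
      by (rule \<mu>.square_integrable_imp_integrable[OF _ H2]) measurable
    have diff: "(\<lambda>n. \<integral>r. g n r - \<eta> n r \<partial>\<mu>) \<longlonglongrightarrow> 0"
    proof (rule eventually_dominated_integral_tendsto_0[OF _ _ point])
      show "integrable \<mu> (\<lambda>r. H r + H r)" using H1 by simp
      show "eventually (\<lambda>n. \<forall>r. \<bar>g n r - \<eta> n r\<bar> \<le> H r + H r) sequentially"
        using ev by eventually_elim (intro allI order.trans[OF abs_triangle_ineq4] add_mono; blast)
    qed measurable
    have ints: "eventually (\<lambda>n. (\<integral>r. g n r - \<eta> n r \<partial>\<mu>) = (\<integral>r. g n r \<partial>\<mu>) - (\<integral>r. \<eta> n r \<partial>\<mu>) \<and>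
        (\<integral>r. (g n r)\<^sup>2 - (\<eta> n r)\<^sup>2 \<partial>\<mu>) = (\<integral>r. (g n r)\<^sup>2 \<partial>\<mu>) - (\<integral>r. (\<eta> n r)\<^sup>2 \<partial>\<mu>)) sequentially"
      using ev
    proof eventually_elim
      case (elim n)
      have 1: "integrable \<mu> f" if "f \<in> borel_measurable \<mu>" "\<forall>r. \<bar>f r\<bar> \<le> H r" for f
        using that by (intro Bochner_Integration.integrable_bound[OF H1] AE_I2) (auto simp: H0le)
      have 2: "integrable \<mu> (\<lambda>r. (f r)\<^sup>2)" if [measurable]: "f \<in> borel_measurable \<mu>" and "\<forall>r. \<bar>f r\<bar> \<le> H r" for f
        using that(2) by (intro Bochner_Integration.integrable_bound[OF H2] AE_I2)
          (auto simp: H0le abs_le_square_iff[symmetric])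
      show ?case
        using elim by (intro conjI Bochner_Integration.integral_diff 1 2) auto
    qed
    have "(\<lambda>n. ((\<integral>r. (g n r)\<^sup>2 - (\<eta> n r)\<^sup>2 \<partial>\<mu>) + (\<integral>r. (\<eta> n r)\<^sup>2 \<partial>\<mu>))
        - ((\<integral>r. g n r - \<eta> n r \<partial>\<mu>) + (\<integral>r. \<eta> n r \<partial>\<mu>))\<^sup>2) \<longlonglongrightarrow> (0 + 2 * K\<^sup>2 * l\<^sup>2 * m) - (0 + 0)\<^sup>2"
      by (intro tendsto_diff tendsto_add tendsto_power dsq square_\<eta> diff mean_\<eta>)
    moreover have "eventually (\<lambda>n. ((\<integral>r. (g n r)\<^sup>2 - (\<eta> n r)\<^sup>2 \<partial>\<mu>) + (\<integral>r. (\<eta> n r)\<^sup>2 \<partial>\<mu>))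
        - ((\<integral>r. g n r - \<eta> n r \<partial>\<mu>) + (\<integral>r. \<eta> n r \<partial>\<mu>))\<^sup>2 = (\<integral>r. (g n r)\<^sup>2 \<partial>\<mu>) - (\<integral>r. g n r \<partial>\<mu>)\<^sup>2) sequentially"
      using ints by eventually_elim simp
    ultimately have "(\<lambda>n. (\<integral>r. (g n r)\<^sup>2 \<partial>\<mu>) - (\<integral>r. g n r \<partial>\<mu>)\<^sup>2) \<longlonglongrightarrow> (0 + 2 * K\<^sup>2 * l\<^sup>2 * m) - (0 + 0)\<^sup>2"
      by (rule Lim_transform_eventually)
    moreover have "(0 + 2 * K\<^sup>2 * l\<^sup>2 * m) - (0 + 0)\<^sup>2 = (K * l * sqrt (2 * m))\<^sup>2"
      using pos by (simp add: power_mult_distrib m_def)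
    ultimately show "(\<lambda>n. (\<integral>r. (g n r)\<^sup>2 \<partial>\<mu>) - (\<integral>r. g n r \<partial>\<mu>)\<^sup>2) \<longlonglongrightarrow> (K * l * sqrt (2 * m))\<^sup>2"
      by (simp only:)
  qed
qed

theorem theorem2p9:
  fixes M :: "'a measure" and N :: "'b measure"
    and B :: "real \<Rightarrow> 'a \<Rightarrow> real" and T :: "'a \<Rightarrow> real" and p :: "real \<Rightarrow> real"
    and X :: "nat \<Rightarrow> 'b \<Rightarrow> real"
    and a b \<gamma> x c :: real and h \<rho> :: "nat \<Rightarrow> real"
  assumes B: "standard_brownian_motion M B"
    and T_nonneg: "\<And>\<omega>. \<omega> \<in> space M \<Longrightarrow> 0 \<le> T \<omega>"
    and p_nonneg: "\<And>t. 0 \<le> p t"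
    and T_density: "distributed M lborel T (\<lambda>t. ennreal (p t))"
    and T_indep_B: "prob_space.indep_set M
           (sets (vimage_algebra (space M) T borel))
           (sets (vimage_algebra (space M) (\<lambda>\<omega>. \<lambda>t\<in>{0..}. B t \<omega>) (\<Pi>\<^sub>M t\<in>{0..}. borel)))"
    and N: "prob_space N"
    and X_indep: "prob_space.indep_vars N (\<lambda>_. borel) X {1..}"
    and X_distr: "\<And>k. 1 \<le> k \<Longrightarrow> distr N borel (X k) = distr M borel (\<lambda>\<omega>. B (T \<omega>) \<omega>)"
    and ab: "0 \<le> a" "a < 1" "1 \<le> b"
    and strip: "{z. a < Re z \<and> Re z < b} \<subseteq> mellin_domain M T"
    and \<gamma>: "max a (3/4) < \<gamma>" "\<gamma> < b"
    and mellin_defined: "complex_of_real (2 * \<gamma> - 1) \<in> mellin_domain M T" "2 * \<gamma> - 1 < b"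
    and x: "0 < x"
    and deriv_nz: "\<exists>D. D \<noteq> 0 \<and>
           ((\<lambda>u::real. Gamma (of_real (2 * \<gamma> - 3/2) + \<i> * of_real u) *
                       mellin p (of_real (2 * \<gamma> - 1) + \<i> * of_real u))
             has_vector_derivative D) (at 0)"
    and mellin_int: "integrable lborel
           (\<lambda>u::real. cmod (mellin p (of_real (2 * \<gamma> - 1) + \<i> * of_real u)))"
    and h_pos: "\<And>n. 0 < h n" and h_lim: "h \<longlonglongrightarrow> 0"
    and c: "0 < c" and h_order: "h \<in> \<Theta>(\<lambda>n. c * inverse (ln (real n)))"
    and \<rho>: "\<rho> \<sim>[at_top] (\<lambda>n. real n powr (-1/2) * h n powr (\<gamma> - 1) *
                  inverse (ln (1 / h n)) * exp (pi / (2 * h n)))"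
  shows "\<exists>\<sigma>>0. weak_conv_m
           (\<lambda>n. distr N borel (\<lambda>\<omega>. inverse (\<rho> n) *
                  (pT_estimator \<gamma> (h n) n (\<lambda>k. X k \<omega>) x -
                   (\<integral>\<omega>'. pT_estimator \<gamma> (h n) n (\<lambda>k. X k \<omega>') x \<partial>N))))
           (density lborel (normal_density 0 \<sigma>))"
proof -
  interpret M: prob_space M using B by (simp add: standard_brownian_motion_def)
  interpret N: prob_space N by (rule N)
  have X_meas: "X k \<in> borel_measurable N" if "k \<ge> 1" for k
    using X_indep that unfolding N.indep_vars_def2 by auto
  have T_meas[measurable]: "T \<in> borel_measurable M"
    using distributed_measurable[OF T_density] by simp
  have p_meas: "(\<lambda>t. ennreal (p t)) \<in> borel_measurable lborel"
    by (rule distributed_borel_measurable[OF T_density])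
  have T_pos: "AE \<omega> in M. T \<omega> > 0"
  proof -
    have "AE t in density lborel (\<lambda>t. ennreal (p t)). t \<noteq> 0"
      using AE_lborel_singleton[of 0] by (subst AE_density[OF p_meas]) auto
    then have "AE t in distr M lborel T. t \<noteq> 0"
      by (simp only: distributed_distr_eq_density[OF T_density])
    then have "AE \<omega> in M. T \<omega> \<noteq> 0"
      by (rule AE_distrD[rotated]) simp
    moreover have "AE \<omega> in M. T \<omega> \<ge> 0" by (rule AE_I2) (rule T_nonneg)
    ultimately show ?thesis by eventually_elim simp
  qed
  define \<mu> where "\<mu> = distr M borel (\<lambda>\<omega>. B (T \<omega>) \<omega>)"
  have \<mu>_eq: "\<mu> = distr (distr M borel T \<Otimes>\<^sub>M std_normal_distribution) borel (\<lambda>(t, z). sqrt t * z)"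
    unfolding \<mu>_def by (rule distr_stopped_brownian_motion[OF B T_nonneg T_meas T_indep_B])
  have \<mu>_distr: "real_distribution \<mu>"
    unfolding \<mu>_def
    by (rule M.real_distribution_distr, rule measurable_stopped_brownian_motion[OF B T_nonneg T_meas T_indep_B])
  interpret \<mu>: real_distribution \<mu> by (rule \<mu>_distr)
  note [measurable_cong] = \<mu>.events_eq_borel
  have X_law: "distr N borel (X k) = \<mu>" if "1 \<le> k" for k
    unfolding \<mu>_def by (rule X_distr[OF that])

  \<comment> \<open>Any exponent strictly between \<open>max a (2 \<gamma> - 1)\<close> and \<open>b\<close> serves for the envelope.\<close>
  define q where "q = (max a (2 * \<gamma> - 1) + b) / 2"
  have q: "a < q" "q < b" "2 * \<gamma> - 1 < q"
    using mellin_defined(2) ab by (auto simp: q_def max_def)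
  have \<gamma>': "\<gamma> > 3/4" "a < \<gamma>" using \<gamma> by auto
  have moment: "integrable M (\<lambda>\<omega>. T \<omega> powr (r - 1))" if "a < r" "r < b" for r
  proof -
    have "complex_of_real r \<in> mellin_domain M T" using strip that by auto
    then show ?thesis by (simp add: mellin_domain_def)
  qed
  have moment\<gamma>: "integrable M (\<lambda>\<omega>. T \<omega> powr (2 * \<gamma> - 2))"
    using mellin_defined(1) by (simp add: mellin_domain_def)
  have s4: "4 * \<gamma> - 4 > -1" "integrable M (\<lambda>\<omega>. T \<omega> powr ((4 * \<gamma> - 4) / 2))"
  proof -
    show "4 * \<gamma> - 4 > -1" using \<gamma>' by simp
    have "(4 * \<gamma> - 4) / 2 = 2 * \<gamma> - 2" by simp
    then show "integrable M (\<lambda>\<omega>. T \<omega> powr ((4 * \<gamma> - 4) / 2))" using moment\<gamma> by (simp only:)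
  qed
  have s2: "2 * \<gamma> - 2 > -1" "integrable M (\<lambda>\<omega>. T \<omega> powr ((2 * \<gamma> - 2) / 2))"
    using \<gamma>' moment[OF \<gamma>'(2) \<gamma>(2)] by (simp_all add: diff_divide_distrib)
  have sq: "2 * q - 2 > -1" "integrable M (\<lambda>\<omega>. T \<omega> powr ((2 * q - 2) / 2))"
    using \<gamma>' q moment[OF q(1,2)] by (simp_all add: diff_divide_distrib)

  define V where "V n = 1 / h n" for n
  have V_lim: "filterlim V at_top sequentially"
    unfolding V_def[abs_def] inverse_eq_divide[symmetric]
    by (rule filterlim_inverse_at_top[OF h_lim]) (simp add: h_pos)
  define A where "A n = rGamma_growth (\<gamma> - 1/2) (V n)" for n
  define r where "r n = real n powr (-1/2) * h n powr (\<gamma> - 1) * inverse (ln (1 / h n)) * exp (pi / (2 * h n))" for n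
  have A_pos: "A n > 0" for n unfolding A_def V_def using h_pos[of n] by (intro rGamma_growth_pos) simp
  have r_eq: "r n = A n / (ln (V n) * sqrt (real n))" if "n > 0" for n
  proof -
    have e1: "h n powr (\<gamma> - 1) = V n powr (1 / 2 - (\<gamma> - 1 / 2))"
      using h_pos[of n] by (simp add: V_def powr_def ln_div algebra_simps)
    have e2: "real n powr (-1/2) = inverse (sqrt (real n))"
      using that powr_minus[of "real n" "1/2"] by (simp add: powr_half_sqrt)
    have e3: "exp (pi / (2 * h n)) = exp (pi * V n / 2)" by (simp add: V_def)
    have "r n = inverse (sqrt (real n)) * V n powr (1 / 2 - (\<gamma> - 1 / 2)) * inverse (ln (V n)) * exp (pi * V n / 2)"
      unfolding r_def e1 e2 e3 by (simp only: V_def)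
    then show ?thesis
      unfolding A_def rGamma_growth_def divide_inverse inverse_mult_distrib by (simp only: mult_ac)
  qed
  \<comment> \<open>Dividing the scores by \<open>\<rho>\<close> instead of the explicit rate multiplies them by a factor that tends to \<open>1\<close>.\<close>
  define c where "c n = r n / \<rho> n" for n
  define g where "g n s = c n * (ln (V n) / A n) * score \<gamma> x (V n) s" for n s
  have ev: "eventually (\<lambda>n. n > 0 \<and> V n > 1) sequentially"
    using V_lim by (intro eventually_conj eventually_gt_at_top) (simp add: filterlim_at_top_dense)
  have r_nz: "r n \<noteq> 0" if "n > 0" "V n > 1" for n
    using that A_pos[of n] by (simp add: r_eq)
  have c_lim: "c \<longlonglongrightarrow> 1"
  proof -
    have "r \<sim>[at_top] \<rho>" unfolding r_def[abs_def] by (rule asymp_equiv_symI[OF \<rho>])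
    then have "(\<lambda>n. if r n = 0 \<and> \<rho> n = 0 then 1 else r n / \<rho> n) \<longlonglongrightarrow> 1"
      by (rule asymp_equivD)
    moreover have "eventually (\<lambda>n. (if r n = 0 \<and> \<rho> n = 0 then 1 else r n / \<rho> n) = c n) sequentially"
      using ev by eventually_elim (simp add: c_def r_nz)
    ultimately show ?thesis by (rule Lim_transform_eventually)
  qed

  obtain \<sigma> H where \<sigma>: "\<sigma> > 0" and H_meas[measurable]: "H \<in> borel_measurable borel"
    and H2: "integrable \<mu> (\<lambda>s. (H s)\<^sup>2)"
    and bound: "eventually (\<lambda>n. \<forall>s. \<bar>g n s\<bar> \<le> H s) sequentially"
    and var: "(\<lambda>n. (\<integral>s. (g n s)\<^sup>2 \<partial>\<mu>) - (\<integral>s. g n s \<partial>\<mu>)\<^sup>2) \<longlonglongrightarrow> \<sigma>\<^sup>2"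
    unfolding g_def A_def
    by (rule score_asymptotic_moments[OF \<mu>_distr _ x q(3) V_lim c_lim
          M.integrable_normal_mixture_powr[OF T_meas T_pos s4, folded \<mu>_eq]
          M.integrable_normal_mixture_powr[OF T_meas T_pos sq, folded \<mu>_eq]
          M.integral_normal_mixture_powr_pos[OF T_meas T_pos s4, folded \<mu>_eq]
          M.normal_mixture_osc_powr_tendsto_0[OF T_meas T_pos s2, folded \<mu>_eq]
          M.normal_mixture_osc_powr_tendsto_0[OF T_meas T_pos s4, folded \<mu>_eq]])
       (use \<gamma>' in simp)
  have g_meas[measurable]: "g n \<in> borel_measurable borel" for n
    unfolding g_def[abs_def] by measurable
  have H1: "integrable \<mu> H"
    by (rule \<mu>.square_integrable_imp_integrable[OF _ H2]) measurable
  have clt: "weak_conv_m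
     (\<lambda>n. distr N borel (\<lambda>\<omega>. (\<Sum>k=1..n. g n (X k \<omega>) - (\<integral>s. g n s \<partial>\<mu>)) / sqrt (real n)))
     (density lborel (normal_density 0 \<sigma>))"
    by (rule weak_conv_iid_rows_dominated[OF N X_indep X_law g_meas H_meas H2 bound var \<sigma>])
  have "eventually (\<lambda>n. distr N borel (\<lambda>\<omega>. (\<Sum>k=1..n. g n (X k \<omega>) - (\<integral>s. g n s \<partial>\<mu>)) / sqrt (real n))
      = distr N borel (\<lambda>\<omega>. inverse (\<rho> n) *
                  (pT_estimator \<gamma> (h n) n (\<lambda>k. X k \<omega>) x -
                   (\<integral>\<omega>'. pT_estimator \<gamma> (h n) n (\<lambda>k. X k \<omega>') x \<partial>N)))) sequentially"
    using ev bound order_tendstoD(1)[OF c_lim zero_less_one]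
  proof eventually_elim
    case (elim n)
    define f where "f = score \<gamma> x (V n)"
    define S where "S = (\<integral>s. f s \<partial>\<mu>)"
    have f_meas[measurable]: "f \<in> borel_measurable borel" by (simp add: f_def)
    have n: "n > 0" "ln (V n) > 0" using elim by auto
    have \<rho>0: "\<rho> n \<noteq> 0" using elim by (auto simp: c_def)
    have g_f: "g n s = f s / (\<rho> n * sqrt (real n))" for s
      using n \<rho>0 A_pos[of n] by (simp add: g_def c_def r_eq f_def)
    have "integrable \<mu> (g n)"
      using elim by (intro Bochner_Integration.integrable_bound[OF H1] AE_I2) (auto intro: order.trans[OF _ abs_ge_self])
    then have "integrable \<mu> (\<lambda>s. g n s * (\<rho> n * sqrt (real n)))" by simp
    then have f_int: "integrable \<mu> f" using n \<rho>0 by (simp add: g_f)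
    have fX: "integrable N (\<lambda>\<omega>. f (X k \<omega>))" "(\<integral>\<omega>. f (X k \<omega>) \<partial>N) = S" if "k \<in> {1..n}" for k
    proof -
      have k: "1 \<le> k" using that by simp
      have [measurable]: "X k \<in> borel_measurable N" by (rule X_meas[OF k])
      show "integrable N (\<lambda>\<omega>. f (X k \<omega>))"
        using f_int unfolding X_law[OF k, symmetric] by (simp add: integrable_distr_eq)
      show "(\<integral>\<omega>. f (X k \<omega>) \<partial>N) = S"
        unfolding S_def X_law[OF k, symmetric] by (simp add: integral_distr)
    qed
    have est: "pT_estimator \<gamma> (h n) n Y x = (\<Sum>k=1..n. f (Y k)) / real n" for Y
      using pT_estimator_eq_mean_score[OF x] by (simp add: f_def V_def)
    have mean: "(\<integral>\<omega>'. pT_estimator \<gamma> (h n) n (\<lambda>k. X k \<omega>') x \<partial>N) = S"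
      unfolding est using n fX by (simp add: Bochner_Integration.integral_sum)
    have int_g: "(\<integral>s. g n s \<partial>\<mu>) = S / (\<rho> n * sqrt (real n))"
      by (simp add: g_f[abs_def] S_def)
    have "(\<Sum>k=1..n. g n (X k \<omega>) - (\<integral>s. g n s \<partial>\<mu>)) / sqrt (real n)
        = inverse (\<rho> n) * (pT_estimator \<gamma> (h n) n (\<lambda>k. X k \<omega>) x - S)" for \<omega>
    proof -
      have "(\<Sum>k=1..n. g n (X k \<omega>) - (\<integral>s. g n s \<partial>\<mu>)) / sqrt (real n)
        = ((\<Sum>k=1..n. f (X k \<omega>)) - real n * S) / (\<rho> n * sqrt (real n)) / sqrt (real n)"
        unfolding int_g unfolding g_f by (simp add: diff_divide_distrib sum_subtractf sum_divide_distrib)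
      also have "\<dots> = ((\<Sum>k=1..n. f (X k \<omega>)) - real n * S) / (\<rho> n * real n)"
        by (simp add: mult.assoc)
      also have "\<dots> = inverse (\<rho> n) * ((\<Sum>k=1..n. f (X k \<omega>)) / real n - S)"
        using n \<rho>0 by (simp add: field_simps)
      finally show ?thesis unfolding est .
    qed
    then show ?case unfolding mean by simp
  qed
  with clt have "weak_conv_m
           (\<lambda>n. distr N borel (\<lambda>\<omega>. inverse (\<rho> n) *
                  (pT_estimator \<gamma> (h n) n (\<lambda>k. X k \<omega>) x -
                   (\<integral>\<omega>'. pT_estimator \<gamma> (h n) n (\<lambda>k. X k \<omega>') x \<partial>N))))
           (density lborel (normal_density 0 \<sigma>))"
    by (rule weak_conv_m_eventually_cong)
  with \<sigma> show ?thesis by blast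
qed

end
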